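(* Let $\hat u_h\in\hat V^k_{h,0}$ solve the HHO problem $a_h(\hat u_h,\hat w_h)=(f,w_{\mathcal T})_{L^2(\Omega)}$ for all $\hat w_h=(w_{\mathcal T},w_{\mathcal F})\in\hat V^k_{h,0}$, with $f\in L^2(\Omega)$, and let the numerical fluxes be $$\phi_{\partial T}(\hat u_T)=-n_T\cdot\nabla R_T(\hat u_T)_{|\partial T}+h_T^{-1}(\tilde S_{\partial T}^*\circ\tilde S_{\partial T})(u_{T|\partial T}-u_{\partial T})\in V^k_{\partial T},\qquad\forall T\in\mathcal T.$$ The following holds: (i) (Equilibrium) For every mesh interface $F=\partial T_-\cap\partial T_+\cap H_F\in\mathcal F^i$, $\phi_{\partial T_-}(\hat u_{T_-})_{|F}+\phi_{\partial T_+}(\hat u_{T_+})_{|F}=0$. (ii) (Balance) For every mesh cell $T\in\mathcal T$, $(\nabla R_T(\hat u_T),\nabla q)_{L^2(T)}+(\phi_{\partial T}(\hat u_T),q)_{L^2(\partial T)}=(f,q)_{L^2(T)}$ for all $q\in\mathbb P^k_d(T)$. (iii) The identities (i) for all $F\in\mathcal F^i$ together with (ii) for all $T\in\mathcal T$ are an equivalent rewriting of the HHO problem that fully characterizes the HHO solution $\hat u_h\in\hat V^k_{h,0}$; that is, an element $\hat u_h\in\hat V^k_{h,0}$ solves the HHO problem if and only if it satisfies all of these identities.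
   Context: **Domain and mesh.** $\Omega\subset\mathbb R^d$, $d\ge2$, is an open bounded connected Lipschitz polyhedron. A mesh $\mathcal T$ is a finite collection of mutually disjoint open polyhedral cells $T$ whose closures cover $\overline\Omega$; $n_T$ is the unit outward normal and $h_T$ the diameter of $T$. A mesh face is a subset $F$ of an affine hyperplane $H_F$ that is either an interface $F=\partial T_-\cap\partial T_+\cap H_F$ for two distinct cells, or a boundary face $F=\partial T_-\cap\partial\Omega\cap H_F$; $\mathcal F^i$, $\mathcal F^b$ are the sets of interfaces and boundary faces, $\mathcal F=\mathcal F^i\cup\mathcal F^b$, and $\mathcal F_T$ is the set of faces composing $\partial T$. **HHO space.** Let $k\ge0$. $\mathbb P^k_d(T)$ is the space of restrictions to $T$ of $d$-variate real polynomials of total degree at most $k$; $\mathbb P^k_{d-1}(F)$ is the space of $(d-1)$-variate polynomials of degree at most $k$ on $F$ (composed with the inverse of an affine parametrization of $H_F$). Set $V^k_{\partial T}=\prod_{F\in\mathcal F_T}\mathbb P^k_{d-1}(F)$ and $\hat V^k_T=\mathbb P^k_d(T)\times V^k_{\partial T}$, with elements $\hat v_T=(v_T,v_{\partial T})$. The space $\hat V^k_h=\prod_{T\in\mathcal T}\mathbb P^k_d(T)\times\prod_{F\in\mathcal F}\mathbb P^k_{d-1}(F)$ has elements $\hat v_h=(v_{\mathcal T},v_{\mathcal F})$ with local components $\hat v_T=(v_T,v_{\partial T}=(v_F)_{F\in\mathcal F_T})$. $\hat V^k_{h,0}$ is the subspace where $v_F=0$ for all $F\in\mathcal F^b$. $\Pi^k_T,\Pi^k_{\partial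 T}$ are the $L^2$-orthogonal projections onto $\mathbb P^k_d(T)$, $V^k_{\partial T}$, and $I$ is the identity. **Operators and forms.** The reconstruction $R_T:\hat V^k_T\to\mathbb P^{k+1}_d(T)$ is defined by $(\nabla R_T(\hat v_T),\nabla q)_{L^2(T)}=-(v_T,\Delta q)_{L^2(T)}+(v_{\partial T},n_T\cdot\nabla q)_{L^2(\partial T)}$ for all $q\in\mathbb P^{k+1}_d(T)$ with zero mean on $T$, and $(R_T(\hat v_T),1)_{L^2(T)}=(v_T,1)_{L^2(T)}$. The stabilization is $S_{\partial T}(\hat v_T)=\Pi^k_{\partial T}\big(v_{T|\partial T}-v_{\partial T}+((I-\Pi^k_T)R_T(\hat v_T))_{|\partial T}\big)$. Set $a_h(\hat v_h,\hat w_h)=\sum_T\big\{(\nabla R_T(\hat v_T),\nabla R_T(\hat w_T))_{L^2(T)}+h_T^{-1}(S_{\partial T}(\hat v_T),S_{\partial T}(\hat w_T))_{L^2(\partial T)}\big\}$. The operator $\tilde S_{\partial T}:V^k_{\partial T}\to V^k_{\partial T}$ is $\tilde S_{\partial T}(\mu)=\Pi^k_{\partial T}\big(\mu-((I-\Pi^k_T)R_T(0,\mu))_{|\partial T}\big)$ (so that $S_{\partial T}(\hat v_T)=\tilde S_{\partial T}(v_{T|\partial T}-v_{\partial T})$), and $\tilde S_{\partial T}^*$ is its adjoint: $(\tilde S^*_{\partial T}(\lambda),\mu)_{L^2(\partial T)}=(\lambda,\tilde S_{\partial T}(\mu))_{L^2(\partial T)}$ for all $\lambda,\mu\in V^k_{\partial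 T}$.
   Formalization: The formal mesh additionally requires the outward normal n_T to be constant on each face of T; otherwise two nonconvex cells, or a cell and the boundary, can swap sides along one face, and the claim that the flux lies in V^k_{∂T} (and (i)) fails. *)

theory Defs
  imports "HOL-Analysis.Analysis"
begin

section \<open>Polyhedral domains, meshes and faces\<close>

text \<open>Taking the interior of a finite union of (closed, convex) polytopes allows nonconvex
  polyhedra and excludes slits, across which no outward normal exists.\<close>

definition open_polyhedral :: "(real^'d) set \<Rightarrow> bool" where
  "open_polyhedral T \<longleftrightarrow>
     (\<exists>\<P>. finite \<P> \<and> (\<forall>P\<in>\<P>. polytope P) \<and> T = interior (\<Union>\<P>))"

text \<open>Near each boundary point, the set is the strict epigraph, in the direction of some unit
  vector \<open>e\<close>, of a Lipschitz function defined on the orthogonal complement of \<open>e\<close>.\<close>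

definition lipschitz_boundary :: "(real^'d) set \<Rightarrow> bool" where
  "lipschitz_boundary \<Omega> \<longleftrightarrow>
     (\<forall>x\<in>frontier \<Omega>. \<exists>U e L \<phi>. open U \<and> x \<in> U \<and> norm e = 1 \<and>
        L-lipschitz_on {y. y \<bullet> e = 0} \<phi> \<and>
        \<Omega> \<inter> U = {y \<in> U. \<phi> (y - (y \<bullet> e) *\<^sub>R e) < y \<bullet> e})"

definition lipschitz_polyhedron :: "(real^'d) set \<Rightarrow> bool" where
  "lipschitz_polyhedron \<Omega> \<longleftrightarrow>
     \<Omega> \<noteq> {} \<and> open \<Omega> \<and> bounded \<Omega> \<and> connected \<Omega> \<and> open_polyhedral \<Omega> \<and> lipschitz_boundary \<Omega>"

definition hyperplane :: "(real^'d) set \<Rightarrow> bool" where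
  "hyperplane H \<longleftrightarrow> (\<exists>n b. n \<noteq> 0 \<and> H = {x. n \<bullet> x = b})"

text \<open>\<open>F \<subseteq> H\<close> has nonempty interior relative to \<open>H\<close>. Intersections of boundaries of smaller
  dimension (edges, vertices) are thereby not faces, and \<open>H\<close> is determined by \<open>F\<close> as
  \<open>affine hull F\<close>.\<close>

definition solid_in :: "(real^'d) set \<Rightarrow> (real^'d) set \<Rightarrow> bool" where
  "solid_in H F \<longleftrightarrow> affine hull F = H \<and> rel_interior F \<noteq> {}"

definition is_interface ::
  "(real^'d) set set \<Rightarrow> (real^'d) set \<Rightarrow> (real^'d) set \<Rightarrow> (real^'d) set \<Rightarrow> bool" where
  "is_interface \<T> Tm Tp F \<longleftrightarrow> Tm \<in> \<T> \<and> Tp \<in> \<T> \<and> Tm \<noteq> Tp \<and>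
     (\<exists>H. hyperplane H \<and> F = frontier Tm \<inter> frontier Tp \<inter> H \<and> solid_in H F)"

definition interfaces :: "(real^'d) set set \<Rightarrow> (real^'d) set set" where
  "interfaces \<T> = {F. \<exists>Tm Tp. is_interface \<T> Tm Tp F}"

definition boundary_faces :: "(real^'d) set \<Rightarrow> (real^'d) set set \<Rightarrow> (real^'d) set set" where
  "boundary_faces \<Omega> \<T> = {F. \<exists>Tm\<in>\<T>. \<exists>H. hyperplane H \<and>
     F = frontier Tm \<inter> frontier \<Omega> \<inter> H \<and> solid_in H F}"

definition faces :: "(real^'d) set \<Rightarrow> (real^'d) set set \<Rightarrow> (real^'d) set set" where
  "faces \<Omega> \<T> = interfaces \<T> \<union> boundary_faces \<Omega> \<T>"

definition cell_faces ::
  "(real^'d) set \<Rightarrow> (real^'d) set set \<Rightarrow> (real^'d) set \<Rightarrow> (real^'d) set set" where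
  "cell_faces \<Omega> \<T> T = {F \<in> faces \<Omega> \<T>. F \<subseteq> frontier T}"

text \<open>\<open>n\<close> is the unit outward normal to \<open>T\<close> at the boundary point \<open>x\<close> around which \<open>T\<close> is a
  half-ball.\<close>

definition outward_normal :: "(real^'d) set \<Rightarrow> real^'d \<Rightarrow> real^'d \<Rightarrow> bool" where
  "outward_normal T x n \<longleftrightarrow> norm n = 1 \<and>
     (\<exists>e>0. \<forall>y\<in>ball x e. y \<in> T \<longleftrightarrow> (y - x) \<bullet> n < 0)"

text \<open>The last clause says that \<open>n\<^sub>T\<close> is constant on each face of \<open>T\<close>, as is needed for
  \<open>n\<^sub>T \<cdot> \<nabla>q\<close> to be a polynomial on the face. It is automatic for convex cells, but two interlocking
  nonconvex cells may exchange sides along one and the same set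
  \<open>\<partial>T\<^sub>- \<inter> \<partial>T\<^sub>+ \<inter> H\<close>.\<close>

definition is_mesh :: "(real^'d) set \<Rightarrow> (real^'d) set set \<Rightarrow> bool" where
  "is_mesh \<Omega> \<T> \<longleftrightarrow>
     finite \<T> \<and> pairwise disjnt \<T> \<and>
     (\<forall>T\<in>\<T>. T \<noteq> {} \<and> open_polyhedral T) \<and>
     (\<Union>T\<in>\<T>. closure T) = closure \<Omega> \<and>
     (\<forall>T\<in>\<T>. \<forall>F\<in>cell_faces \<Omega> \<T> T. \<forall>x\<in>rel_interior F. \<forall>y\<in>rel_interior F. \<forall>m n.
        outward_normal T x m \<longrightarrow> outward_normal T y n \<longrightarrow> m = n)"

text \<open>The constant value of \<open>n\<^sub>T\<close> on the face \<open>F\<close> of \<open>T\<close>.\<close>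

definition face_normal :: "(real^'d) set \<Rightarrow> (real^'d) set \<Rightarrow> real^'d" where
  "face_normal T F = (THE n. \<exists>x\<in>rel_interior F. outward_normal T x n)"


section \<open>Polynomial spaces\<close>

definition multi_indices :: "'i set \<Rightarrow> nat \<Rightarrow> ('i \<Rightarrow> nat) set" where
  "multi_indices I k = {\<alpha>. (\<forall>i. i \<notin> I \<longrightarrow> \<alpha> i = 0) \<and> (\<Sum>i\<in>I. \<alpha> i) \<le> k}"

definition poly_funs :: "'i set \<Rightarrow> nat \<Rightarrow> (('i \<Rightarrow> real) \<Rightarrow> real) set" where
  "poly_funs I k = {p. \<exists>c :: ('i \<Rightarrow> nat) \<Rightarrow> real.
     p = (\<lambda>\<xi>. \<Sum>\<alpha>\<in>multi_indices I k. c \<alpha> * (\<Prod>i\<in>I. \<xi> i ^ \<alpha> i))}"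

text \<open>An element of \<open>\<P>\<^sup>k\<^sub>d(T)\<close> is represented by the polynomial function on the whole space, which is
  determined by its restriction to the nonempty open set \<open>T\<close>; its trace on \<open>\<partial>T\<close> is then its
  value there.\<close>

definition cell_polys :: "nat \<Rightarrow> (real^'d \<Rightarrow> real) set" where
  "cell_polys k = {v. \<exists>p\<in>poly_funs (UNIV :: 'd set) k. \<forall>x. v x = p (\<lambda>i. x $ i)}"

text \<open>Coordinates \<open>\<xi>\<^sub>0, \<dots>, \<xi>\<^sub>d\<^sub>-\<^sub>2\<close> on a hyperplane are functions on \<open>{..<d-1}\<close>, extensional so that
  an affine parametrization can be required to be a bijection.\<close>

abbreviation hyp_coords :: "'d itself \<Rightarrow> (nat \<Rightarrow> real) set" where
  "hyp_coords d \<equiv> {..<CARD('d) - 1} \<rightarrow>\<^sub>E UNIV"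

definition affine_map :: "real^'d \<Rightarrow> (nat \<Rightarrow> real^'d) \<Rightarrow> (nat \<Rightarrow> real) \<Rightarrow> real^'d" where
  "affine_map a t \<xi> = a + (\<Sum>i<CARD('d) - 1. \<xi> i *\<^sub>R t i)"

definition face_polys :: "nat \<Rightarrow> (real^'d) set \<Rightarrow> (real^'d \<Rightarrow> real) set" where
  "face_polys k F = {g \<in> extensional F. \<exists>a t. \<exists>p\<in>poly_funs {..<CARD('d) - 1} k.
     bij_betw (affine_map a t) (hyp_coords TYPE('d)) (affine hull F) \<and>
     (\<forall>x\<in>F. g x = p (inv_into (hyp_coords TYPE('d)) (affine_map a t) x))}"


section \<open>Integrals and differential operators\<close>

text \<open>The \<open>(d-1)\<close>-dimensional Lebesgue measure on the hyperplane \<open>n \<cdot> x = b\<close> with \<open>\<bar>n\<bar> = 1\<close>: the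
  measure of a part of the hyperplane is the volume of the right cylinder of height one above it,
  so we project the Lebesgue measure of a slab of thickness one orthogonally.\<close>

definition hyperplane_measure :: "real^'d \<Rightarrow> real \<Rightarrow> (real^'d) measure" where
  "hyperplane_measure n b =
     distr (restrict_space lborel {x. b \<le> n \<bullet> x \<and> n \<bullet> x \<le> b + 1}) borel
       (\<lambda>x. x - (n \<bullet> x - b) *\<^sub>R n)"

definition surface_measure :: "(real^'d) set \<Rightarrow> (real^'d) measure" where
  "surface_measure F = restrict_space
     (SOME M. \<exists>n b. norm n = 1 \<and> affine hull F = {x. n \<bullet> x = b} \<and> M = hyperplane_measure n b) F"

definition L2_fun :: "(real^'d) set \<Rightarrow> (real^'d \<Rightarrow> real) \<Rightarrow> bool" where
  "L2_fun S f \<longleftrightarrow>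
     f \<in> borel_measurable (lebesgue_on S) \<and> integrable (lebesgue_on S) (\<lambda>x. (f x)\<^sup>2)"

definition ip_cell :: "(real^'d) set \<Rightarrow> (real^'d \<Rightarrow> real) \<Rightarrow> (real^'d \<Rightarrow> real) \<Rightarrow> real" where
  "ip_cell T u v = (\<integral>x. u x * v x \<partial>lebesgue_on T)"

definition ip_cell_vec ::
  "(real^'d) set \<Rightarrow> (real^'d \<Rightarrow> real^'d) \<Rightarrow> (real^'d \<Rightarrow> real^'d) \<Rightarrow> real" where
  "ip_cell_vec T U V = (\<integral>x. U x \<bullet> V x \<partial>lebesgue_on T)"

text \<open>Functions on \<open>\<partial>T\<close> are families indexed by the set \<open>B\<close> of the faces of \<open>T\<close>, which cover
  \<open>\<partial>T\<close> and overlap in null sets only.\<close>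

type_synonym 'd face_family = "(real^'d) set \<Rightarrow> real^'d \<Rightarrow> real"

definition ip_bd :: "(real^'d) set set \<Rightarrow> 'd face_family \<Rightarrow> 'd face_family \<Rightarrow> real" where
  "ip_bd B \<eta> \<mu> = (\<Sum>F\<in>B. \<integral>x. \<eta> F x * \<mu> F x \<partial>surface_measure F)"

definition grad :: "(real^'d \<Rightarrow> real) \<Rightarrow> real^'d \<Rightarrow> real^'d" where
  "grad v x = (THE D. GDERIV v x :> D)"

definition laplacian :: "(real^'d \<Rightarrow> real) \<Rightarrow> real^'d \<Rightarrow> real" where
  "laplacian v x = (\<Sum>i\<in>UNIV. grad (\<lambda>y. grad v y $ i) x $ i)"


section \<open>Local HHO operators\<close>

text \<open>In this section \<open>T\<close> is a cell and \<open>B\<close> the set of its faces.\<close>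

definition bd_space :: "nat \<Rightarrow> (real^'d) set set \<Rightarrow> 'd face_family set" where
  "bd_space k B = (\<Pi>\<^sub>E F\<in>B. face_polys k F)"

definition bd_trace :: "(real^'d) set set \<Rightarrow> (real^'d \<Rightarrow> real) \<Rightarrow> 'd face_family" where
  "bd_trace B v = (\<lambda>F\<in>B. \<lambda>x\<in>F. v x)"

definition bd_diff ::
  "(real^'d) set set \<Rightarrow> 'd face_family \<Rightarrow> 'd face_family \<Rightarrow> 'd face_family" where
  "bd_diff B \<eta> \<mu> = (\<lambda>F\<in>B. \<lambda>x\<in>F. \<eta> F x - \<mu> F x)"

definition normal_deriv ::
  "(real^'d) set \<Rightarrow> (real^'d) set set \<Rightarrow> (real^'d \<Rightarrow> real) \<Rightarrow> 'd face_family" where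
  "normal_deriv T B q = (\<lambda>F\<in>B. \<lambda>x\<in>F. face_normal T F \<bullet> grad q x)"

definition proj_cell :: "nat \<Rightarrow> (real^'d) set \<Rightarrow> (real^'d \<Rightarrow> real) \<Rightarrow> (real^'d \<Rightarrow> real)" where
  "proj_cell k T u = (THE p. p \<in> cell_polys k \<and>
     (\<forall>q\<in>cell_polys k. ip_cell T (\<lambda>x. u x - p x) q = 0))"

definition proj_bd :: "nat \<Rightarrow> (real^'d) set set \<Rightarrow> 'd face_family \<Rightarrow> 'd face_family" where
  "proj_bd k B \<eta> = (THE \<mu>. \<mu> \<in> bd_space k B \<and>
     (\<forall>\<nu>\<in>bd_space k B. ip_bd B (bd_diff B \<eta> \<mu>) \<nu> = 0))"

definition recon ::
  "nat \<Rightarrow> (real^'d) set \<Rightarrow> (real^'d) set set \<Rightarrow> (real^'d \<Rightarrow> real) \<times> 'd face_family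
    \<Rightarrow> (real^'d \<Rightarrow> real)" where
  "recon k T B v = (THE r. r \<in> cell_polys (k + 1) \<and>
     (\<forall>q\<in>cell_polys (k + 1). ip_cell T q (\<lambda>x. 1) = 0 \<longrightarrow>
        ip_cell_vec T (grad r) (grad q) =
          - ip_cell T (fst v) (laplacian q) + ip_bd B (snd v) (normal_deriv T B q)) \<and>
     ip_cell T r (\<lambda>x. 1) = ip_cell T (fst v) (\<lambda>x. 1))"

definition recon_fluct ::
  "nat \<Rightarrow> (real^'d) set \<Rightarrow> (real^'d) set set \<Rightarrow> (real^'d \<Rightarrow> real) \<times> 'd face_family
    \<Rightarrow> (real^'d \<Rightarrow> real)" where
  "recon_fluct k T B v = (\<lambda>x. recon k T B v x - proj_cell k T (recon k T B v) x)"

definition stab ::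
  "nat \<Rightarrow> (real^'d) set \<Rightarrow> (real^'d) set set \<Rightarrow> (real^'d \<Rightarrow> real) \<times> 'd face_family
    \<Rightarrow> 'd face_family" where
  "stab k T B v = proj_bd k B
     (\<lambda>F\<in>B. \<lambda>x\<in>F. fst v x - snd v F x + recon_fluct k T B v x)"

definition stab_tilde ::
  "nat \<Rightarrow> (real^'d) set \<Rightarrow> (real^'d) set set \<Rightarrow> 'd face_family \<Rightarrow> 'd face_family" where
  "stab_tilde k T B \<mu> = proj_bd k B (bd_diff B \<mu> (bd_trace B (recon_fluct k T B (\<lambda>x. 0, \<mu>))))"

definition stab_tilde_adj ::
  "nat \<Rightarrow> (real^'d) set \<Rightarrow> (real^'d) set set \<Rightarrow> 'd face_family \<Rightarrow> 'd face_family" where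
  "stab_tilde_adj k T B \<eta> = (THE \<nu>. \<nu> \<in> bd_space k B \<and>
     (\<forall>\<mu>\<in>bd_space k B. ip_bd B \<nu> \<mu> = ip_bd B \<eta> (stab_tilde k T B \<mu>)))"

definition num_flux ::
  "nat \<Rightarrow> (real^'d) set \<Rightarrow> (real^'d) set set \<Rightarrow> (real^'d \<Rightarrow> real) \<times> 'd face_family
    \<Rightarrow> 'd face_family" where
  "num_flux k T B u = (\<lambda>F\<in>B. \<lambda>x\<in>F.
     - normal_deriv T B (recon k T B u) F x +
     inverse (diameter T) *
       (stab_tilde_adj k T B \<circ> stab_tilde k T B) (bd_diff B (bd_trace B (fst u)) (snd u)) F x)"


section \<open>The global HHO problem\<close>

type_synonym 'd hho = "((real^'d) set \<Rightarrow> real^'d \<Rightarrow> real) \<times> 'd face_family"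

definition hho_space :: "nat \<Rightarrow> (real^'d) set \<Rightarrow> (real^'d) set set \<Rightarrow> 'd hho set" where
  "hho_space k \<Omega> \<T> = (\<Pi>\<^sub>E T\<in>\<T>. cell_polys k) \<times> (\<Pi>\<^sub>E F\<in>faces \<Omega> \<T>. face_polys k F)"

definition hho_space0 :: "nat \<Rightarrow> (real^'d) set \<Rightarrow> (real^'d) set set \<Rightarrow> 'd hho set" where
  "hho_space0 k \<Omega> \<T> =
     {v \<in> hho_space k \<Omega> \<T>. \<forall>F\<in>boundary_faces \<Omega> \<T>. \<forall>x\<in>F. snd v F x = 0}"

definition local_comp ::
  "(real^'d) set \<Rightarrow> (real^'d) set set \<Rightarrow> 'd hho \<Rightarrow> (real^'d) set
    \<Rightarrow> (real^'d \<Rightarrow> real) \<times> 'd face_family" where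
  "local_comp \<Omega> \<T> v T = (fst v T, restrict (snd v) (cell_faces \<Omega> \<T> T))"

definition recon_at ::
  "nat \<Rightarrow> (real^'d) set \<Rightarrow> (real^'d) set set \<Rightarrow> 'd hho \<Rightarrow> (real^'d) set
    \<Rightarrow> (real^'d \<Rightarrow> real)" where
  "recon_at k \<Omega> \<T> v T = recon k T (cell_faces \<Omega> \<T> T) (local_comp \<Omega> \<T> v T)"

definition stab_at ::
  "nat \<Rightarrow> (real^'d) set \<Rightarrow> (real^'d) set set \<Rightarrow> 'd hho \<Rightarrow> (real^'d) set
    \<Rightarrow> 'd face_family" where
  "stab_at k \<Omega> \<T> v T = stab k T (cell_faces \<Omega> \<T> T) (local_comp \<Omega> \<T> v T)"

definition flux_at ::
  "nat \<Rightarrow> (real^'d) set \<Rightarrow> (real^'d) set set \<Rightarrow> 'd hho \<Rightarrow> (real^'d) set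
    \<Rightarrow> 'd face_family" where
  "flux_at k \<Omega> \<T> v T = num_flux k T (cell_faces \<Omega> \<T> T) (local_comp \<Omega> \<T> v T)"

definition a_h ::
  "nat \<Rightarrow> (real^'d) set \<Rightarrow> (real^'d) set set \<Rightarrow> 'd hho \<Rightarrow> 'd hho \<Rightarrow> real" where
  "a_h k \<Omega> \<T> v w = (\<Sum>T\<in>\<T>.
     ip_cell_vec T (grad (recon_at k \<Omega> \<T> v T)) (grad (recon_at k \<Omega> \<T> w T)) +
     inverse (diameter T) *
       ip_bd (cell_faces \<Omega> \<T> T) (stab_at k \<Omega> \<T> v T) (stab_at k \<Omega> \<T> w T))"

text \<open>The function on \<open>\<Omega>\<close> equal to \<open>w\<^sub>T\<close> on each cell (and zero on the null set outside the
  cells).\<close>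

definition broken :: "(real^'d) set set \<Rightarrow> ((real^'d) set \<Rightarrow> real^'d \<Rightarrow> real) \<Rightarrow> real^'d \<Rightarrow> real"
  where "broken \<T> w x = (\<Sum>T\<in>\<T>. indicator T x * w T x)"

definition solves_hho ::
  "nat \<Rightarrow> (real^'d) set \<Rightarrow> (real^'d) set set \<Rightarrow> (real^'d \<Rightarrow> real) \<Rightarrow> 'd hho \<Rightarrow> bool" where
  "solves_hho k \<Omega> \<T> f u \<longleftrightarrow> u \<in> hho_space0 k \<Omega> \<T> \<and>
     (\<forall>w\<in>hho_space0 k \<Omega> \<T>. a_h k \<Omega> \<T> u w = ip_cell \<Omega> f (broken \<T> (fst w)))"

definition flux_equilibrium ::
  "nat \<Rightarrow> (real^'d) set \<Rightarrow> (real^'d) set set \<Rightarrow> 'd hho \<Rightarrow> bool" where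
  "flux_equilibrium k \<Omega> \<T> u \<longleftrightarrow>
     (\<forall>Tm Tp F. is_interface \<T> Tm Tp F \<longrightarrow>
        (\<forall>x\<in>F. flux_at k \<Omega> \<T> u Tm F x + flux_at k \<Omega> \<T> u Tp F x = 0))"

definition flux_balance ::
  "nat \<Rightarrow> (real^'d) set \<Rightarrow> (real^'d) set set \<Rightarrow> (real^'d \<Rightarrow> real) \<Rightarrow> 'd hho \<Rightarrow> bool" where
  "flux_balance k \<Omega> \<T> f u \<longleftrightarrow>
     (\<forall>T\<in>\<T>. \<forall>q\<in>cell_polys k.
        ip_cell_vec T (grad (recon_at k \<Omega> \<T> u T)) (grad q) +
        ip_bd (cell_faces \<Omega> \<T> T) (flux_at k \<Omega> \<T> u T) (bd_trace (cell_faces \<Omega> \<T> T) q) =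
        ip_cell T f q)"

end

(* An HHO reconstruction reproduces polynomials of degree k on the cell from their traces, which is the
   divergence theorem for polynomials on polyhedral cells. Consequently the stabilization is the boundary
   operator applied to the difference between cell trace and face unknown, and the cell contribution to
   a_h(u,w) becomes the flux balance tested with w_T minus the flux tested with the face unknowns of w.
   Testing with functions supported on one cell gives the balance; testing with the sum of the two
   fluxes on one interface gives the equilibrium, since an interface belongs to exactly two cells.
   Conversely, summing the balances makes the interface contributions cancel.

   The divergence theorem is proved without charts. The cells and the domain are unions of cells of one
   finite hyperplane arrangement, and at a point of exactly one hyperplane every cell is locally empty,
   a half ball or a ball. Translating the cell by t v and dividing by t concentrates the mass in thin
   slabs around the hyperplanes, whose limit is the hyperplane measure, as that is itself the projection
   of a slab. *)

theory Submission
  imports Defs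
begin

section \<open>Linear functionals and polynomial functions\<close>

text \<open>The difficulty is that faces are given only as sets
  \<open>frontier S \<inter> frontier S' \<inter> H\<close> of possibly nonconvex cells, and that an
  outward normal exists only at part of their points. Every question about faces is therefore
  decided at generic points, those lying on exactly one hyperplane of the arrangement. They have
  full surface measure, and each of the two sides there belongs to at most one cell, so that
  counting cells becomes propositional logic. It matters that a cell is the interior of a compact
  union: a set present on both sides of the hyperplane also contains the points in between. The
  operators are definite descriptions, so existence and uniqueness precede any computation. Both
  come from a Riesz lemma on coefficient vectors, for a form that is only semidefinite: polynomials
  on a face are handled as restrictions of polynomials in all d variables, and different
  coefficients may then give the same function. Polynomials live on the whole space, so a vanishing
  integral of a square over a cell is already an identity on the whole space.\<close>

text \<open>The index set grows by one element at a time, as in Gram-Schmidt orthogonalisation.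
  \<open>Q\<close> may be degenerate because the parametrisations used later need not be injective;
  \<open>null\<close> is the solvability condition that this costs.\<close>

lemma riesz_coeff:
  fixes Q :: "('i \<Rightarrow> real) \<Rightarrow> ('i \<Rightarrow> real) \<Rightarrow> real" and L :: "('i \<Rightarrow> real) \<Rightarrow> real"
  assumes fin: "finite I"
    and Qlin: "\<And>a c c' e. Q (\<lambda>i. a * c i + c' i) e = a * Q c e + Q c' e"
    and Qsym: "\<And>c e. Q c e = Q e c"
    and Qpos: "\<And>c. Q c c \<ge> 0"
    and Llin: "\<And>a c c'. L (\<lambda>i. a * c i + c' i) = a * L c + L c'"
    and null: "\<And>c. Q c c = 0 \<Longrightarrow> L c = 0"
  shows "\<exists>r. (\<forall>i. i \<notin> I \<longrightarrow> r i = 0) \<and> (\<forall>c. (\<forall>i. i \<notin> I \<longrightarrow> c i = 0) \<longrightarrow> Q r c = L c)"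
  using fin Llin null
proof (induction I arbitrary: L rule: finite_induct)
  case empty
  have "L (\<lambda>i. 0) = 0" using empty(1)[of 1 "\<lambda>i. 0" "\<lambda>i. 0"] by simp
  moreover have "Q (\<lambda>i. 0) (\<lambda>i. 0) = 0" using Qlin[of 1 "\<lambda>i. 0" "\<lambda>i. 0"] by simp
  ultimately show ?case
    by (intro exI[of _ "\<lambda>_. 0"]) (simp flip: fun_eq_iff)
next
  case (insert j J L)
  have Qlin2: "Q e (\<lambda>i. a * c i + c' i) = a * Q e c + Q e c'" for a c c' e
    using Qlin Qsym by metis
  define d :: "'i \<Rightarrow> real" where "d = (\<lambda>i. if i = j then 1 else 0)"
  obtain r0 where r0: "\<forall>i. i \<notin> J \<longrightarrow> r0 i = 0" "\<And>c. (\<forall>i. i \<notin> J \<longrightarrow> c i = 0) \<Longrightarrow> Q r0 c = L c"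
    using insert.IH[of L, OF insert.prems] by blast
  \<comment> \<open>Cauchy-Schwarz for a semidefinite form: a null vector is orthogonal to
    everything. This makes \<open>Q d\<close> admissible as a functional in the induction
    hypothesis.\<close>
  have nullQ: "Q d c = 0" if "Q c c = 0" for c
  proof -
    have "0 \<le> Q (\<lambda>i. a * c i + d i) (\<lambda>i. a * c i + d i)" for a by (rule Qpos)
    then have *: "0 \<le> 2 * a * Q d c + Q d d" for a
      using that unfolding Qlin Qlin2 by (simp add: Qsym[of c d] algebra_simps)
    show ?thesis
    proof (rule ccontr)
      assume "Q d c \<noteq> 0"
      \<comment> \<open>With this \<open>a\<close> the nonnegative expression in \<open>*\<close>
        would equal -1.\<close>
      then show False using *[of "- (Q d d + 1) / (2 * Q d c)"] by (simp add: field_simps)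
    qed
  qed
  \<comment> \<open>Gram-Schmidt: \<open>p\<close> is the projection of the new basis vector \<open>d\<close>.\<close>
  have "\<exists>p. (\<forall>i. i \<notin> J \<longrightarrow> p i = 0) \<and> (\<forall>c. (\<forall>i. i \<notin> J \<longrightarrow> c i = 0) \<longrightarrow> Q p c = Q d c)"
    by (rule insert.IH) (auto simp: Qlin2 nullQ)
  then obtain p where p: "\<forall>i. i \<notin> J \<longrightarrow> p i = 0" "\<And>c. (\<forall>i. i \<notin> J \<longrightarrow> c i = 0) \<Longrightarrow> Q p c = Q d c"
    by blast
  define e where "e = (\<lambda>i. (-1) * p i + d i)"
  have eJ: "Q e c = 0" if "\<forall>i. i \<notin> J \<longrightarrow> c i = 0" for c
    unfolding e_def Qlin using p(2)[OF that] by simp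
  \<comment> \<open>If \<open>Q e e = 0\<close>, then \<open>L e = 0\<close> by \<open>null\<close>
    and \<open>r0\<close> already fits, since \<open>Q r0 e = 0\<close>.\<close>
  define t where "t = (if Q e e = 0 then 0 else (L e - Q r0 e) / Q e e)"
  define r where "r = (\<lambda>i. t * e i + r0 i)"
  have re: "Q r e = L e"
  proof (cases "Q e e = 0")
    case True
    have "Q r0 e = 0" using eJ[OF r0(1)] Qsym by metis
    with True insert.prems(2)[OF True] show ?thesis unfolding r_def Qlin by simp
  next
    case False
    then show ?thesis unfolding r_def Qlin by (simp add: t_def)
  qed
  have "Q r c = L c" if c: "\<forall>i. i \<notin> insert j J \<longrightarrow> c i = 0" for c
  proof -
    \<comment> \<open>What is left of \<open>c\<close> after removing \<open>c j\<close> times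
      \<open>e\<close>; the term with \<open>p\<close> cancels the components of \<open>e\<close> in
      \<open>J\<close>, so \<open>c0\<close> is supported in \<open>J\<close>.\<close>
    define c0 where "c0 = (\<lambda>i. c j * p i + (if i = j then 0 else c i))"
    have c0: "\<forall>i. i \<notin> J \<longrightarrow> c0 i = 0"
      using c p(1) insert.hyps(2) by (auto simp: c0_def)
    have ceq: "c = (\<lambda>i. c j * e i + c0 i)"
      using p(1) insert.hyps(2) by (auto simp: e_def c0_def d_def fun_eq_iff right_diff_distrib)
    have "Q r c0 = L c0"
      using r0(2)[OF c0] eJ[OF c0] unfolding r_def Qlin by simp
    then show ?thesis
      using re by (subst (1 2) ceq) (simp only: Qlin2 insert.prems(1))
  qed
  moreover have "\<forall>i. i \<notin> insert j J \<longrightarrow> r i = 0"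
    using r0(1) p(1) by (simp add: r_def e_def d_def)
  ultimately show ?case by blast
qed

section \<open>Polynomial functions of bounded degree\<close>

lemma finite_multi_indices: "finite I \<Longrightarrow> finite (multi_indices I k)"
proof -
  assume I: "finite I"
  have "multi_indices I k \<subseteq> {f. \<forall>i. (i \<in> I \<longrightarrow> f i \<in> {..k}) \<and> (i \<notin> I \<longrightarrow> f i = 0)}"
    using I by (auto simp: multi_indices_def intro: order_trans[OF member_le_sum])
  then show ?thesis
    by (rule finite_subset) (rule finite_set_of_finite_funs, use I in auto)
qed

lemma poly_funs_lin:
  assumes "p \<in> poly_funs I k" "q \<in> poly_funs I k"
  shows "(\<lambda>x. a * p x + q x) \<in> poly_funs I k"
proof -
  from assms obtain c e where 
    "p = (\<lambda>\<xi>. \<Sum>\<alpha>\<in>multi_indices I k. c \<alpha> * (\<Prod>i\<in>I. \<xi> i ^ \<alpha> i))"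
    "q = (\<lambda>\<xi>. \<Sum>\<alpha>\<in>multi_indices I k. e \<alpha> * (\<Prod>i\<in>I. \<xi> i ^ \<alpha> i))"
    unfolding poly_funs_def by blast
  then have "(\<lambda>x. a * p x + q x) = (\<lambda>\<xi>. \<Sum>\<alpha>\<in>multi_indices I k. (a * c \<alpha> + e \<alpha>) * (\<Prod>i\<in>I. \<xi> i ^ \<alpha> i))"
    by (simp add: sum_distrib_left sum.distrib algebra_simps)
  then show ?thesis unfolding poly_funs_def by (intro CollectI exI[of _ "\<lambda>\<alpha>. a * c \<alpha> + e \<alpha>"])
qed

lemma monom_in_poly_funs:
  assumes "finite I" "\<alpha> \<in> multi_indices I k"
  shows "(\<lambda>\<xi>. \<Prod>i\<in>I. \<xi> i ^ \<alpha> i) \<in> poly_funs I k"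
  unfolding poly_funs_def
  apply (intro CollectI exI[of _ "\<lambda>\<beta>. if \<beta> = \<alpha> then 1 else 0"] ext)
  using assms by (simp add: finite_multi_indices if_distrib[of "\<lambda>x. x * _"] cong: if_cong)

lemma poly_funs_0: "(\<lambda>x. 0) \<in> poly_funs I k"
  unfolding poly_funs_def by (intro CollectI exI[of _ "\<lambda>\<alpha>. 0"]) auto

lemma poly_funs_sum:
  assumes "finite A" "\<And>a. a \<in> A \<Longrightarrow> p a \<in> poly_funs I k"
  shows "(\<lambda>x. \<Sum>a\<in>A. c a * p a x) \<in> poly_funs I k"
  using assms
proof (induction A rule: finite_induct)
  case empty then show ?case by (simp add: poly_funs_0)
next
  case (insert a A)
  then show ?case using poly_funs_lin[of "p a" I k _ "c a"] by simp
qed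

lemma poly_funs_mult:
  assumes "finite I" "p \<in> poly_funs I k" "q \<in> poly_funs I l"
  shows "(\<lambda>x. p x * q x) \<in> poly_funs I (k + l)"
proof -
  from assms obtain c e where pq:
    "p = (\<lambda>\<xi>. \<Sum>\<alpha>\<in>multi_indices I k. c \<alpha> * (\<Prod>i\<in>I. \<xi> i ^ \<alpha> i))"
    "q = (\<lambda>\<xi>. \<Sum>\<alpha>\<in>multi_indices I l. e \<alpha> * (\<Prod>i\<in>I. \<xi> i ^ \<alpha> i))"
    unfolding poly_funs_def by blast
  have "(\<lambda>x. p x * q x) = (\<lambda>\<xi>. \<Sum>\<alpha>\<in>multi_indices I k. c \<alpha> * (\<Sum>\<beta>\<in>multi_indices I l. e \<beta> * (\<Prod>i\<in>I. \<xi> i ^ (\<alpha> i + \<beta> i))))"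
    unfolding pq by (simp only: sum_product power_add prod.distrib) (simp add: sum_distrib_left mult_ac)
  moreover have "\<dots> \<in> poly_funs I (k + l)"
  proof (intro poly_funs_sum finite_multi_indices assms)
    fix \<alpha> \<beta> assume "\<alpha> \<in> multi_indices I k" "\<beta> \<in> multi_indices I l"
    then show "(\<lambda>\<xi>. \<Prod>i\<in>I. \<xi> i ^ (\<alpha> i + \<beta> i)) \<in> poly_funs I (k + l)"
      by (intro monom_in_poly_funs assms) (auto simp: multi_indices_def sum.distrib)
  qed
  ultimately show ?thesis by simp
qed

lemma poly_funs_const: "finite I \<Longrightarrow> (\<lambda>x. c) \<in> poly_funs I k"
  using poly_funs_lin[OF monom_in_poly_funs[of I "\<lambda>_. 0" k] poly_funs_0, of c]
  by (simp add: multi_indices_def)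

lemma poly_funs_coord: "finite I \<Longrightarrow> i \<in> I \<Longrightarrow> (\<lambda>x. x i) \<in> poly_funs I 1"
  using monom_in_poly_funs[of I "\<lambda>j. if j = i then 1 else 0" 1]
  by (simp add: multi_indices_def if_distrib[of "\<lambda>n. _ ^ n"] cong: if_cong)

lemma poly_funs_mono:
  assumes "finite I" "k \<le> l" "p \<in> poly_funs I k" shows "p \<in> poly_funs I l"
  using poly_funs_mult[OF assms(1) assms(3) poly_funs_const[OF assms(1), of 1 "l - k"]] assms(2) by simp

lemma poly_funs_pow:
  assumes "finite I" "p \<in> poly_funs I 1" shows "(\<lambda>x. p x ^ m) \<in> poly_funs I m"
proof (induction m)
  case 0 then show ?case by (simp add: poly_funs_const assms)
next
  case (Suc m)
  then show ?case using poly_funs_mult[OF assms(1) assms(2) Suc] by simp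
qed

lemma poly_funs_prod_pow:
  assumes "finite I" "finite J" "\<And>j. j \<in> J \<Longrightarrow> g j \<in> poly_funs I 1"
  shows "(\<lambda>x. \<Prod>j\<in>J. g j x ^ \<alpha> j) \<in> poly_funs I (\<Sum>j\<in>J. \<alpha> j)"
  using assms(2,3)
proof (induction J rule: finite_induct)
  case empty then show ?case by (simp add: poly_funs_const assms)
next
  case (insert j J)
  then show ?case using poly_funs_mult[OF assms(1) poly_funs_pow[OF assms(1), of "g j" "\<alpha> j"] insert.IH] by simp
qed

text \<open>Substituting expressions of degree one keeps the degree bound; this is how polynomials
  move between hyperplane coordinates and ambient coordinates.\<close>

lemma poly_funs_subst:
  assumes "finite I" "finite J" "p \<in> poly_funs J k" "\<And>j. j \<in> J \<Longrightarrow> (\<lambda>x. g x j) \<in> poly_funs I 1"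
  shows "(\<lambda>x. p (g x)) \<in> poly_funs I k"
proof -
  from assms obtain c where pq:
    "p = (\<lambda>\<xi>. \<Sum>\<alpha>\<in>multi_indices J k. c \<alpha> * (\<Prod>i\<in>J. \<xi> i ^ \<alpha> i))"
    unfolding poly_funs_def by blast
  show ?thesis unfolding pq
  proof (intro poly_funs_sum finite_multi_indices assms)
    fix \<alpha> assume a: "\<alpha> \<in> multi_indices J k"
    show "(\<lambda>\<xi>. \<Prod>i\<in>J. g \<xi> i ^ \<alpha> i) \<in> poly_funs I k"
      by (rule poly_funs_mono[OF _ _ poly_funs_prod_pow[of I J "\<lambda>i x. g x i"]])
        (use assms a in \<open>auto simp: multi_indices_def\<close>)
  qed
qed

lemma cell_polys_eq: "cell_polys k = (\<lambda>p x. p (\<lambda>i. x $ i)) ` poly_funs UNIV k"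
  unfolding cell_polys_def by (auto simp: fun_eq_iff image_iff)

lemma cell_polys_lin: "p \<in> cell_polys k \<Longrightarrow> q \<in> cell_polys k \<Longrightarrow> (\<lambda>x. a * p x + q x) \<in> cell_polys k"
  unfolding cell_polys_eq by (auto intro!: image_eqI[OF _ poly_funs_lin])

lemma cell_polys_mult: "p \<in> cell_polys k \<Longrightarrow> q \<in> cell_polys l \<Longrightarrow> (\<lambda>x. p x * q x) \<in> cell_polys (k + l)"
  unfolding cell_polys_eq by (auto intro!: image_eqI[OF _ poly_funs_mult])

lemma cell_polys_mono: "k \<le> l \<Longrightarrow> p \<in> cell_polys k \<Longrightarrow> p \<in> cell_polys l"
  unfolding cell_polys_eq using poly_funs_mono[of UNIV k l] by (meson finite image_mono subsetD subsetI)

lemma cell_polys_const: "(\<lambda>x. c) \<in> cell_polys k"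
  unfolding cell_polys_eq by (rule image_eqI[OF _ poly_funs_const]) auto

lemma cell_polys_coord: "(\<lambda>x. x $ i) \<in> cell_polys 1"
  unfolding cell_polys_eq by (rule image_eqI[OF _ poly_funs_coord]) auto

lemma cell_polys_add: "p \<in> cell_polys k \<Longrightarrow> q \<in> cell_polys k \<Longrightarrow> (\<lambda>x. p x + q x) \<in> cell_polys k"
  using cell_polys_lin[of p k q 1] by simp

lemma cell_polys_cmult: "p \<in> cell_polys k \<Longrightarrow> (\<lambda>x. a * p x) \<in> cell_polys k"
  using cell_polys_lin[OF _ cell_polys_const[of 0], of p k a] by simp

lemma cell_polys_uminus: "p \<in> cell_polys k \<Longrightarrow> (\<lambda>x. - p x) \<in> cell_polys k"
  using cell_polys_cmult[of p k "-1"] by simp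

lemma cell_polys_diff: "p \<in> cell_polys k \<Longrightarrow> q \<in> cell_polys k \<Longrightarrow> (\<lambda>x. p x - q x) \<in> cell_polys k"
  using cell_polys_lin[of q k p "-1"] by simp

lemma cell_polys_sum:
  assumes "\<And>a. a \<in> A \<Longrightarrow> p a \<in> cell_polys k"
  shows "(\<lambda>x. \<Sum>a\<in>A. p a x) \<in> cell_polys k"
proof (cases "finite A")
  case True
  then show ?thesis using assms
    by (induction A rule: finite_induct) (auto intro: cell_polys_const cell_polys_add)
qed (auto intro: cell_polys_const)

text \<open>The degree bound is an argument of \<open>P\<close>, so that claims about the degree of
  a derivative can be proved without multi-indices. Each monomial is built from its coefficient by
  multiplying with one coordinate at a time; \<open>mono\<close> absorbs monomials of degree below
  \<open>k\<close>.\<close>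

lemma cell_polys_induct [consumes 1, case_names const add coord mono]:
  assumes "v \<in> cell_polys k"
    and const: "\<And>c. P 0 (\<lambda>x. c)"
    and add: "\<And>k v w. P k v \<Longrightarrow> P k w \<Longrightarrow> P k (\<lambda>x. v x + w x)"
    and coord: "\<And>k v i. v \<in> cell_polys k \<Longrightarrow> P k v \<Longrightarrow> P (Suc k) (\<lambda>x. x $ i * v x)"
    and mono: "\<And>k v. P k v \<Longrightarrow> P (Suc k) v"
  shows "P k (v :: real^'d \<Rightarrow> real)"
proof -
  have mono': "P l v" if "k \<le> l" "P k v" for k l v
    using that by (induction l rule: dec_induct) (auto intro: mono)
  have monom: "P (\<Sum>i\<in>I. \<alpha> i) (\<lambda>x. c * (\<Prod>i\<in>I. x $ i ^ \<alpha> i)) \<and> 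
      (\<lambda>x. c * (\<Prod>i\<in>I. x $ i ^ \<alpha> i)) \<in> cell_polys (\<Sum>i\<in>I. \<alpha> i)" for c and I :: "'d set" and \<alpha>
  proof (induction I rule: infinite_finite_induct)
    case (insert j I)
    have "P (n + (\<Sum>i\<in>I. \<alpha> i)) (\<lambda>x. x $ j ^ n * (c * (\<Prod>i\<in>I. x $ i ^ \<alpha> i))) \<and>
       (\<lambda>x. x $ j ^ n * (c * (\<Prod>i\<in>I. x $ i ^ \<alpha> i))) \<in> cell_polys (n + (\<Sum>i\<in>I. \<alpha> i))" for n
    proof (induction n)
      case 0 then show ?case using insert.IH by simp
    next
      case (Suc n)
      then show ?case using coord[of _ "n + (\<Sum>i\<in>I. \<alpha> i)" j] 
          cell_polys_mult[OF cell_polys_coord[of j], of _ "n + (\<Sum>i\<in>I. \<alpha> i)"] by (simp add: mult.assoc)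
    qed
    from this[of "\<alpha> j"] show ?case using insert.hyps by (simp add: algebra_simps)
  qed (auto intro: const cell_polys_const)
  from assms(1) obtain c where v:
    "v = (\<lambda>x. \<Sum>\<alpha>\<in>multi_indices UNIV k. c \<alpha> * (\<Prod>i\<in>UNIV. x $ i ^ \<alpha> i))"
    unfolding cell_polys_eq poly_funs_def by blast
  have "P k (\<lambda>x. \<Sum>\<alpha>\<in>A. c \<alpha> * (\<Prod>i\<in>UNIV. x $ i ^ \<alpha> i))" if "finite A" "A \<subseteq> multi_indices UNIV k" for A
    using that
  proof (induction A rule: finite_induct)
    case empty then show ?case using mono'[OF _ const[of 0]] by simp
  next
    case (insert \<alpha> A)
    have "P k (\<lambda>x. c \<alpha> * (\<Prod>i\<in>UNIV. x $ i ^ \<alpha> i))"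
      by (rule mono'[OF _ conjunct1[OF monom]]) (use insert in \<open>auto simp: multi_indices_def\<close>)
    from add[OF this insert.IH] insert show ?case by simp
  qed
  from this[OF finite_multi_indices] show ?thesis unfolding v by simp
qed

section \<open>Gradients of polynomials\<close>

lemma GDERIV_unique: "GDERIV f x :> D \<Longrightarrow> GDERIV f x :> E \<Longrightarrow> D = (E :: 'a :: real_inner)"
  unfolding gderiv_def by (drule (1) has_derivative_unique) (metis inner_commute vector_eq_rdot)

lemma grad_eqI: "GDERIV f x :> D \<Longrightarrow> grad f x = D"
  unfolding grad_def by (rule the_equality) (auto intro: GDERIV_unique)

text \<open>The clause for \<open>k = 0\<close> is there because \<open>k - 1\<close> is truncated:
  when a constant is multiplied by a coordinate, \<open>x $ j * G i x\<close> stays of degree 0 only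
  because \<open>G\<close> vanishes.\<close>

lemma cell_polys_GDERIV:
  assumes "v \<in> cell_polys k"
  shows "\<exists>G. (\<forall>i. G i \<in> cell_polys (k - 1)) \<and> (k = 0 \<longrightarrow> (\<forall>i x. G i x = 0)) \<and>
     (\<forall>x. GDERIV v x :> (\<chi> i. G i x))"
  using assms
proof (induction rule: cell_polys_induct)
  case (const c)
  show ?case
    by (rule exI[of _ "\<lambda>i x. 0"]) (auto simp: cell_polys_const gderiv_def vec_eq_iff inner_vec_def)
next
  case (add k v w)
  then obtain G H where "\<forall>i. G i \<in> cell_polys (k - 1)" "k = 0 \<longrightarrow> (\<forall>i x. G i x = 0)"
     "\<forall>x. GDERIV v x :> (\<chi> i. G i x)" "\<forall>i. H i \<in> cell_polys (k - 1)" "k = 0 \<longrightarrow> (\<forall>i x. H i x = 0)"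
     "\<forall>x. GDERIV w x :> (\<chi> i. H i x)" by blast
  then show ?case
    by (intro exI[of _ "\<lambda>i x. G i x + H i x"])
      (auto intro!: cell_polys_add GDERIV_subst[OF GDERIV_add] simp: vec_eq_iff)
next
  case (coord k v j)
  then obtain G where G: "\<forall>i. G i \<in> cell_polys (k - 1)" "k = 0 \<longrightarrow> (\<forall>i x. G i x = 0)"
     "\<forall>x. GDERIV v x :> (\<chi> i. G i x)" by blast
  have "(\<lambda>x. x $ j * G i x + (if i = j then v x else 0)) \<in> cell_polys k" for i
  proof (intro cell_polys_add)
    show "(\<lambda>x. x $ j * G i x) \<in> cell_polys k"
    proof (cases "k = 0")
      case True then show ?thesis using G by (simp add: cell_polys_const)
    next
      case False then show ?thesis using cell_polys_mult[OF cell_polys_coord G(1)[rule_format, of i], of j]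
        by simp
    qed
    show "(\<lambda>x. if i = j then v x else 0) \<in> cell_polys k"
      using coord(1) by (cases "i = j") (simp_all add: cell_polys_const)
  qed
  moreover have "GDERIV (\<lambda>x. x $ j) x :> axis j 1" for x :: "real^'a"
    unfolding gderiv_def inner_axis using bounded_linear_imp_has_derivative[OF bounded_linear_vec_nth] by simp
  from GDERIV_mult[OF this G(3)[rule_format]] 
  have "GDERIV (\<lambda>x. x $ j * v x) x :> (\<chi> i. x $ j * G i x + (if i = j then v x else 0))" for x
    by (rule GDERIV_subst) (auto simp: vec_eq_iff axis_def)
  ultimately show ?case by (intro exI[of _ "\<lambda>i x. x $ j * G i x + (if i = j then v x else 0)"]) auto
next
  case (mono k v)
  then obtain G where G: "\<forall>i. G i \<in> cell_polys (k - 1)" "k = 0 \<longrightarrow> (\<forall>i x. G i x = 0)"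
     "\<forall>x. GDERIV v x :> (\<chi> i. G i x)" by blast
  then show ?case by (intro exI[of _ G]) (auto intro: cell_polys_mono[of "k - 1" k])
qed

lemma GDERIV_grad: "v \<in> cell_polys k \<Longrightarrow> GDERIV v x :> grad v x"
  using cell_polys_GDERIV grad_eqI by metis

lemma grad_cell_polys: "v \<in> cell_polys k \<Longrightarrow> (\<lambda>x. grad v x $ i) \<in> cell_polys (k - 1)"
proof -
  assume "v \<in> cell_polys k"
  from cell_polys_GDERIV[OF this] obtain G where
    "G i \<in> cell_polys (k - 1)" "\<And>x. GDERIV v x :> (\<chi> i. G i x)" by blast
  moreover from this(2) have "grad v x = (\<chi> i. G i x)" for x by (rule grad_eqI)
  then have "(\<lambda>x. grad v x $ i) = G i" by simp
  ultimately show ?thesis by simp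
qed

lemma grad_lin:
  assumes "v \<in> cell_polys k" "w \<in> cell_polys l"
  shows "grad (\<lambda>x. a * v x + w x) = (\<lambda>x. a *\<^sub>R grad v x + grad w x)"
proof
  fix x
  have "GDERIV (\<lambda>x. a * v x + w x) x :> a *\<^sub>R grad v x + grad w x"
    using GDERIV_grad[OF assms(1), of x] GDERIV_grad[OF assms(2), of x] unfolding gderiv_def inner_add_right inner_scaleR_right
    by (auto intro!: derivative_eq_intros)
  then show "grad (\<lambda>x. a * v x + w x) x = a *\<^sub>R grad v x + grad w x" by (rule grad_eqI)
qed

lemma grad_const: "grad (\<lambda>x. c) x = 0"
  by (rule grad_eqI) (rule GDERIV_const)

lemma cell_polys_continuous: "v \<in> cell_polys k \<Longrightarrow> continuous_on S v"
  using GDERIV_grad[unfolded gderiv_def] has_derivative_continuous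
  by (metis continuous_at_imp_continuous_on)

lemma grad_continuous: "v \<in> cell_polys k \<Longrightarrow> continuous_on S (grad v)"
  using continuous_on_vec_lambda[of S "\<lambda>i x. grad v x $ i", OF cell_polys_continuous[OF grad_cell_polys]] by simp

lemma laplacian_cell_polys: "v \<in> cell_polys k \<Longrightarrow> laplacian v \<in> cell_polys k"
  unfolding laplacian_def[abs_def]
  by (rule cell_polys_sum, rule cell_polys_mono[of "k - 1 - 1" k], simp) (intro grad_cell_polys)

lemma laplacian_lin:
  assumes "v \<in> cell_polys k" "w \<in> cell_polys l"
  shows "laplacian (\<lambda>x. a * v x + w x) = (\<lambda>x. a * laplacian v x + laplacian w x)"
  unfolding laplacian_def[abs_def] grad_lin[OF assms]
  using grad_lin[OF grad_cell_polys[OF assms(1)] grad_cell_polys[OF assms(2)]]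
  by (simp add: sum.distrib sum_distrib_left)

section \<open>Zeros of polynomials\<close>

lemma cell_polys_on_line:
  "v \<in> cell_polys k \<Longrightarrow> \<exists>P. \<forall>t. v (x + t *\<^sub>R d) = poly P t"
proof (induction rule: cell_polys_induct)
  case (const c)
  show ?case by (rule exI[of _ "[:c:]"]) simp
next
  case (add k v w)
  then obtain P Q where "\<forall>t. v (x + t *\<^sub>R d) = poly P t" "\<forall>t. w (x + t *\<^sub>R d) = poly Q t" by blast
  then show ?case by (intro exI[of _ "P + Q"]) simp
next
  case (coord k v i)
  then obtain P where "\<forall>t. v (x + t *\<^sub>R d) = poly P t" by blast
  then show ?case by (intro exI[of _ "[:x $ i, d $ i:] * P"]) (simp add: algebra_simps)
qed auto

text \<open>Along the line through \<open>x\<close> and \<open>y\<close> the polynomial is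
  univariate with infinitely many zeros, hence zero, and \<open>y\<close> is the parameter value
  1.\<close>

lemma cell_polys_zero_ray:
  assumes "v \<in> cell_polys k" "e > 0" and 0: "\<And>t. 0 \<le> t \<Longrightarrow> t < e \<Longrightarrow> v (x + t *\<^sub>R (y - x)) = 0"
  shows "v y = 0"
proof -
  obtain P where P: "\<And>t. v (x + t *\<^sub>R (y - x)) = poly P t" using cell_polys_on_line[OF assms(1)] by blast
  have "infinite {0..<e}" using \<open>e > 0\<close> by (simp add: infinite_Ico)
  moreover have "{0..<e} \<subseteq> {t. poly P t = 0}" using 0 P by auto
  ultimately have "P = 0" using poly_roots_finite finite_subset by blast
  then show ?thesis using P[of 1] by simp
qed

text \<open>Identity theorem relative to an affine subspace: it is applied with the whole space for
  cells and with the plane of a face for faces.\<close>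

lemma cell_polys_zero_on_relopen:
  assumes "v \<in> cell_polys k" "affine H" "x \<in> H" "y \<in> H" "e > 0"
    and 0: "\<And>z. z \<in> ball x e \<inter> H \<Longrightarrow> v z = 0"
  shows "v y = 0"
\<comment> \<open>The summand 1 keeps the quotient meaningful for \<open>y = x\<close>.\<close>
proof (rule cell_polys_zero_ray[OF assms(1), of "e / (norm (y - x) + 1)" x])
  show "e / (norm (y - x) + 1) > 0" using \<open>e > 0\<close> by (simp add: add_nonneg_pos)
  fix t assume t: "0 \<le> t" "t < e / (norm (y - x) + 1)"
  then have "t * norm (y - x) < e"
    by (smt (verit) mult_left_mono norm_ge_zero pos_less_divide_eq)
  moreover have "x + t *\<^sub>R (y - x) \<in> H"
    using mem_affine_3_minus[OF assms(2,3,4,3), of t] by simp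
  ultimately show "v (x + t *\<^sub>R (y - x)) = 0" using t by (intro 0) (auto simp: dist_norm)
qed

section \<open>Polynomials on a hyperplane\<close>

lemma cell_polys_subst_affine_map:
  fixes a :: "real^'d"
  shows "v \<in> cell_polys k \<Longrightarrow> (\<lambda>\<xi>. v (affine_map a t \<xi>)) \<in> poly_funs {..<CARD('d) - 1} k"
proof -
  assume "v \<in> cell_polys k"
  then obtain p where p: "p \<in> poly_funs UNIV k" "v = (\<lambda>x. p (\<lambda>i. x $ i))" unfolding cell_polys_eq by blast
  have "(\<lambda>\<xi>. affine_map a t \<xi> $ i) \<in> poly_funs {..<CARD('d) - 1} 1" for i
  proof -
    have "(\<lambda>\<xi>. 1 * a $ i + (\<Sum>j<CARD('d) - 1. t j $ i * \<xi> j)) \<in> poly_funs {..<CARD('d) - 1} 1"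
      by (rule poly_funs_lin) (auto intro!: poly_funs_const poly_funs_sum poly_funs_coord simp del: One_nat_def)
    then show ?thesis unfolding affine_map_def by (simp add: mult.commute)
  qed
  from poly_funs_subst[OF _ _ p(1) this] show ?thesis unfolding p(2) by simp
qed

text \<open>Injectivity makes the directions \<open>t i\<close> independent, so dual functionals
  exist and extend to the whole space. Each coordinate thereby becomes an affine function of the
  ambient point.\<close>

lemma affine_map_inverse:
  fixes a :: "real^'d"
  assumes "inj_on (affine_map a t) (hyp_coords TYPE('d))"
  shows "\<exists>c w. \<forall>\<xi>\<in>hyp_coords TYPE('d). \<forall>i<CARD('d) - 1. \<xi> i = c i + w i \<bullet> affine_map a t \<xi>"
proof -
  let ?n = "CARD('d) - 1"
  define L :: "(nat \<Rightarrow> real) \<Rightarrow> real^'d" where "L = (\<lambda>\<xi>. \<Sum>i<?n. \<xi> i *\<^sub>R t i)"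
  have inj: "c = c'" if "L c = L c'" "c \<in> hyp_coords TYPE('d)" "c' \<in> hyp_coords TYPE('d)" for c c'
    using assms that unfolding inj_on_def affine_map_def L_def by auto
  have *: "u i = 0" if "L u = 0" "i < ?n" for u i
  proof -
    have "restrict u {..<?n} = restrict (\<lambda>_. 0) {..<?n}"
      by (rule inj) (use that(1) in \<open>auto simp: L_def\<close>)
    then show ?thesis using that(2) by (metis lessThan_iff restrict_apply')
  qed
  have injt: "inj_on t {..<?n}"
  proof (rule inj_onI, rule ccontr)
    fix i j assume ij: "i \<in> {..<?n}" "j \<in> {..<?n}" "t i = t j" "i \<noteq> j"
    \<comment> \<open>Two equal directions would give this nonzero kernel vector of
      \<open>L\<close>.\<close>
    define u where "u = (\<lambda>m. if m = i then 1 else if m = j then -1 else (0::real))"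
    have "L u = (\<Sum>m<?n. (if m = i then t m else 0) - (if m = j then t m else 0))"
      unfolding L_def u_def using ij by (intro sum.cong) auto
    also have "\<dots> = 0" using ij by (simp add: sum_subtractf)
    finally show False using *[of u i] ij by (simp add: u_def)
  qed
  have ind: "independent (t ` {..<?n})"
    unfolding independent_explicit
  proof (intro conjI allI impI ballI)
    fix u v assume "(\<Sum>v\<in>t ` {..<?n}. u v *\<^sub>R v) = 0" "v \<in> t ` {..<?n}"
    then show "u v = 0" using *[of "u \<circ> t"] unfolding L_def sum.reindex[OF injt] by auto
  qed simp
  have "\<exists>f. linear f \<and> (\<forall>x\<in>t ` {..<?n}. f x = (if x = t i then 1 else (0::real)))" for i
    using linear_independent_extend[OF ind, of "\<lambda>x. if x = t i then 1 else 0"] .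
  then obtain f :: "nat \<Rightarrow> real^'d \<Rightarrow> real" where f: "\<And>i. linear (f i)"
    "\<And>i j. j < ?n \<Longrightarrow> f i (t j) = (if t j = t i then 1 else 0)" by (metis imageI lessThan_iff)
  \<comment> \<open>The vector that represents the functional \<open>f i\<close> by the inner
    product.\<close>
  define w where "w i = adjoint (f i) 1" for i
  have w: "w i \<bullet> x = f i x" for i x
    using adjoint_works[OF f(1), of x i 1] by (simp add: w_def inner_commute)
  have "\<xi> i = - f i a + w i \<bullet> affine_map a t \<xi>" if "i < ?n" for \<xi> i
  proof -
    have "f i (affine_map a t \<xi>) = f i a + (\<Sum>j<?n. \<xi> j * f i (t j))"
      unfolding affine_map_def by (simp add: linear_add[OF f(1)] linear_sum[OF f(1)] linear_scale[OF f(1)])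
    also have "(\<Sum>j<?n. \<xi> j * f i (t j)) = (\<Sum>j<?n. if j = i then \<xi> i else 0)"
      using injt that by (intro sum.cong) (auto simp: f(2) inj_on_def)
    finally show ?thesis using that by (simp add: w)
  qed
  then show ?thesis by (intro exI[of _ "\<lambda>i. - f i a"] exI[of _ w]) simp
qed

text \<open>A basis of the parallel subspace through the origin provides the directions, the foot of
  the perpendicular from the origin the base point.\<close>

lemma hyperplane_parametrization:
  fixes H :: "(real^'d) set"
  assumes "hyperplane H"
  obtains a t where "bij_betw (affine_map a t) (hyp_coords TYPE('d)) H"
proof -
  let ?n = "CARD('d) - 1"
  obtain n b where nb: "n \<noteq> 0" "H = {x. n \<bullet> x = b}" using assms unfolding hyperplane_def by blast
  define a where "a = (b / (n \<bullet> n)) *\<^sub>R n"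
  have a: "n \<bullet> a = b" using nb by (simp add: a_def)
  define S where "S = {x. n \<bullet> x = 0}"
  have "dim S = ?n" unfolding S_def using dim_hyperplane[OF nb(1)] by simp
  moreover have S: "subspace S" unfolding S_def by (rule subspace_hyperplane)
  ultimately obtain B where B: "B \<subseteq> S" "independent B" "S \<subseteq> span B" "card B = ?n"
    using basis_exists by metis
  then have spB: "span B = S" using S span_subspace by blast
  have finB: "finite B" using B(2) by (rule independent_imp_finite)
  obtain t where t: "bij_betw t {..<?n} B" 
    using ex_bij_betw_nat_finite[OF finB] B(4) by (auto simp: atLeast0LessThan)
  have re: "(\<Sum>i<?n. \<xi> i *\<^sub>R t i) = (\<Sum>v\<in>B. \<xi> (inv_into {..<?n} t v) *\<^sub>R v)" for \<xi> :: "nat \<Rightarrow> real"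
    by (rule sum.reindex_bij_betw[OF t, symmetric, THEN trans, rotated, symmetric]) 
      (use t in \<open>auto simp: bij_betw_def intro!: sum.cong\<close>)
  have "bij_betw (affine_map a t) (hyp_coords TYPE('d)) H"
    unfolding bij_betw_def
  proof
    show "inj_on (affine_map a t) (hyp_coords TYPE('d))"
    proof (rule inj_onI)
      fix \<xi> \<eta> assume x: "\<xi> \<in> hyp_coords TYPE('d)" "\<eta> \<in> hyp_coords TYPE('d)" "affine_map a t \<xi> = affine_map a t \<eta>"
      then have "(\<Sum>v\<in>B. (\<xi> (inv_into {..<?n} t v) - \<eta> (inv_into {..<?n} t v)) *\<^sub>R v) = 0"
        unfolding affine_map_def re by (simp add: scaleR_diff_left sum_subtractf)
      then have "\<xi> (inv_into {..<?n} t v) = \<eta> (inv_into {..<?n} t v)" if "v \<in> B" for v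
        using B(2)[unfolded independent_explicit] that by auto
      then have "\<xi> i = \<eta> i" if "i < ?n" for i
        using t that bij_betw_inv_into_left[OF t, of i] by (metis bij_betwE lessThan_iff)
      then show "\<xi> = \<eta>" using x(1,2) by (intro PiE_ext[of \<xi> "{..<?n}" _ \<eta>]) auto
    qed
    show "affine_map a t ` hyp_coords TYPE('d) = H"
    proof safe
      fix \<xi> assume "\<xi> \<in> hyp_coords TYPE('d)"
      have "n \<bullet> (\<Sum>i<?n. \<xi> i *\<^sub>R t i) = 0"
        using t B(1) by (auto simp: inner_sum_right S_def bij_betw_def intro!: sum.neutral)
      then show "affine_map a t \<xi> \<in> H" by (simp add: affine_map_def nb(2) inner_add_right a)
    next
      fix x assume "x \<in> H"
      then have "x - a \<in> span B" using spB a nb by (auto simp: S_def inner_diff_right)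
      then obtain u where u: "x - a = (\<Sum>v\<in>B. u v *\<^sub>R v)" using span_finite[OF finB] by auto
      have "x = affine_map a t (restrict (u \<circ> t) {..<?n})"
        unfolding affine_map_def using u sum.reindex_bij_betw[OF t, of "\<lambda>v. u v *\<^sub>R v"] by (simp add: algebra_simps)
      then show "x \<in> affine_map a t ` hyp_coords TYPE('d)" by (intro image_eqI[where x = "restrict (u \<circ> t) {..<?n}"]) auto
    qed
  qed
  then show ?thesis by (rule that)
qed

text \<open>Hyperplane coordinates are affine in the ambient point, so the space does not depend on
  the parametrization, and boundary unknowns can be treated with the calculus of
  \<open>cell_polys\<close>.\<close>

lemma face_polys_eq_restrictions:
  fixes F :: "(real^'d) set"
  assumes "hyperplane (affine hull F)"
  shows "face_polys k F = (\<lambda>v. restrict v F) ` cell_polys k"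
proof safe
  fix g assume "g \<in> face_polys k F"
  then obtain a t p where g: "g \<in> extensional F" "p \<in> poly_funs {..<CARD('d) - 1} k"
    and bij: "bij_betw (affine_map a t) (hyp_coords TYPE('d)) (affine hull F)"
    and gx: "\<And>x. x \<in> F \<Longrightarrow> g x = p (inv_into (hyp_coords TYPE('d)) (affine_map a t) x)"
    unfolding face_polys_def by blast
  obtain c w where cw: "\<And>\<xi> i. \<xi> \<in> hyp_coords TYPE('d) \<Longrightarrow> i < CARD('d) - 1 \<Longrightarrow> \<xi> i = c i + w i \<bullet> affine_map a t \<xi>"
    using affine_map_inverse[OF bij_betw_imp_inj_on[OF bij]] by blast
  define q where "q x = p (\<lambda>i. c i + w i \<bullet> x)" for x
  have "(\<lambda>\<zeta>. p (\<lambda>i. c i + (\<Sum>j\<in>UNIV. w i $ j * \<zeta> j))) \<in> poly_funs (UNIV :: 'd set) k"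
  proof (rule poly_funs_subst[OF _ _ g(2)])
    fix i
    have "(\<lambda>x. 1 * c i + (\<Sum>j\<in>UNIV. w i $ j * x j)) \<in> poly_funs (UNIV :: 'd set) 1"
      by (rule poly_funs_lin) (auto intro!: poly_funs_const poly_funs_sum poly_funs_coord simp del: One_nat_def)
    then show "(\<lambda>x. c i + (\<Sum>j\<in>UNIV. w i $ j * x j)) \<in> poly_funs (UNIV :: 'd set) 1" by simp
  qed auto
  then have q: "q \<in> cell_polys k" unfolding cell_polys_def q_def inner_vec_def by auto
  \<comment> \<open>The affine functions \<open>c i + w i \<bullet> x\<close> are not extensional in
    \<open>i\<close>, unlike true coordinates, so \<open>p\<close> must be known to look only at the
    indices below the dimension of the plane.\<close>
  have dep: "p \<xi> = p \<eta>" if "\<And>i. i < CARD('d) - 1 \<Longrightarrow> \<xi> i = \<eta> i" for \<xi> \<eta>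
    using g(2) that unfolding poly_funs_def by (auto intro!: sum.cong prod.cong)
  have "g = restrict q F"
  proof
    fix x
    show "g x = restrict q F x"
    proof (cases "x \<in> F")
      case True
      then have "x \<in> affine_map a t ` hyp_coords TYPE('d)" using bij hull_inc[of x F] by (auto simp: bij_betw_def)
      note i = inv_into_into[OF this] f_inv_into_f[OF this]
      have "g x = q x" unfolding gx[OF True] q_def by (rule dep) (use cw[OF i(1)] i(2) in simp)
      then show ?thesis using True by simp
    next
      case False then show ?thesis using g(1) by (simp add: extensional_def)
    qed
  qed
  then show "g \<in> (\<lambda>v. restrict v F) ` cell_polys k" using q by blast
next
  fix v :: "real^'d \<Rightarrow> real" assume v: "v \<in> cell_polys k"
  obtain a t where bij: "bij_betw (affine_map a t) (hyp_coords TYPE('d)) (affine hull F)"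
    using hyperplane_parametrization[OF assms] .
  have "v x = v (affine_map a t (inv_into (hyp_coords TYPE('d)) (affine_map a t) x))" if "x \<in> F" for x
    using bij_betw_inv_into_right[OF bij hull_inc[OF that]] by simp
  then show "restrict v F \<in> face_polys k F"
    unfolding face_polys_def using bij cell_polys_subst_affine_map[OF v, of a t] by fastforce
qed

lemma cell_polys_parametrization:
  "\<exists>I. finite I \<and> (cell_polys k :: (real^'d \<Rightarrow> real) set) = 
    range (\<lambda>c x. \<Sum>\<alpha>\<in>I. c \<alpha> * (\<Prod>i\<in>UNIV. x $ i ^ \<alpha> i))"
  unfolding cell_polys_eq poly_funs_def
  by (intro exI[of _ "multi_indices UNIV k"] conjI finite_multi_indices) (auto simp: image_iff)

section \<open>Measures on hyperplanes\<close>

lemma emeasure_lborel_translate: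
  fixes c :: "'a::euclidean_space"
  assumes "{x. Q x} \<in> sets borel"
  shows "emeasure lborel {x. Q (c + x)} = emeasure lborel {x. Q x}"
proof -
  have "emeasure (distr lborel borel ((+) c)) {x. Q x} = emeasure lborel ((+) c -` {x. Q x} \<inter> space lborel)"
    using assms by (intro emeasure_distr) auto
  then show ?thesis by (simp add: lborel_distr_plus vimage_def)
qed

lemma hyperplane_null_lborel:
  fixes n :: "'a::euclidean_space"
  assumes "n \<noteq> 0" shows "{x. n \<bullet> x = b} \<in> null_sets lborel"
proof -
  have "closed {x. n \<bullet> x = b}" by (rule closed_hyperplane)
  then have "{x. n \<bullet> x = b} \<in> sets lborel" by auto
  moreover have "negligible {x. n \<bullet> x = b}" using assms by (intro negligible_hyperplane) auto
  ultimately show ?thesis by (simp add: negligible_iff_null_sets null_sets_completion_iff)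
qed

section \<open>Lebesgue measure as a product of plane measure and height\<close>

text \<open>Cauchy's functional equation on the nonnegative reals. Nonnegativity gives monotonicity,
  and comparing \<open>N * s\<close> with the integers around it bounds the error by
  \<open>F 1 / N\<close> for every \<open>N\<close>.\<close>

lemma additive_imp_linear:
  fixes F :: "real \<Rightarrow> real"
  assumes nonneg: "\<And>s. s \<ge> 0 \<Longrightarrow> F s \<ge> 0"
    and add: "\<And>s t. s \<ge> 0 \<Longrightarrow> t \<ge> 0 \<Longrightarrow> F (s + t) = F s + F t" and s: "s \<ge> 0"
  shows "F s = s * F 1"
proof -
  have F0: "F 0 = 0" using add[of 0 0] by simp
  have mult: "F (real m * t) = real m * F t" if "t \<ge> 0" for m t
    using that by (induction m) (auto simp: F0 add distrib_right)
  have mono: "F s \<le> F t" if "0 \<le> s" "s \<le> t" for s t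
    using add[of s "t - s"] nonneg[of "t - s"] that by simp
  have bd: "\<bar>F s - s * F 1\<bar> * real N \<le> F 1" for N
  proof -
    define m where "m = nat \<lfloor>real N * s\<rfloor>"
    have "\<lfloor>real N * s\<rfloor> \<ge> 0" using s by simp
    then have m: "real m \<le> real N * s" "real N * s \<le> real m + 1" unfolding m_def by linarith+
    have "real m * F 1 \<le> real N * F s" 
      using mono[of "real m * 1" "real N * s"] m mult[of 1 m] mult[of s N] s by simp
    moreover have "real N * F s \<le> (real m + 1) * F 1"
      using mono[of "real N * s" "real (Suc m) * 1"] m mult[of 1 "Suc m"] mult[of s N] s by (simp add: algebra_simps)
    moreover have "real m * F 1 \<le> real N * s * F 1" "real N * s * F 1 \<le> (real m + 1) * F 1"
      using m nonneg[of 1] by (auto intro: mult_right_mono)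
    ultimately have "\<bar>real N * F s - real N * s * F 1\<bar> \<le> F 1" by (simp add: algebra_simps abs_if)
    then show ?thesis by (simp add: algebra_simps abs_if split: if_splits)
  qed
  show ?thesis
  proof (rule ccontr)
    assume "F s \<noteq> s * F 1"
    then have p: "\<bar>F s - s * F 1\<bar> > 0" by simp
    obtain N :: nat where "F 1 / \<bar>F s - s * F 1\<bar> < real N" using reals_Archimedean2 by blast
    then show False using bd[of N] p by (simp add: field_simps)
  qed
qed

context
  fixes n :: "real^'d" and b :: real
  assumes unit: "norm n = 1"
begin

text \<open>Signed height over the plane; together with \<open>hyp_proj\<close>, the foot of the
  perpendicular, it gives the orthogonal coordinates in which Lebesgue measure factors.\<close>

definition hyp_lev where "hyp_lev x = n \<bullet> x - b"
definition hyp_proj where "hyp_proj x = x - hyp_lev x *\<^sub>R n"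

lemma nn: "n \<bullet> n = 1" using unit by (simp add: norm_eq_1)

lemma hyp_lev_measurable [measurable]: "hyp_lev \<in> borel_measurable borel"
  unfolding hyp_lev_def[abs_def] by measurable
lemma hyp_proj_measurable [measurable]: "hyp_proj \<in> borel_measurable borel"
  unfolding hyp_proj_def[abs_def] by measurable

lemma hyp_lev_add: "hyp_lev (x + s *\<^sub>R n) = hyp_lev x + s" "hyp_lev (s *\<^sub>R n + x) = hyp_lev x + s"
  by (auto simp: hyp_lev_def inner_add_right nn)
lemma hyp_proj_add: "hyp_proj (x + s *\<^sub>R n) = hyp_proj x" "hyp_proj (s *\<^sub>R n + x) = hyp_proj x"
  by (auto simp: hyp_proj_def hyp_lev_add algebra_simps)
lemma hyp_lev_proj: "hyp_lev (hyp_proj x) = 0"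
  unfolding hyp_proj_def using hyp_lev_add(1)[of x "- hyp_lev x"] by simp

lemma hyp_lev_null: "{x. hyp_lev x = c} \<in> null_sets lborel"
  proof -
  have "n \<noteq> 0" using unit by auto
  then show ?thesis using hyperplane_null_lborel[of n "c + b"] by (simp add: hyp_lev_def diff_eq_eq)
qed

lemma hyperplane_measure_alt:
  "hyperplane_measure n b = distr (restrict_space lborel {x. 0 \<le> hyp_lev x \<and> hyp_lev x \<le> 1}) borel hyp_proj"
  unfolding hyperplane_measure_def hyp_lev_def hyp_proj_def by (simp add: algebra_simps)

text \<open>The slab becomes half-open at the cost of the null set at height 1: half-open slabs fit
  together without overlap, so their volumes add.\<close>

lemma emeasure_hyperplane_measure:
  assumes [measurable]: "A \<in> sets borel"
  shows "emeasure (hyperplane_measure n b) A = emeasure lborel {x. hyp_proj x \<in> A \<and> 0 \<le> hyp_lev x \<and> hyp_lev x < 1}"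
proof -
  have "emeasure (hyperplane_measure n b) A = 
     emeasure (restrict_space lborel {x. 0 \<le> hyp_lev x \<and> hyp_lev x \<le> 1}) (hyp_proj -` A \<inter> {x. 0 \<le> hyp_lev x \<and> hyp_lev x \<le> 1})"
    unfolding hyperplane_measure_alt
    by (subst emeasure_distr) (auto simp: space_restrict_space intro!: measurable_restrict_space1)
  also have "\<dots> = emeasure lborel (hyp_proj -` A \<inter> {x. 0 \<le> hyp_lev x \<and> hyp_lev x \<le> 1})"
    by (subst emeasure_restrict_space) auto
  also have "\<dots> = emeasure lborel ((hyp_proj -` A \<inter> {x. 0 \<le> hyp_lev x \<and> hyp_lev x \<le> 1}) - {x. hyp_lev x = 1})"
    using hyp_lev_null[of 1] by (intro emeasure_Diff_null_set[symmetric]) auto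
  also have "(hyp_proj -` A \<inter> {x. 0 \<le> hyp_lev x \<and> hyp_lev x \<le> 1}) - {x. hyp_lev x = 1} = {x. hyp_proj x \<in> A \<and> 0 \<le> hyp_lev x \<and> hyp_lev x < 1}"
    by auto
  finally show ?thesis .
qed

lemma space_hyperplane_measure [simp]: "space (hyperplane_measure n b) = UNIV"
  and sets_hyperplane_measure [simp, measurable_cong]: "sets (hyperplane_measure n b) = sets borel"
  by (auto simp: hyperplane_measure_def)

lemma norm_le_hyp_proj: "norm x \<le> norm (hyp_proj x) + \<bar>hyp_lev x\<bar>"
  using norm_triangle_ineq[of "hyp_proj x" "hyp_lev x *\<^sub>R n"] unit by (simp add: hyp_proj_def)

lemma emeasure_hyperplane_measure_cball: "emeasure (hyperplane_measure n b) (cball 0 r) < \<infinity>"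
proof -
  have "emeasure (hyperplane_measure n b) (cball 0 r) \<le> emeasure lborel (cball (0::real^'d) (r + 1))"
    unfolding emeasure_hyperplane_measure[OF borel_closed[OF closed_cball]]
    using norm_le_hyp_proj by (intro emeasure_mono) (auto, smt (verit) norm_le_hyp_proj)
  also have "\<dots> < \<infinity>" by (rule emeasure_lborel_cball_finite)
  finally show ?thesis .
qed

lemma sigma_finite_hyperplane_measure: "sigma_finite_measure (hyperplane_measure n b)"
proof
  show "\<exists>A. countable A \<and> A \<subseteq> sets (hyperplane_measure n b) \<and> \<Union>A = space (hyperplane_measure n b) \<and>
    (\<forall>a\<in>A. emeasure (hyperplane_measure n b) a \<noteq> \<infinity>)"
  proof (intro exI[of _ "range (\<lambda>i::nat. cball 0 (real i))"] conjI)
    show "\<Union> (range (\<lambda>i::nat. cball 0 (real i))) = space (hyperplane_measure n b)"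
      using real_arch_simple by auto
  qed (use emeasure_hyperplane_measure_cball in \<open>auto simp: less_top[symmetric]\<close>)
qed

text \<open>Translation along \<open>n\<close> makes the volume over \<open>A\<close> additive in
  the thickness, hence proportional to it, and thickness 1 fixes the factor. Boundedness of
  \<open>A\<close> keeps the volumes finite.\<close>

lemma emeasure_cylinder:
  assumes [measurable]: "A \<in> sets borel" and A: "A \<subseteq> cball 0 r" and xy: "x \<le> y"
  shows "emeasure lborel {z. hyp_proj z \<in> A \<and> x \<le> hyp_lev z \<and> hyp_lev z < y} =
     emeasure (hyperplane_measure n b) A * ennreal (y - x)"
proof -
  define E where "E s = {z. hyp_proj z \<in> A \<and> 0 \<le> hyp_lev z \<and> hyp_lev z < s}" for s
  have [measurable]: "E s \<in> sets lborel" for s unfolding E_def by measurable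
  have tr: "emeasure lborel {z. hyp_proj z \<in> A \<and> a \<le> hyp_lev z \<and> hyp_lev z < a + s} = emeasure lborel (E s)" for a s
  proof -
    have "emeasure lborel {z. hyp_proj (a *\<^sub>R n + z) \<in> A \<and> a \<le> hyp_lev (a *\<^sub>R n + z) \<and> hyp_lev (a *\<^sub>R n + z) < a + s} =
       emeasure lborel {z. hyp_proj z \<in> A \<and> a \<le> hyp_lev z \<and> hyp_lev z < a + s}"
      by (rule emeasure_lborel_translate) measurable
    then show ?thesis by (simp add: hyp_lev_add hyp_proj_add E_def add.commute)
  qed
  have fin: "emeasure lborel (E s) < \<infinity>" for s
  proof -
    have "emeasure lborel (E s) \<le> emeasure lborel (cball (0::real^'d) (r + \<bar>s\<bar>))"
      using A norm_le_hyp_proj by (intro emeasure_mono) (auto simp: E_def, smt (verit) norm_le_hyp_proj mem_cball_0 subsetD)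
    also have "\<dots> < \<infinity>" by (rule emeasure_lborel_cball_finite)
    finally show ?thesis .
  qed
  have "measure lborel (E (s + t)) = measure lborel (E s) + measure lborel (E t)" if "s \<ge> 0" "t \<ge> 0" for s t
  proof -
    have "E (s + t) = E s \<union> {z. hyp_proj z \<in> A \<and> s \<le> hyp_lev z \<and> hyp_lev z < s + t}" using that by (auto simp: E_def)
    moreover have "emeasure lborel {z. hyp_proj z \<in> A \<and> s \<le> hyp_lev z \<and> hyp_lev z < s + t} < \<infinity>" unfolding tr by (rule fin)
    moreover have "emeasure lborel (E s \<union> {z. hyp_proj z \<in> A \<and> s \<le> hyp_lev z \<and> hyp_lev z < s + t}) =
       emeasure lborel (E s) + emeasure lborel {z. hyp_proj z \<in> A \<and> s \<le> hyp_lev z \<and> hyp_lev z < s + t}"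
      by (intro plus_emeasure[symmetric]) (auto simp: E_def)
    ultimately have "emeasure lborel (E (s + t)) = emeasure lborel (E s) + emeasure lborel (E t)"
      by (simp add: tr)
    then show ?thesis using fin[of s] fin[of t] by (simp add: measure_def enn2real_plus)
  qed
  from additive_imp_linear[of "\<lambda>s. measure lborel (E s)", OF _ this, of "y - x"] xy
  have "measure lborel (E (y - x)) = (y - x) * measure lborel (E 1)" by simp
  then have "emeasure lborel (E (y - x)) = emeasure lborel (E 1) * ennreal (y - x)"
    using emeasure_eq_ennreal_measure[of lborel "E 1"] emeasure_eq_ennreal_measure[of lborel "E (y - x)"]
      fin[of 1] fin[of "y - x"] xy by (simp add: ennreal_mult' mult.commute less_top)
  then show ?thesis using tr[of x "y - x"] emeasure_hyperplane_measure[of A] by (simp add: E_def)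
qed

text \<open>For bounded \<open>A\<close> both sides are measures in \<open>B\<close> that agree on
  intervals by \<open>emeasure_cylinder\<close>; a general \<open>A\<close> is cut into bounded
  pieces.\<close>

lemma lborel_disintegration:
  "hyperplane_measure n b \<Otimes>\<^sub>M lborel = distr lborel (borel \<Otimes>\<^sub>M borel) (\<lambda>x. (hyp_proj x, hyp_lev x))"
proof (rule pair_measure_eqI)
  show "sigma_finite_measure (hyperplane_measure n b)" by (rule sigma_finite_hyperplane_measure)
  show "sigma_finite_measure lborel" ..
  show "sets (hyperplane_measure n b \<Otimes>\<^sub>M lborel) = sets (distr lborel (borel \<Otimes>\<^sub>M borel) (\<lambda>x. (hyp_proj x, hyp_lev x)))"
    unfolding sets_distr by (rule sets_pair_measure_cong) auto
next
  fix A B assume "A \<in> sets (hyperplane_measure n b)" "B \<in> sets (lborel :: real measure)"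
  then have [measurable]: "A \<in> sets borel" "B \<in> sets borel" by auto
  have bounded_case: "emeasure (hyperplane_measure n b) A * emeasure lborel B = emeasure lborel {x. hyp_proj x \<in> A \<and> hyp_lev x \<in> B}"
    if Ab [measurable]: "A \<in> sets borel" and A: "A \<subseteq> cball 0 r" for A r
  proof -
    define S where "S = {x. hyp_proj x \<in> A}"
    have [measurable]: "S \<in> sets borel" unfolding S_def by measurable
    define M1 where "M1 = distr (density lborel (indicator S)) borel hyp_lev"
    define M2 where "M2 = density (lborel :: real measure) (\<lambda>_. emeasure (hyperplane_measure n b) A)"
    have M1: "emeasure M1 X = emeasure lborel {x. hyp_proj x \<in> A \<and> hyp_lev x \<in> X}" if [measurable]: "X \<in> sets borel" for X
      unfolding M1_def by (subst emeasure_distr, simp, simp, subst emeasure_density) 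
         (auto simp: S_def intro!: arg_cong[where f = "emeasure lborel"] measurable_sets_borel[OF hyp_lev_measurable] simp flip: indicator_inter_arith)
    have M2: "emeasure M2 X = emeasure (hyperplane_measure n b) A * emeasure lborel X" if [measurable]: "X \<in> sets borel" for X
      unfolding M2_def by (subst emeasure_density) (auto simp: nn_integral_cmult_indicator)
    have "M1 = M2"
    proof (rule measure_eqI_generator_eq)
      let ?E = "range (\<lambda>(a, b). box a b::real set)"
      show "Int_stable ?E" by (auto simp: Int_stable_def box_Int_box)
      show "?E \<subseteq> Pow UNIV" "sets M1 = sigma_sets UNIV ?E" "sets M2 = sigma_sets UNIV ?E"
        by (simp_all add: borel_eq_box M1_def M2_def)
      let ?A = "\<lambda>n::nat. box (- (real n *\<^sub>R One)) (real n *\<^sub>R One) :: real set"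
      show "range ?A \<subseteq> ?E" "(\<Union>i. ?A i) = UNIV"
        unfolding UN_box_eq_UNIV by auto
      show eq: "emeasure M1 X = emeasure M2 X" if X: "X \<in> ?E" for X
      proof -
        obtain x y where X: "X = {x<..<y}" using X by (auto simp: box_real)
        show ?thesis
        proof (cases "x \<le> y")
          case True
          have "emeasure M1 X = emeasure lborel ({z. hyp_proj z \<in> A \<and> x \<le> hyp_lev z \<and> hyp_lev z < y} - {z. hyp_lev z = x})"
            unfolding X by (subst M1) (auto intro!: arg_cong[where f = "emeasure lborel"])
          also have "\<dots> = emeasure lborel {z. hyp_proj z \<in> A \<and> x \<le> hyp_lev z \<and> hyp_lev z < y}"
            by (intro emeasure_Diff_null_set hyp_lev_null) measurable
          also have "\<dots> = emeasure M2 X" using emeasure_cylinder[OF Ab A True] True by (simp add: M2 X)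
          finally show ?thesis .
        qed (simp add: X)
      qed
      show "emeasure M1 (?A i) \<noteq> \<infinity>" for i
      proof -
        have "emeasure M1 (?A i) = emeasure M2 (?A i)" by (rule eq) auto
        also have "\<dots> = emeasure (hyperplane_measure n b) A * emeasure lborel (?A i)" by (rule M2) simp
        also have "\<dots> < \<infinity>"
        proof (rule ennreal_mult_less_top[THEN iffD2, OF disjI2, OF disjI2, OF conjI, simplified infinity_ennreal_def[symmetric]])
          show "emeasure (hyperplane_measure n b) A < \<infinity>"
            using emeasure_mono[OF A, of "hyperplane_measure n b"] emeasure_hyperplane_measure_cball[of r] by (auto intro: le_less_trans)
        qed (rule emeasure_lborel_box_finite)
        finally show ?thesis by simp
      qed
    qed
    then show ?thesis using M1[of B] M2[of B] by simp
  qed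
  \<comment> \<open>Shells \<open>i < norm x \<le> i + 1\<close>; the origin, which they miss, is
    put into the first one.\<close>
  define D where "D i = A \<inter> (cball 0 (real (Suc i)) - cball 0 (real i) \<union> (if i = 0 then {0} else {}))" for i :: nat
  have [measurable]: "D i \<in> sets borel" for i unfolding D_def by measurable
  have disj: "disjoint_family D"
  proof -
    have "D i \<inter> D j = {}" if "i < j" for i j using that unfolding D_def by force
    then show ?thesis unfolding disjoint_family_on_def by (metis Int_commute linorder_neqE_nat)
  qed
  have UN: "(\<Union>i. D i) = A"
  proof -
    have "\<exists>i. x \<in> D i" if "x \<in> A" for x
    proof (cases "x = 0")
      case True then show ?thesis using that by (intro exI[of _ 0]) (auto simp: D_def)
    next
      case False
      define i where "i = nat (\<lceil>norm x\<rceil> - 1)"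
      have "norm x > 0" using False by simp
      then have "real i < norm x" "norm x \<le> real (Suc i)" unfolding i_def by linarith+
      then show ?thesis using that by (intro exI[of _ i]) (auto simp: D_def)
    qed
    then show ?thesis by (auto simp: D_def)
  qed
  have "emeasure (hyperplane_measure n b) A * emeasure lborel B = (\<Sum>i. emeasure (hyperplane_measure n b) (D i)) * emeasure lborel B"
    using suminf_emeasure[of D "hyperplane_measure n b"] disj UN by (auto simp: image_subset_iff)
  also have "\<dots> = (\<Sum>i. emeasure (hyperplane_measure n b) (D i) * emeasure lborel B)"
    by simp
  also have "\<dots> = (\<Sum>i. emeasure lborel {x. hyp_proj x \<in> D i \<and> hyp_lev x \<in> B})"
    by (intro suminf_cong bounded_case[of _ "real (Suc _)"]) (auto simp: D_def)
  also have "\<dots> = emeasure lborel (\<Union>i. {x. hyp_proj x \<in> D i \<and> hyp_lev x \<in> B})"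
    using disj by (intro suminf_emeasure) (auto simp: disjoint_family_on_def image_subset_iff)
  also have "(\<Union>i. {x. hyp_proj x \<in> D i \<and> hyp_lev x \<in> B}) = {x. hyp_proj x \<in> A \<and> hyp_lev x \<in> B}" using UN by auto
  also have "emeasure lborel \<dots> = emeasure (distr lborel (borel \<Otimes>\<^sub>M borel) (\<lambda>x. (hyp_proj x, hyp_lev x))) (A \<times> B)"
    by (subst emeasure_distr) (auto intro!: arg_cong[where f = "emeasure lborel"])
  finally show "emeasure (hyperplane_measure n b) A * emeasure lborel B = emeasure (distr lborel (borel \<Otimes>\<^sub>M borel) (\<lambda>x. (hyp_proj x, hyp_lev x))) (A \<times> B)" .
qed

end

lemma emeasure_lborel_hyp_proj_lev:
  fixes n :: "real^'d"
  assumes "norm n = 1" and [measurable]: "A \<in> sets borel" "B \<in> sets borel"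
  shows "emeasure lborel {x. hyp_proj n b x \<in> A \<and> hyp_lev n b x \<in> B} =
    emeasure (hyperplane_measure n b) A * emeasure lborel B"
proof -
  note [measurable] = hyp_proj_measurable[OF assms(1)] hyp_lev_measurable[OF assms(1)]
  have "emeasure (hyperplane_measure n b) A * emeasure lborel B =
      emeasure (hyperplane_measure n b \<Otimes>\<^sub>M lborel) (A \<times> B)"
    by (rule lborel.emeasure_pair_measure_Times[symmetric]) (auto simp: sets_hyperplane_measure[OF assms(1)])
  also have "\<dots> = emeasure lborel {x. hyp_proj n b x \<in> A \<and> hyp_lev n b x \<in> B}"
    unfolding lborel_disintegration[OF assms(1)]
    by (subst emeasure_distr) (auto intro!: arg_cong[where f = "emeasure lborel"])
  finally show ?thesis by simp
qed

section \<open>Orientation, null sets and positivity of the surface measure\<close>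

text \<open>With \<open>-n\<close> the unit slab lies on the other side of the plane, at heights in
  \<open>{-1<..0}\<close>, and only the length of the height interval counts. This makes the
  arbitrary choice in \<open>surface_measure\<close> harmless.\<close>

lemma hyperplane_measure_uminus:
  fixes n :: "real^'d"
  assumes "norm n = 1"
  shows "hyperplane_measure (-n) (-b) = hyperplane_measure n b"
proof (rule measure_eqI)
  have m: "norm (-n) = 1" using assms by simp
  show "sets (hyperplane_measure (-n) (-b)) = sets (hyperplane_measure n b)"
    using assms by (simp add: sets_hyperplane_measure)
  fix A assume "A \<in> sets (hyperplane_measure (-n) (-b))"
  then have A: "A \<in> sets borel" by (simp add: sets_hyperplane_measure[OF m])
  have eq: "hyp_lev (-n) (-b) x = - hyp_lev n b x" "hyp_proj (-n) (-b) x = hyp_proj n b x" for x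
    by (simp_all add: hyp_lev_def[OF assms] hyp_lev_def[OF m] hyp_proj_def[OF assms] hyp_proj_def[OF m] flip: scaleR_minus_left)
  have "emeasure (hyperplane_measure (-n) (-b)) A = 
      emeasure lborel {x. hyp_proj n b x \<in> A \<and> hyp_lev n b x \<in> {-1<..0}}"
    unfolding emeasure_hyperplane_measure[OF m A] eq by (auto intro!: arg_cong[where f = "emeasure lborel"])
  then show "emeasure (hyperplane_measure (-n) (-b)) A = emeasure (hyperplane_measure n b) A"
    using emeasure_lborel_hyp_proj_lev[OF assms A, of "{-1<..0}" b] by simp
qed

lemma unit_normal_unique:
  fixes n m :: "'a::real_inner"
  assumes n: "norm n = 1" and m: "norm m = 1" and eq: "{x. n \<bullet> x = b} = {x. m \<bullet> x = c}"
  shows "m = n \<and> c = b \<or> m = - n \<and> c = - b"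
proof -
  have nn: "n \<bullet> n = 1" "m \<bullet> m = 1" using n m by (simp_all add: norm_eq_1)
  have in_eq: "n \<bullet> x = b \<longleftrightarrow> m \<bullet> x = c" for x using eq by blast
  have mc: "m \<bullet> (b *\<^sub>R n) = c" using in_eq[of "b *\<^sub>R n"] nn by simp
  \<comment> \<open>Moving along \<open>w\<close>, the part of \<open>m\<close> orthogonal to
    \<open>n\<close>, stays in the plane, so \<open>m\<close> is orthogonal to \<open>w\<close> too
    and \<open>w\<close> vanishes.\<close>
  define w where "w = m - (n \<bullet> m) *\<^sub>R n"
  have "n \<bullet> w = 0" by (simp add: w_def inner_diff_right nn)
  then have "m \<bullet> w = 0" using in_eq[of "b *\<^sub>R n + w"] mc nn by (simp add: inner_add_right)
  then have "w \<bullet> w = 0" using \<open>n \<bullet> w = 0\<close> by (simp add: w_def inner_diff_left)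
  then have w: "m = (n \<bullet> m) *\<^sub>R n" by (simp add: w_def)
  then have "(n \<bullet> m) * (n \<bullet> m) = 1"
    using nn by (metis inner_scaleR_left)
  then have "n \<bullet> m = 1 \<or> n \<bullet> m = -1" by (metis square_eq_1_iff)
  then show ?thesis using w mc nn by auto
qed

lemma surface_measure_eq:
  fixes n :: "real^'d"
  assumes "norm n = 1" "affine hull F = {x. n \<bullet> x = b}"
  shows "surface_measure F = restrict_space (hyperplane_measure n b) F"
proof -
  have "(SOME M. \<exists>m c. norm m = 1 \<and> affine hull F = {x. m \<bullet> x = c} \<and> M = hyperplane_measure m c) = hyperplane_measure n b"
  proof (rule some_equality)
    fix M assume "\<exists>m c. norm m = 1 \<and> affine hull F = {x. m \<bullet> x = c} \<and> M = hyperplane_measure m c"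
    then obtain m c where "norm m = 1" "affine hull F = {x. m \<bullet> x = c}" "M = hyperplane_measure m c" by blast
    then show "M = hyperplane_measure n b"
      using unit_normal_unique[of n m b c] assms hyperplane_measure_uminus[of n b] by auto
  qed (use assms in blast)
  then show ?thesis unfolding surface_measure_def by simp
qed

text \<open>Pulled back under the projection, the other plane becomes a plane with normal
  \<open>m - (m \<bullet> n) *\<^sub>R n\<close>, which is a null set. If that vector vanishes, the
  two planes are parallel and distinct and the preimage is empty.\<close>

lemma hyperplane_measure_other_hyperplane:
  fixes n m :: "real^'d"
  assumes n: "norm n = 1" and m: "norm m = 1" and ne: "{x. n \<bullet> x = b} \<noteq> {x. m \<bullet> x = c}"
  shows "{x. m \<bullet> x = c} \<in> null_sets (hyperplane_measure n b)"
proof -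
  have cl: "{x. m \<bullet> x = c} \<in> sets borel" using closed_hyperplane[of m c] by auto
  have mp: "m \<bullet> hyp_proj n b x = (m - (m \<bullet> n) *\<^sub>R n) \<bullet> x + b * (m \<bullet> n)" for x
    by (simp add: hyp_proj_def[OF n] hyp_lev_def[OF n] inner_diff_left inner_diff_right algebra_simps)
  have "emeasure lborel {x. m \<bullet> hyp_proj n b x = c \<and> 0 \<le> hyp_lev n b x \<and> hyp_lev n b x < 1} = 0"
  proof (cases "m - (m \<bullet> n) *\<^sub>R n = 0")
    case False
    have "emeasure lborel {x. m \<bullet> hyp_proj n b x = c \<and> 0 \<le> hyp_lev n b x \<and> hyp_lev n b x < 1} \<le>
       emeasure lborel {x. (m - (m \<bullet> n) *\<^sub>R n) \<bullet> x = c - b * (m \<bullet> n)}"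
      unfolding mp by (intro emeasure_mono) (auto intro!: borel_closed closed_hyperplane)
    also have "\<dots> = 0" using hyperplane_null_lborel[OF False] by blast
    finally show ?thesis by simp
  next
    case True
    then have mn: "m = (m \<bullet> n) *\<^sub>R n" by simp
    have "(m \<bullet> n) * (m \<bullet> n) = 1"
      using mn m by (metis inner_commute inner_scaleR_left norm_eq_1)
    then have "m \<bullet> n = 1 \<or> m \<bullet> n = -1" by (metis square_eq_1_iff)
    then have "m = n \<or> m = -n" using mn by auto
    then have "b * (m \<bullet> n) \<noteq> c" using ne n by (auto simp: norm_eq_1)
    then show ?thesis unfolding mp True by simp
  qed
  then show ?thesis using emeasure_hyperplane_measure[OF n cl, of b] cl sets_hyperplane_measure[OF n, of b] 
    by (intro null_setsI) auto
qed

lemma hyperplane_measure_ball_pos: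
  fixes n y :: "real^'d"
  assumes n: "norm n = 1" and y: "n \<bullet> y = b" and e: "e > 0"
  shows "emeasure (hyperplane_measure n b) (ball y e) > 0"
proof -
  define r where "r = min (e / 2) (1 / 2)"
  have r: "r > 0" "r \<le> e / 2" "r \<le> 1 / 2" using e by (auto simp: r_def)
  have [measurable]: "hyp_proj n b \<in> borel_measurable borel" "hyp_lev n b \<in> borel_measurable borel"
    using hyp_proj_measurable[OF n] hyp_lev_measurable[OF n] by auto
  have nn: "n \<bullet> n = 1" using n by (simp add: norm_eq_1)
  \<comment> \<open>The ball sits at half height, so a radius of at most 1/2 keeps it in the unit
    slab; the distance of the projection to \<open>y\<close> is estimated by twice the radius, hence
    \<open>e / 2\<close>.\<close>
  have "ball (y + (1/2) *\<^sub>R n) r \<subseteq> {x. hyp_proj n b x \<in> ball y e \<and> 0 \<le> hyp_lev n b x \<and> hyp_lev n b x < 1}"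
  proof
    fix x assume "x \<in> ball (y + (1/2) *\<^sub>R n) r"
    then have x: "norm (x - (y + (1/2) *\<^sub>R n)) < r" by (simp add: dist_norm norm_minus_commute)
    define d where "d = x - (y + (1/2) *\<^sub>R n)"
    have d: "\<bar>n \<bullet> d\<bar> < r" using Cauchy_Schwarz_ineq2[of n d] x n by (simp add: d_def)
    have lev: "hyp_lev n b x = n \<bullet> d + 1/2"
      by (simp add: d_def hyp_lev_def[OF n] inner_diff_right inner_add_right nn y)
    have "hyp_proj n b x - y = d - (n \<bullet> d) *\<^sub>R n"
      unfolding hyp_proj_def[OF n] lev by (simp add: d_def algebra_simps)
    then have "norm (hyp_proj n b x - y) \<le> norm d + \<bar>n \<bullet> d\<bar>"
      using norm_triangle_ineq4[of d "(n \<bullet> d) *\<^sub>R n"] n by simp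
    then have "norm (hyp_proj n b x - y) < e" using d x r by (simp add: d_def)
    then show "x \<in> {x. hyp_proj n b x \<in> ball y e \<and> 0 \<le> hyp_lev n b x \<and> hyp_lev n b x < 1}"
      using lev d r by (auto simp: dist_norm norm_minus_commute)
  qed
  then have "emeasure lborel (ball (y + (1/2) *\<^sub>R n) r) \<le> emeasure (hyperplane_measure n b) (ball y e)"
    unfolding emeasure_hyperplane_measure[OF n borel_open[OF open_ball]] by (intro emeasure_mono) (auto, measurable)
  moreover have "emeasure lborel (ball (y + (1/2) *\<^sub>R n) r) > 0"
    using open_not_negligible[of "ball (y + (1/2) *\<^sub>R n) r"] r(1)
    by (auto simp: negligible_iff_null_sets null_sets_completion_iff zero_less_iff_neq_zero null_sets_def)
  ultimately show ?thesis by (rule less_le_trans[rotated])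
qed

text \<open>After stretching the slab of thickness \<open>\<epsilon> j\<close> to thickness one, this is dominated convergence.\<close>

lemma thin_slab_limit:
  fixes n :: "real^'d" and G :: "nat \<Rightarrow> real^'d \<Rightarrow> real"
  assumes n: "norm n = 1"
    and G [measurable]: "\<And>j. G j \<in> borel_measurable borel" and q [measurable]: "q \<in> borel_measurable borel"
    and bound: "\<And>j x. \<bar>G j x\<bar> \<le> M" and supp: "\<And>j x. x \<notin> cball 0 R \<Longrightarrow> G j x = 0"
    and e: "\<And>j. 0 < \<epsilon> j" "\<And>j. \<epsilon> j \<le> 1"
    and lim: "AE y in hyperplane_measure n b. \<forall>s. 0 < s \<and> s < 1 \<longrightarrow> (\<lambda>j. G j (y + (\<epsilon> j * s) *\<^sub>R n)) \<longlonglongrightarrow> q y"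
  shows "(\<lambda>j. (\<integral>x. indicator {x. 0 < hyp_lev n b x \<and> hyp_lev n b x < \<epsilon> j} x * G j x \<partial>lborel) / \<epsilon> j)
     \<longlonglongrightarrow> (\<integral>y. q y \<partial>hyperplane_measure n b)"
proof -
  let ?\<sigma> = "hyperplane_measure n b"
  let ?P = "?\<sigma> \<Otimes>\<^sub>M (lborel :: real measure)"
  note [measurable_cong] = sets_hyperplane_measure[OF n]
  have [measurable]: "hyp_proj n b \<in> borel_measurable borel" "hyp_lev n b \<in> borel_measurable borel"
    using hyp_proj_measurable[OF n] hyp_lev_measurable[OF n] by auto
  interpret S: sigma_finite_measure ?\<sigma> by (rule sigma_finite_hyperplane_measure[OF n])
  interpret P: pair_sigma_finite ?\<sigma> "lborel :: real measure" ..
  have [measurable]: "cball 0 (R + 1) \<in> sets (borel :: (real^'d) measure)" by (rule borel_closed[OF closed_cball])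
  have M: "M \<ge> 0" using bound[of undefined undefined] by linarith
  \<comment> \<open>Dominating function: the foot point is within distance 1 of a point of
    \<open>cball 0 R\<close>, as heights do not exceed \<open>\<epsilon> j \<le> 1\<close>; hence
    the radius \<open>R + 1\<close>.\<close>
  define w :: "(real^'d) \<times> real \<Rightarrow> real" where "w = (\<lambda>z. M * indicator (cball 0 (R + 1) \<times> {0<..<1}) z)"
  have intw: "integrable ?P w"
  proof -
    have "emeasure ?P (cball 0 (R + 1) \<times> {0<..<1}) = emeasure ?\<sigma> (cball 0 (R + 1)) * emeasure lborel {0<..<1::real}"
      by (rule lborel.emeasure_pair_measure_Times) auto
    then have "emeasure ?P (cball 0 (R + 1) \<times> {0<..<1}) < \<infinity>"
      using emeasure_hyperplane_measure_cball[OF n, of b "R + 1"] by simp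
    then show ?thesis unfolding w_def by (intro integrable_mult_right integrable_real_indicator) measurable
  qed
  \<comment> \<open>The stretched slab: the true height is \<open>\<epsilon> j * s\<close> with
    \<open>s\<close> in the unit interval.\<close>
  define g where "g j z = indicator {0<..<1} (snd z) * G j (fst z + (\<epsilon> j * snd z) *\<^sub>R n)" for j and z :: "(real^'d) \<times> real"
  have [measurable]: "g j \<in> borel_measurable ?P" for j unfolding g_def by measurable
  have gw: "norm (g j z) \<le> w z" for j z
  proof (cases "snd z \<in> {0<..<1} \<and> fst z + (\<epsilon> j * snd z) *\<^sub>R n \<in> cball 0 R")
    case True
    have "norm (fst z) \<le> norm (fst z + (\<epsilon> j * snd z) *\<^sub>R n) + norm ((\<epsilon> j * snd z) *\<^sub>R n)"
      using norm_triangle_ineq4[of "fst z + (\<epsilon> j * snd z) *\<^sub>R n" "(\<epsilon> j * snd z) *\<^sub>R n"] by simp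
    also have "\<dots> \<le> R + 1" using True n e[of j] by (auto simp: abs_mult intro!: add_mono mult_le_one)
    finally have "z \<in> cball 0 (R + 1) \<times> {0<..<1}" using True by (cases z) auto
    then show ?thesis using True bound by (simp add: g_def w_def)
  next
    case False
    then show ?thesis using supp[of "fst z + (\<epsilon> j * snd z) *\<^sub>R n" j] M by (auto simp: g_def w_def)
  qed
  have g_lim: "AE z in ?P. (\<lambda>j. g j z) \<longlonglongrightarrow> indicator {0<..<1} (snd z) * q (fst z)"
  proof -
    obtain N where N: "N \<in> null_sets ?\<sigma>" "\<And>y s. y \<notin> N \<Longrightarrow> 0 < s \<Longrightarrow> s < 1 \<Longrightarrow> (\<lambda>j. G j (y + (\<epsilon> j * s) *\<^sub>R n)) \<longlonglongrightarrow> q y"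
      using lim by (auto simp: eventually_ae_filter space_hyperplane_measure[OF n])
    have "N \<times> UNIV \<in> null_sets ?P"
      using N(1) lborel.emeasure_pair_measure_Times[of N ?\<sigma> UNIV] by (auto simp: null_sets_def)
    then show ?thesis
    proof (rule AE_I', safe)
      fix y s assume "\<not> (\<lambda>j. g j (y, s)) \<longlonglongrightarrow> indicator {0<..<1} (snd (y, s)) * q (fst (y, s))"
      then show "y \<in> N" using N(2)[of y s] by (cases "0 < s \<and> s < 1") (auto simp: g_def)
    qed auto
  qed
  have m2: "(\<lambda>z. indicator {0<..<1} (snd z) * q (fst z)) \<in> borel_measurable ?P" by measurable
  note dc = m2 _ intw g_lim AE_I2[OF gw]
  have int_g: "integrable ?P (g j)" for j
    by (rule Bochner_Integration.integrable_bound[OF intw]) (simp, intro AE_I2, metis gw abs_ge_self order_trans real_norm_def)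
  have int_l: "integrable ?P (\<lambda>z. indicator {0<..<1} (snd z) * q (fst z))"
    by (rule integrable_dominated_convergence[OF dc]) auto
  have conv: "(\<lambda>j. integral\<^sup>L ?P (g j)) \<longlonglongrightarrow> integral\<^sup>L ?P (\<lambda>z. indicator {0<..<1} (snd z) * q (fst z))"
    by (rule integral_dominated_convergence[OF dc]) auto
  have "integral\<^sup>L ?P (\<lambda>z. indicator {0<..<1} (snd z) * q (fst z)) = (\<integral>y. q y \<partial>?\<sigma>)"
    using P.integral_fst'[OF int_l] by simp
  moreover have "(\<integral>x. indicator {x. 0 < hyp_lev n b x \<and> hyp_lev n b x < \<epsilon> j} x * G j x \<partial>lborel) / \<epsilon> j = integral\<^sup>L ?P (g j)" for j
  proof -
    \<comment> \<open>The integrand in unstretched coordinates, where it is the slab integral by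
      \<open>lborel_disintegration\<close>; substituting in the height produces the factor
      \<open>\<epsilon> j\<close>.\<close>
    define h where "h z = indicator {0<..<\<epsilon> j} (snd z) * G j (fst z + snd z *\<^sub>R n)" for z :: "(real^'d) \<times> real"
    have [measurable]: "h \<in> borel_measurable (borel \<Otimes>\<^sub>M borel)" unfolding h_def by measurable
    have h: "h (hyp_proj n b x, hyp_lev n b x) = indicator {x. 0 < hyp_lev n b x \<and> hyp_lev n b x < \<epsilon> j} x * G j x" for x
      by (simp add: h_def hyp_proj_def[OF n] indicator_def)
    have hw: "norm (h z) \<le> w z" for z
    proof (cases "snd z \<in> {0<..<\<epsilon> j} \<and> fst z + snd z *\<^sub>R n \<in> cball 0 R")
      case True
      have "norm (fst z) \<le> norm (fst z + snd z *\<^sub>R n) + norm (snd z *\<^sub>R n)"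
        using norm_triangle_ineq4[of "fst z + snd z *\<^sub>R n" "snd z *\<^sub>R n"] by simp
      also have "\<dots> \<le> R + 1" using True n e[of j] by (auto intro!: add_mono)
      finally have "z \<in> cball 0 (R + 1) \<times> {0<..<1}" using True e(2)[of j] by (cases z) auto
      then show ?thesis using True bound by (simp add: h_def w_def)
    next
      case False
      then show ?thesis using supp[of "fst z + snd z *\<^sub>R n" j] M by (auto simp: h_def w_def)
    qed
    have int_h: "integrable ?P h"
      by (rule Bochner_Integration.integrable_bound[OF intw]) (simp, intro AE_I2, metis hw abs_ge_self order_trans real_norm_def)
    have "(\<integral>x. indicator {x. 0 < hyp_lev n b x \<and> hyp_lev n b x < \<epsilon> j} x * G j x \<partial>lborel) =
       integral\<^sup>L (distr lborel (borel \<Otimes>\<^sub>M borel) (\<lambda>x. (hyp_proj n b x, hyp_lev n b x))) h"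
      by (subst integral_distr) (auto simp: h)
    also have "\<dots> = integral\<^sup>L ?P h" using lborel_disintegration[OF n, of b] by simp
    also have "\<dots> = (\<integral>y. (\<integral>s. h (y, s) \<partial>lborel) \<partial>?\<sigma>)" using P.integral_fst'[OF int_h] by simp
    also have "\<dots> = (\<integral>y. \<epsilon> j * (\<integral>s. g j (y, s) \<partial>lborel) \<partial>?\<sigma>)"
    proof (rule Bochner_Integration.integral_cong[OF refl])
      fix y
      have *: "indicator {0<..<\<epsilon> j} (\<epsilon> j * s) = (indicator {0<..<1} s :: real)" for s
        using e(1)[of j] by (auto simp: indicator_def zero_less_mult_iff)
      show "(\<integral>s. h (y, s) \<partial>lborel) = \<epsilon> j * (\<integral>s. g j (y, s) \<partial>lborel)"
        using lborel_integral_real_affine[of "\<epsilon> j" "\<lambda>s. h (y, s)" 0] e(1)[of j] by (simp add: h_def g_def *)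
    qed
    also have "\<dots> = \<epsilon> j * integral\<^sup>L ?P (g j)" using P.integral_fst'[OF int_g] by simp
    finally show ?thesis using e(1)[of j] by simp
  qed
  ultimately show ?thesis using conv by simp
qed

section \<open>The divergence theorem for an arrangement of hyperplanes\<close>

text \<open>The sign is fixed by \<open>v\<close>, so that a step along \<open>v\<close> can cross
  the plane only from its negative to its positive side.\<close>

lemma hyperplane_unit_normal:
  assumes "hyperplane H" obtains n b where "norm n = 1" "H = {x. n \<bullet> x = b}" "n \<bullet> v \<ge> 0"
proof -
  obtain m c where mc: "m \<noteq> 0" "H = {x. m \<bullet> x = c}" using assms unfolding hyperplane_def by blast
  define s where "s = (if m \<bullet> v \<ge> 0 then 1 else -1 :: real)"
  have s: "s * s = 1" "s \<noteq> 0" "\<bar>s\<bar> = 1" "s * (m \<bullet> v) \<ge> 0" by (auto simp: s_def)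
  show thesis
  proof (rule that[of "(s / norm m) *\<^sub>R m" "s / norm m * c"])
    show "norm ((s / norm m) *\<^sub>R m) = 1" using mc s by simp
    show "H = {x. (s / norm m) *\<^sub>R m \<bullet> x = s / norm m * c}" using mc s by (auto simp: field_simps)
    show "(s / norm m) *\<^sub>R m \<bullet> v \<ge> 0" using s(4) by (simp add: divide_nonneg_nonneg)
  qed
qed

text \<open>Finitely many other planes are null for this measure. As it is a measure on the whole
  space, it also has to be shown to sit on its own plane.\<close>

lemma AE_hyperplane_measure_generic:
  fixes n :: "real^'d"
  assumes n: "norm n = 1" and fin: "finite \<H>" and H: "\<And>H. H \<in> \<H> \<Longrightarrow> hyperplane H"
  shows "AE y in hyperplane_measure n b. n \<bullet> y = b \<and> (\<forall>H\<in>\<H> - {{x. n \<bullet> x = b}}. y \<notin> H)"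
proof (rule AE_conjI)
  have [measurable]: "{y. n \<bullet> y \<noteq> b} \<in> sets borel" by measurable
  have "emeasure (hyperplane_measure n b) {y. n \<bullet> y \<noteq> b} = 0"
    using hyp_lev_proj[OF n, of b] emeasure_hyperplane_measure[OF n, of "{y. n \<bullet> y \<noteq> b}" b]
    by (simp add: hyp_lev_def[OF n])
  then have "{y. n \<bullet> y \<noteq> b} \<in> null_sets (hyperplane_measure n b)"
    by (intro null_setsI) (auto simp: sets_hyperplane_measure[OF n])
  then show "AE y in hyperplane_measure n b. n \<bullet> y = b" by (rule AE_I') auto
  show "AE y in hyperplane_measure n b. \<forall>H\<in>\<H> - {{x. n \<bullet> x = b}}. y \<notin> H"
  proof (subst AE_finite_all)
    show "finite (\<H> - {{x. n \<bullet> x = b}})" using fin by simp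
    show "\<forall>H\<in>\<H> - {{x. n \<bullet> x = b}}. AE y in hyperplane_measure n b. y \<notin> H"
    proof
      fix H' assume H': "H' \<in> \<H> - {{x. n \<bullet> x = b}}"
      then obtain m c where mc: "norm m = 1" "H' = {x. m \<bullet> x = c}" using H hyperplane_unit_normal[of H' 0] by blast
      then have "H' \<in> null_sets (hyperplane_measure n b)"
        using hyperplane_measure_other_hyperplane[OF n mc(1), of b c] H' by auto
      then show "AE y in hyperplane_measure n b. y \<notin> H'" by (rule AE_not_in)
    qed
  qed
qed

text \<open>The integral of \<open>\<partial>\<^sub>v p\<close> over \<open>T\<close> is the limit of the integrals of \<open>(1\<^sub>T(x - t v) - 1\<^sub>T(x)) p(x) / t\<close>, whose
  integrand lives on the slabs \<open>E H\<close> swept by the hyperplanes. Dividing by the number \<open>m\<close> of slabs that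
  contain \<open>x\<close> splits it into one thin slab integral per hyperplane. Almost every point of a hyperplane eventually
  sees \<open>m = 1\<close>.\<close>

lemma gauss_arrangement:
  fixes T :: "(real^'d) set" and v :: "real^'d" and N :: "(real^'d) set \<Rightarrow> real^'d"
  assumes T: "open T" "T \<subseteq> cball 0 R" and fin: "finite \<H>"
    and N: "\<And>H. H \<in> \<H> \<Longrightarrow> norm (N H) = 1" "\<And>H. H \<in> \<H> \<Longrightarrow> H = {x. N H \<bullet> x = off H}"
      "\<And>H. H \<in> \<H> \<Longrightarrow> N H \<bullet> v \<ge> 0"
    and sep: "\<And>x y. (\<And>H. H \<in> \<H> \<Longrightarrow> (N H \<bullet> x - off H) * (N H \<bullet> y - off H) > 0) \<Longrightarrow> x \<in> T \<longleftrightarrow> y \<in> T"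
    and \<nu> [measurable]: "\<And>H. H \<in> \<H> \<Longrightarrow> \<nu> H \<in> borel_measurable borel"
    and \<nu>_eq: "\<And>H y e P Q. H \<in> \<H> \<Longrightarrow> y \<in> H \<Longrightarrow> (\<And>H'. H' \<in> \<H> \<Longrightarrow> H' \<noteq> H \<Longrightarrow> y \<notin> H') \<Longrightarrow> e > 0 \<Longrightarrow>
        (\<And>z. z \<in> ball y e \<Longrightarrow> N H \<bullet> z > off H \<Longrightarrow> z \<in> T \<longleftrightarrow> P) \<Longrightarrow>
        (\<And>z. z \<in> ball y e \<Longrightarrow> N H \<bullet> z < off H \<Longrightarrow> z \<in> T \<longleftrightarrow> Q) \<Longrightarrow>
        \<nu> H y = (N H \<bullet> v) * (of_bool Q - of_bool P)"
    and p: "p \<in> cell_polys k"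
  shows "(\<integral>x. indicator T x * (grad p x \<bullet> v) \<partial>lborel) =
    (\<Sum>H\<in>\<H>. \<integral>y. p y * \<nu> H y \<partial>hyperplane_measure (N H) (off H))"
proof -
  have [measurable]: "T \<in> sets borel" using T(1) by auto
  have pc: "continuous_on S p" for S by (rule cell_polys_continuous[OF p])
  have pm [measurable]: "p \<in> borel_measurable borel" using pc by (rule borel_measurable_continuous_onI)
  define p' where "p' x = grad p x \<bullet> v" for x
  have p'c: "continuous_on S p'" for S
    unfolding p'_def by (intro continuous_intros grad_continuous[OF p])
  have p'm [measurable]: "p' \<in> borel_measurable borel" using p'c by (rule borel_measurable_continuous_onI)
  have dp: "((\<lambda>t. p (x + t *\<^sub>R v)) has_real_derivative p' (x + t *\<^sub>R v)) (at t)" for x t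
  proof -
    have "(p has_derivative (\<lambda>h. h \<bullet> grad p (x + t *\<^sub>R v))) (at (x + t *\<^sub>R v))"
      using GDERIV_grad[OF p, unfolded gderiv_def] .
    then have "((\<lambda>t. p (x + t *\<^sub>R v)) has_derivative (\<lambda>s. (s *\<^sub>R v) \<bullet> grad p (x + t *\<^sub>R v))) (at t)"
      by (rule has_derivative_compose[rotated]) (auto intro!: derivative_eq_intros)
    moreover have "(\<lambda>s. (s *\<^sub>R v) \<bullet> grad p (x + t *\<^sub>R v)) = (*) (p' (x + t *\<^sub>R v))"
      by (simp add: fun_eq_iff p'_def inner_commute[of v] mult.commute)
    ultimately show ?thesis by (simp add: has_field_derivative_def)
  qed
  \<comment> \<open>The factor \<open>1 + norm v\<close> makes both \<open>t j\<close> and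
    \<open>t j * norm v\<close> at most 1: translated points of \<open>T\<close> stay in the ball of
    radius \<open>R + 1\<close>, and the slabs have thickness at most 1.\<close>
  define t where "t j = inverse (real (Suc j)) / (1 + norm v)" for j
  have t: "t j > 0" for j unfolding t_def by (auto intro!: divide_pos_pos add_pos_nonneg)
  have t_lim: "t \<longlonglongrightarrow> 0"
    unfolding t_def using tendsto_divide[OF LIMSEQ_inverse_real_of_nat tendsto_const, of "1 + norm v"]
    by (simp add: add_pos_nonneg less_imp_neq[symmetric])
  have t1: "t j * (1 + norm v) \<le> 1" for j
    unfolding t_def by (simp add: add_pos_nonneg less_imp_neq[symmetric] field_simps)
  have tv: "t j * norm v \<le> 1" "t j \<le> 1" for j
  proof -
    have "0 \<le> t j * norm v" using t[of j] by simp
    then show "t j * norm v \<le> 1" "t j \<le> 1" using t1[of j] t[of j] unfolding distrib_left by linarith+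
  qed
  obtain K where K: "\<And>x. x \<in> cball 0 (R + 1) \<Longrightarrow> \<bar>p' x\<bar> \<le> K" 
    using compact_imp_bounded[OF compact_continuous_image[OF p'c compact_cball]] unfolding bounded_iff by fastforce
  obtain M0 where M0: "\<And>x. x \<in> cball 0 (R + 1) \<Longrightarrow> \<bar>p x\<bar> \<le> M0" 
    using compact_imp_bounded[OF compact_continuous_image[OF pc compact_cball]] unfolding bounded_iff by fastforce
  define M where "M = max 0 M0"
  have M: "M \<ge> 0" "\<And>x. x \<in> cball 0 (R + 1) \<Longrightarrow> \<bar>p x\<bar> \<le> M" using M0 by (force simp: M_def)+
  have stepR: "x + t j *\<^sub>R v \<in> cball 0 (R + 1)" "x \<in> cball 0 (R + 1)" if "x \<in> T" for x j
    using norm_triangle_ineq[of x "t j *\<^sub>R v"] that T(2) tv[of j] t[of j] by auto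
  \<comment> \<open>The mean value theorem bounds the difference quotients uniformly in
    \<open>j\<close>, as dominated convergence requires.\<close>
  have quot_bound: "\<bar>(p (x + t j *\<^sub>R v) - p x) / t j\<bar> \<le> K" if "x \<in> T" for x j
  proof -
    obtain \<xi> where \<xi>: "0 < \<xi>" "\<xi> < t j" "p (x + t j *\<^sub>R v) - p (x + 0 *\<^sub>R v) = (t j - 0) * p' (x + \<xi> *\<^sub>R v)"
      using MVT2[OF t[of j], of "\<lambda>t. p (x + t *\<^sub>R v)" "\<lambda>t. p' (x + t *\<^sub>R v)"] dp by blast
    have "\<xi> * norm v \<le> t j * norm v" using \<xi> by (intro mult_right_mono) auto
    then have "x + \<xi> *\<^sub>R v \<in> cball 0 (R + 1)"
      using norm_triangle_ineq[of x "\<xi> *\<^sub>R v"] that T(2) tv[of j] \<xi> by auto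
    then show ?thesis using K \<xi> t[of j] by simp
  qed
  have intT: "integrable lborel (indicator T :: real^'d \<Rightarrow> real)"
    using T(2) emeasure_lborel_cball_finite[of 0 R] emeasure_mono[of T "cball 0 R" lborel] 
    by (intro integrable_real_indicator) (auto intro: le_less_trans)
  have int_supp: "integrable lborel (\<lambda>x. indicator T (x + c) * p (x + d))" for c d :: "real^'d"
  proof -
    have sub: "{x. x + c \<in> T} \<subseteq> cball 0 (R + norm c)"
    proof safe
      fix x assume "x + c \<in> T"
      then show "x \<in> cball 0 (R + norm c)"
        using T(2) norm_triangle_ineq4[of "x + c" c] by auto
    qed
    obtain B where B: "\<And>x. x \<in> cball 0 (R + norm c + norm d) \<Longrightarrow> \<bar>p x\<bar> \<le> B" 
      using compact_imp_bounded[OF compact_continuous_image[OF pc compact_cball]] unfolding bounded_iff by fastforce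
    show ?thesis
    proof (rule Bochner_Integration.integrable_bound)
      show "integrable lborel (\<lambda>x. B * indicator (cball 0 (R + norm c)) x :: real)"
        using emeasure_lborel_cball_finite[of 0 "R + norm c"] 
        by (intro integrable_mult_right integrable_real_indicator) auto
      show "AE x in lborel. norm (indicator T (x + c) * p (x + d)) \<le> norm (B * indicator (cball 0 (R + norm c)) x)"
      proof (intro AE_I2)
        fix x
        show "norm (indicator T (x + c) * p (x + d)) \<le> norm (B * indicator (cball 0 (R + norm c)) x :: real)"
        proof (cases "x + c \<in> T")
          case True
          then have x: "norm x \<le> R + norm c" using sub by auto
          then have "\<bar>p (x + d)\<bar> \<le> B" using B[of "x + d"] norm_triangle_ineq[of x d] by auto
          then show ?thesis using True x by simp
        qed simp
      qed
    qed measurable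
  qed
  define D where "D j x = (indicator T (x - t j *\<^sub>R v) - indicator T x) * p x" for j x
  define A where "A j = (\<integral>x. indicator T x * ((p (x + t j *\<^sub>R v) - p x) / t j) \<partial>lborel)" for j
  have A_lim: "A \<longlonglongrightarrow> (\<integral>x. indicator T x * p' x \<partial>lborel)"
    unfolding A_def
  proof (rule integral_dominated_convergence[where w = "\<lambda>x. K * indicator T x"])
    show "integrable lborel (\<lambda>x. K * indicator T x)" using intT by simp
    show "AE x in lborel. (\<lambda>j. indicator T x * ((p (x + t j *\<^sub>R v) - p x) / t j)) \<longlonglongrightarrow> indicator T x * p' x"
    proof (intro AE_I2 tendsto_mult tendsto_const)
      fix x
      have "((\<lambda>h. (p (x + (0 + h) *\<^sub>R v) - p (x + 0 *\<^sub>R v)) / h) \<longlongrightarrow> p' (x + 0 *\<^sub>R v)) (at 0)"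
        using dp[of x 0] unfolding DERIV_def by simp
      moreover have "filterlim t (at 0) sequentially"
        using t_lim t by (auto simp: filterlim_at less_imp_neq[symmetric])
      ultimately show "(\<lambda>j. (p (x + t j *\<^sub>R v) - p x) / t j) \<longlonglongrightarrow> p' x"
        by (auto dest: filterlim_compose)
    qed
    show "AE x in lborel. norm (indicator T x * ((p (x + t j *\<^sub>R v) - p x) / t j)) \<le> K * indicator T x" for j
      using quot_bound by (intro AE_I2) (auto simp: indicator_def)
  qed measurable
  have A_eq: "A j = (\<integral>x. D j x \<partial>lborel) / t j" for j
  proof -
    have i1: "integrable lborel (\<lambda>x. indicator T x * p (x + t j *\<^sub>R v))" "integrable lborel (\<lambda>x. indicator T x * p x)"
      using int_supp[of 0] int_supp[of 0 0] by auto
    have i2: "integrable lborel (\<lambda>x. indicator T (x - t j *\<^sub>R v) * p x)"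
      using int_supp[of "- t j *\<^sub>R v" 0] by simp
    have "A j = (\<integral>x. indicator T x * p (x + t j *\<^sub>R v) - indicator T x * p x \<partial>lborel) / t j"
    proof -
      have "A j = (\<integral>x. (indicator T x * p (x + t j *\<^sub>R v) - indicator T x * p x) / t j \<partial>lborel)"
        unfolding A_def by (intro Bochner_Integration.integral_cong) (auto simp: right_diff_distrib)
      then show ?thesis by simp
    qed
    also have "\<dots> = ((\<integral>x. indicator T x * p (x + t j *\<^sub>R v) \<partial>lborel) - (\<integral>x. indicator T x * p x \<partial>lborel)) / t j"
      using i1 by simp
    \<comment> \<open>Translation invariance moves the shift from \<open>p\<close> to the indicator
      of \<open>T\<close>.\<close>
    also have "(\<integral>x. indicator T x * p (x + t j *\<^sub>R v) \<partial>lborel) = (\<integral>x. indicator T (x - t j *\<^sub>R v) * p x \<partial>lborel)"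
      by (subst (2) lborel_distr_plus[of "t j *\<^sub>R v", symmetric], subst integral_distr) (auto simp: add.commute)
    also have "\<dots> - (\<integral>x. indicator T x * p x \<partial>lborel) = (\<integral>x. D j x \<partial>lborel)"
      using i1 i2 by (simp add: D_def left_diff_distrib)
    finally show ?thesis .
  qed
  define c where "c H = N H \<bullet> v" for H
  define \<H>' where "\<H>' = {H \<in> \<H>. c H > 0}"
  have fin': "finite \<H>'" "\<H>' \<subseteq> \<H>" using fin by (auto simp: \<H>'_def)
  define l where "l H x = N H \<bullet> x - off H" for H x
  have lev: "hyp_lev (N H) (off H) x = l H x" if "H \<in> \<H>" for H x
    using hyp_lev_def[OF N(1)[OF that]] by (simp add: l_def)
  have [measurable]: "l H \<in> borel_measurable borel" for H unfolding l_def by measurable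
  \<comment> \<open>The points \<open>x\<close> above \<open>H\<close> whose predecessor
    \<open>x - t j *\<^sub>R v\<close> lies below \<open>H\<close>.\<close>
  define E where "E H j = {x. 0 < l H x \<and> l H x < t j * c H}" for H j
  have [measurable]: "E H j \<in> sets borel" for H j unfolding E_def by measurable
  define m where "m j x = (\<Sum>H\<in>\<H>'. indicator (E H j) x :: real)" for j x
  have [measurable]: "m j \<in> borel_measurable borel" for j unfolding m_def[abs_def] by measurable
  \<comment> \<open>Where no slab contains \<open>x\<close>, division by zero gives 0, which agrees
    with \<open>D\<close> almost everywhere there.\<close>
  define G where "G j x = D j x / m j x" for j x
  have [measurable]: "D j \<in> borel_measurable borel" for j unfolding D_def[abs_def] by measurable
  have [measurable]: "G j \<in> borel_measurable borel" for j unfolding G_def[abs_def] by measurable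
  \<comment> \<open>\<open>m\<close> counts slabs, so dividing by it never enlarges
    \<open>D\<close>.\<close>
  have m01: "m j x = 0 \<or> m j x \<ge> 1" for j x
  proof (cases "\<exists>H\<in>\<H>'. x \<in> E H j")
    case True
    then obtain H where "H \<in> \<H>'" "x \<in> E H j" by blast
    then have "(\<Sum>H\<in>{H}. indicator (E H j) x :: real) \<le> m j x" unfolding m_def using fin' by (intro sum_mono2) auto
    then show ?thesis using \<open>x \<in> E H j\<close> by simp
  qed (auto simp: m_def intro!: sum.neutral)
  have D0: "D j x = 0" if "x \<notin> cball 0 (R + 1)" for j x
    using stepR(2)[of x] stepR(1)[of "x - t j *\<^sub>R v" j] that by (auto simp: D_def indicator_def)
  have DM: "\<bar>D j x\<bar> \<le> M" for j x
  proof (cases "x \<in> cball 0 (R + 1)")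
    case True
    then have "\<bar>p x\<bar> \<le> M" by (rule M)
    then show ?thesis using M(1) by (auto simp: D_def indicator_def)
  qed (use M D0 in auto)
  have GM: "\<bar>G j x\<bar> \<le> M" for j x
  proof (cases "m j x = 0")
    case False
    then have "m j x \<ge> 1" using m01 by blast
    then have "\<bar>G j x\<bar> \<le> \<bar>D j x\<bar> / 1" unfolding G_def abs_divide by (intro divide_left_mono) auto
    then show ?thesis using DM[of j x] by simp
  qed (simp add: G_def M)
  have G0: "G j x = 0" if "x \<notin> cball 0 (R + 1)" for j x using D0[OF that] by (simp add: G_def)
  have null: "AE x in lborel. \<forall>H\<in>\<H>. l H x \<noteq> 0 \<and> l H x \<noteq> t j * c H" for j
  proof (subst AE_finite_all[OF fin], intro ballI AE_conjI)
    fix H assume H: "H \<in> \<H>"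
    have *: "AE x in lborel. l H x \<noteq> a" for a
      using AE_not_in[OF hyp_lev_null[OF N(1)[OF H], where b = "off H" and c = a]] by (simp add: lev[OF H])
    show "AE x in lborel. l H x \<noteq> 0" "AE x in lborel. l H x \<noteq> t j * c H" by (rule *)+
  qed
  have split: "AE x in lborel. D j x = (\<Sum>H\<in>\<H>'. indicator (E H j) x * G j x)" for j
    using null[of j]
  proof eventually_elim
    fix x assume x: "\<forall>H\<in>\<H>. l H x \<noteq> 0 \<and> l H x \<noteq> t j * c H"
    have "D j x = m j x * G j x"
    proof (cases "m j x = 0")
      case True
      \<comment> \<open>Outside all slabs, \<open>x\<close> and its predecessor have the same strict
        sign with respect to every plane.\<close>
      have "x \<in> T \<longleftrightarrow> x - t j *\<^sub>R v \<in> T"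
      proof (rule sep)
        fix H assume H: "H \<in> \<H>"
        have l2: "N H \<bullet> (x - t j *\<^sub>R v) - off H = l H x - t j * c H" by (simp add: l_def c_def inner_diff_right)
        have "x \<notin> E H j"
        proof (cases "H \<in> \<H>'")
          case True' : True
          have "(\<Sum>H\<in>\<H>'. indicator (E H j) x :: real) = 0" using True by (simp add: m_def)
          then have "indicator (E H j) x = (0::real)" using fin' True' by (subst (asm) sum_nonneg_eq_0_iff) auto
          then show ?thesis by (simp add: indicator_eq_0_iff)
        next
          case False
          then have "c H = 0" using N(3)[OF H] H by (simp add: \<H>'_def c_def)
          then show ?thesis by (simp add: E_def)
        qed
        then have "l H x < 0 \<or> l H x > t j * c H" using x H by (auto simp: E_def)
        moreover have "t j * c H \<ge> 0" using t[of j] N(3)[OF H] by (simp add: c_def)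
        ultimately have "l H x * (l H x - t j * c H) > 0" by (auto intro: mult_neg_neg)
        then show "(N H \<bullet> x - off H) * (N H \<bullet> (x - t j *\<^sub>R v) - off H) > 0" unfolding l2 by (simp add: l_def)
      qed
      then show ?thesis using True by (auto simp: D_def indicator_def)
    qed (simp add: G_def)
    then show "D j x = (\<Sum>H\<in>\<H>'. indicator (E H j) x * G j x)" by (simp add: m_def sum_distrib_right)
  qed
  have intG: "integrable lborel (\<lambda>x. indicator (E H j) x * G j x)" for H j
  proof (rule Bochner_Integration.integrable_bound)
    show "integrable lborel (\<lambda>x :: real^'d. M * indicator (cball 0 (R + 1)) x :: real)"
      using emeasure_lborel_cball_finite[of "0::real^'d" "R + 1"] 
      by (intro integrable_mult_right integrable_real_indicator) auto
    show "AE x in lborel. norm (indicator (E H j) x * G j x) \<le> norm (M * indicator (cball 0 (R + 1)) x)"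
      using GM G0 M by (intro AE_I2) (auto simp: indicator_def)
  qed measurable
  have A_eq2: "A j = (\<Sum>H\<in>\<H>'. c H * ((\<integral>x. indicator (E H j) x * G j x \<partial>lborel) / (t j * c H)))" for j
  proof -
    have "(\<integral>x. D j x \<partial>lborel) = (\<integral>x. (\<Sum>H\<in>\<H>'. indicator (E H j) x * G j x) \<partial>lborel)"
      using split[of j] by (intro integral_cong_AE) auto
    also have "\<dots> = (\<Sum>H\<in>\<H>'. \<integral>x. indicator (E H j) x * G j x \<partial>lborel)"
      using intG by (intro Bochner_Integration.integral_sum)
    finally have "A j = (\<Sum>H\<in>\<H>'. (\<integral>x. indicator (E H j) x * G j x \<partial>lborel) / t j)"
      unfolding A_eq by (simp add: sum_divide_distrib)
    \<comment> \<open>Expanding by \<open>c H\<close> normalises each integral by the thickness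
      \<open>t j * c H\<close> of its slab.\<close>
    also have "\<dots> = (\<Sum>H\<in>\<H>'. c H * ((\<integral>x. indicator (E H j) x * G j x \<partial>lborel) / (t j * c H)))"
      by (intro sum.cong) (auto simp: \<H>'_def)
    finally show ?thesis .
  qed
  have local: "\<exists>e P Q. e > 0 \<and> (\<forall>z. z \<in> ball y e \<longrightarrow> N H \<bullet> z > off H \<longrightarrow> (z \<in> T) = P) \<and>
      (\<forall>z. z \<in> ball y e \<longrightarrow> N H \<bullet> z < off H \<longrightarrow> (z \<in> T) = Q)"
    if H: "H \<in> \<H>" and y: "\<And>H'. H' \<in> \<H> - {H} \<Longrightarrow> y \<notin> H'" for H y
  proof -
    \<comment> \<open>Distance to the nearest other plane; the 1 makes the minimum exist when there
      is no other plane.\<close>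
    define e where "e = Min (insert 1 ((\<lambda>H'. \<bar>l H' y\<bar>) ` (\<H> - {H})))"
    have ly: "l H' y \<noteq> 0" if "H' \<in> \<H> - {H}" for H' using y[OF that] N(2)[of H'] that by (auto simp: l_def)
    have e: "e > 0" unfolding e_def using fin ly by (subst Min_gr_iff) auto
    have el: "e \<le> \<bar>l H' y\<bar>" if "H' \<in> \<H> - {H}" for H' unfolding e_def using fin that by (intro Min_le) auto
    have near: "\<bar>l H' z - l H' y\<bar> < \<bar>l H' y\<bar>" if "H' \<in> \<H> - {H}" "z \<in> ball y e" for H' z
    proof -
      have "l H' z - l H' y = N H' \<bullet> (z - y)" by (simp add: l_def inner_diff_right)
      then have "\<bar>l H' z - l H' y\<bar> \<le> norm (z - y)" using Cauchy_Schwarz_ineq2[of "N H'" "z - y"] N(1)[of H'] that by simp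
      then show ?thesis using that el[OF that(1)] by (auto simp: dist_norm norm_minus_commute)
    qed
    have same: "l H' z * l H' z' > 0" if "H' \<in> \<H> - {H}" "z \<in> ball y e" "z' \<in> ball y e" for H' z z'
      using near[OF that(1,2)] near[OF that(1,3)] ly[OF that(1)]
      by (cases "l H' y > 0") (auto intro!: mult_pos_pos mult_neg_neg simp: abs_if split: if_splits)
    have sepH: "z \<in> T \<longleftrightarrow> z' \<in> T" if "z \<in> ball y e" "z' \<in> ball y e" "l H z * l H z' > 0" for z z'
    proof (rule sep)
      fix H' assume "H' \<in> \<H>"
      then show "(N H' \<bullet> z - off H') * (N H' \<bullet> z' - off H') > 0"
        using same[of H' z z'] that by (cases "H' = H") (auto simp: l_def)
    qed
    have sepP: "z \<in> T \<longleftrightarrow> z' \<in> T" if "z \<in> ball y e" "z' \<in> ball y e" "N H \<bullet> z > off H" "N H \<bullet> z' > off H" for z z'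
      using that by (intro sepH) (auto simp: l_def)
    have sepQ: "z \<in> T \<longleftrightarrow> z' \<in> T" if "z \<in> ball y e" "z' \<in> ball y e" "N H \<bullet> z < off H" "N H \<bullet> z' < off H" for z z'
      using that by (intro sepH) (auto simp: l_def intro: mult_neg_neg)
    show ?thesis
    proof (intro exI conjI allI impI)
      show "e > 0" by (rule e)
      fix z assume z: "z \<in> ball y e"
      \<comment> \<open>Membership is constant on each half of the ball, so the existence of a point
        of \<open>T\<close> in that half can serve as its truth value.\<close>
      show "(z \<in> T) = (\<exists>z'\<in>ball y e. N H \<bullet> z' > off H \<and> z' \<in> T)" if "N H \<bullet> z > off H"
        using sepP[OF z _ that] that z by blast
      show "(z \<in> T) = (\<exists>z'\<in>ball y e. N H \<bullet> z' < off H \<and> z' \<in> T)" if "N H \<bullet> z < off H"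
        using sepQ[OF z _ that] that z by blast
    qed
  qed
  have generic: "AE y in hyperplane_measure (N H) (off H). y \<in> H \<and> (\<forall>H'\<in>\<H> - {H}. y \<notin> H')" if H: "H \<in> \<H>" for H
  proof -
    have "hyperplane H'" if "H' \<in> \<H>" for H'
      unfolding hyperplane_def using N(1)[OF that] N(2)[OF that] by (intro exI[of _ "N H'"] exI[of _ "off H'"]) auto
    from AE_hyperplane_measure_generic[OF N(1)[OF H] fin this, of "off H"] show ?thesis
      using N(2)[OF H] by auto
  qed
  have slab_lim: "(\<lambda>j. (\<integral>x. indicator (E H j) x * G j x \<partial>lborel) / (t j * c H)) \<longlonglongrightarrow>
      (\<integral>y. p y * \<nu> H y / c H \<partial>hyperplane_measure (N H) (off H))" if H': "H \<in> \<H>'" for H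
  proof -
    have H: "H \<in> \<H>" and cH: "c H > 0" using H' by (auto simp: \<H>'_def)
    have [measurable]: "\<nu> H \<in> borel_measurable borel" by (rule \<nu>[OF H])
    have cv: "c H \<le> norm v" using Cauchy_Schwarz_ineq2[of "N H" v] N(1)[OF H] by (simp add: c_def)
    have "(\<lambda>j. (\<integral>x. indicator {x. 0 < hyp_lev (N H) (off H) x \<and> hyp_lev (N H) (off H) x < t j * c H} x * G j x \<partial>lborel) / (t j * c H))
       \<longlonglongrightarrow> (\<integral>y. p y * \<nu> H y / c H \<partial>hyperplane_measure (N H) (off H))"
    proof (rule thin_slab_limit[OF N(1)[OF H], where M = M and R = "R + 1"])
      show "t j * c H \<le> 1" for j
        using order_trans[OF mult_left_mono[OF cv less_imp_le[OF t]] tv(1)] .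
      show "AE y in hyperplane_measure (N H) (off H). \<forall>s. 0 < s \<and> s < 1 \<longrightarrow>
          (\<lambda>j. G j (y + (t j * c H * s) *\<^sub>R N H)) \<longlonglongrightarrow> p y * \<nu> H y / c H"
        using generic[OF H]
      proof eventually_elim
        fix y assume y: "y \<in> H \<and> (\<forall>H'\<in>\<H> - {H}. y \<notin> H')"
        obtain e P Q where e: "e > 0" "\<And>z. z \<in> ball y e \<Longrightarrow> N H \<bullet> z > off H \<Longrightarrow> (z \<in> T) = P"
          "\<And>z. z \<in> ball y e \<Longrightarrow> N H \<bullet> z < off H \<Longrightarrow> (z \<in> T) = Q" using local[OF H, of y] y by blast
        have "\<nu> H y = (N H \<bullet> v) * (of_bool Q - of_bool P)"
          by (rule \<nu>_eq[OF H _ _ e]) (use y in auto)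
        then have \<nu>y: "p y * \<nu> H y / c H = (of_bool Q - of_bool P) * p y" using cH by (simp add: c_def)
        have ly: "l H y = 0" using y N(2)[OF H] by (auto simp: l_def)
        show "\<forall>s. 0 < s \<and> s < 1 \<longrightarrow> (\<lambda>j. G j (y + (t j * c H * s) *\<^sub>R N H)) \<longlonglongrightarrow> p y * \<nu> H y / c H"
        proof (intro allI impI)
          fix s :: real assume s: "0 < s \<and> s < 1"
          \<comment> \<open>The point at relative height \<open>s\<close> of the slab lies above
            \<open>H\<close>, its predecessor at relative height \<open>s - 1\<close> below; so the
            first indicator in \<open>D\<close> reads off \<open>Q\<close>, the second
            \<open>P\<close>.\<close>
          define x where "x j = y + (t j * c H * s) *\<^sub>R N H" for j
          have x_lim: "x \<longlonglongrightarrow> y"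
            unfolding x_def by (rule tendsto_eq_intros t_lim refl | simp)+
          have xv_lim: "(\<lambda>j. x j - t j *\<^sub>R v) \<longlonglongrightarrow> y"
            by (rule tendsto_eq_intros t_lim x_lim refl | simp)+
          have nn: "N H \<bullet> N H = 1" using N(1)[OF H] by (simp add: norm_eq_1)
          have lx: "l H (x j) = t j * c H * s" for j using ly nn by (simp add: l_def x_def inner_add_right)
          have lxv: "l H (x j - t j *\<^sub>R v) = t j * c H * (s - 1)" for j
            using lx[of j] by (simp add: l_def inner_diff_right c_def algebra_simps)
          have pos: "t j * c H * s > 0" "t j * c H * (s - 1) < 0" "t j * c H * s < t j * c H" for j
            using t[of j] cH s by (auto simp: mult_pos_neg)
          \<comment> \<open>\<open>y\<close> is off every other plane, so the slabs shrinking onto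
            those planes eventually miss points converging to \<open>y\<close>.\<close>
          have others: "\<forall>\<^sub>F j in sequentially. x j \<notin> E H' j" if "H' \<in> \<H>' - {H}" for H'
          proof -
            have l_lim: "(\<lambda>j. l H' (x j)) \<longlonglongrightarrow> l H' y" 
              unfolding l_def by (rule tendsto_eq_intros x_lim refl | simp)+
            have l_lim2: "(\<lambda>j. l H' (x j) - t j * c H') \<longlonglongrightarrow> l H' y" 
              by (rule tendsto_eq_intros l_lim t_lim refl | simp)+
            have "l H' y \<noteq> 0" using y N(2)[of H'] that fin' by (auto simp: l_def)
            then consider "l H' y < 0" | "l H' y > 0" by linarith
            then show ?thesis
            proof cases
              case 1
              from order_tendstoD(2)[OF l_lim 1] show ?thesis by eventually_elim (auto simp: E_def)
            next
              case 2
              from order_tendstoD(1)[OF l_lim2 2] show ?thesis by eventually_elim (auto simp: E_def)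
            qed
          qed
          have "\<forall>\<^sub>F j in sequentially. \<forall>H'\<in>\<H>' - {H}. x j \<notin> E H' j"
            using others fin' by (intro eventually_ball_finite) auto
          moreover have "\<forall>\<^sub>F j in sequentially. x j \<in> ball y e"
            using tendstoD[OF x_lim e(1)] by eventually_elim (simp add: dist_commute)
          moreover have "\<forall>\<^sub>F j in sequentially. x j - t j *\<^sub>R v \<in> ball y e"
            using tendstoD[OF xv_lim e(1)] by eventually_elim (simp add: dist_commute)
          ultimately have ev: "\<forall>\<^sub>F j in sequentially. (of_bool Q - of_bool P) * p (x j) = G j (x j)"
          proof eventually_elim
            case (elim j)
            have "x j \<in> E H j" using pos by (simp add: E_def lx)
            have "m j (x j) = (\<Sum>H'\<in>\<H>'. if H' = H then 1 else 0)"
              unfolding m_def using elim(1) \<open>x j \<in> E H j\<close> by (intro sum.cong) auto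
            then have "m j (x j) = 1" using fin' H' by simp
            moreover have "(x j \<in> T) = P" using e(2)[OF elim(2)] lx[of j] pos[of j] by (simp add: l_def)
            moreover have "(x j - t j *\<^sub>R v \<in> T) = Q" using e(3)[OF elim(3)] lxv[of j] pos[of j] by (simp add: l_def)
            ultimately show ?case by (simp add: G_def D_def indicator_def)
          qed
          have "(\<lambda>j. p (x j)) \<longlonglongrightarrow> p y"
            by (rule continuous_on_tendsto_compose[OF pc[of UNIV] x_lim]) auto
          then have "(\<lambda>j. (of_bool Q - of_bool P) * p (x j)) \<longlonglongrightarrow> (of_bool Q - of_bool P) * p y"
            by (intro tendsto_intros)
          from Lim_transform_eventually[OF this ev]
          show "(\<lambda>j. G j (y + (t j * c H * s) *\<^sub>R N H)) \<longlonglongrightarrow> p y * \<nu> H y / c H"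
            unfolding \<nu>y by (simp add: x_def)
        qed
      qed
    qed (use GM G0 t cH in \<open>auto\<close>)
    then show ?thesis unfolding lev[OF H] E_def .
  qed
  have "A \<longlonglongrightarrow> (\<Sum>H\<in>\<H>'. c H * (\<integral>y. p y * \<nu> H y / c H \<partial>hyperplane_measure (N H) (off H)))"
    unfolding A_eq2[abs_def] by (intro tendsto_intros slab_lim)
  then have "(\<integral>x. indicator T x * p' x \<partial>lborel) = (\<Sum>H\<in>\<H>'. c H * (\<integral>y. p y * \<nu> H y / c H \<partial>hyperplane_measure (N H) (off H)))"
    using A_lim LIMSEQ_unique by blast
  also have "\<dots> = (\<Sum>H\<in>\<H>'. \<integral>y. p y * \<nu> H y \<partial>hyperplane_measure (N H) (off H))"
    by (intro sum.cong) (auto simp: \<H>'_def)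
  \<comment> \<open>Planes parallel to \<open>v\<close> sweep no slab; they can be added because
    \<open>\<nu>\<close> vanishes almost everywhere on them.\<close>
  also have "\<dots> = (\<Sum>H\<in>\<H>. \<integral>y. p y * \<nu> H y \<partial>hyperplane_measure (N H) (off H))"
  proof (rule sum.mono_neutral_left[OF fin fin'(2)], rule ballI)
    fix H assume "H \<in> \<H> - \<H>'"
    then have H: "H \<in> \<H>" and c0: "N H \<bullet> v = 0" using N(3)[of H] by (auto simp: \<H>'_def c_def)
    have "AE y in hyperplane_measure (N H) (off H). p y * \<nu> H y = 0"
      using generic[OF H]
    proof eventually_elim
      fix y assume y: "y \<in> H \<and> (\<forall>H'\<in>\<H> - {H}. y \<notin> H')"
      obtain e P Q where e: "e > 0" "\<And>z. z \<in> ball y e \<Longrightarrow> N H \<bullet> z > off H \<Longrightarrow> (z \<in> T) = P"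
          "\<And>z. z \<in> ball y e \<Longrightarrow> N H \<bullet> z < off H \<Longrightarrow> (z \<in> T) = Q" using local[OF H, of y] y by blast
      have "\<nu> H y = (N H \<bullet> v) * (of_bool Q - of_bool P)"
        by (rule \<nu>_eq[OF H _ _ e]) (use y in auto)
      then show "p y * \<nu> H y = 0" using c0 by simp
    qed
    then show "(\<integral>y. p y * \<nu> H y \<partial>hyperplane_measure (N H) (off H)) = 0"
      by (rule integral_eq_zero_AE)
  qed
  finally show ?thesis by (simp add: p'_def)
qed

section \<open>Meshes as hyperplane arrangements\<close>

text \<open>One orientation per plane, chosen arbitrarily; this is harmless, since only vanishing
  and equality of signs at two points matter later.\<close>

definition hyp_normal :: "(real^'d) set \<Rightarrow> real^'d" where
  "hyp_normal H = (SOME n. norm n = 1 \<and> (\<exists>b. H = {x. n \<bullet> x = b}))"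

definition hyp_offset :: "(real^'d) set \<Rightarrow> real" where
  "hyp_offset H = (SOME b. H = {x. hyp_normal H \<bullet> x = b})"

definition signed_dist :: "(real^'d) set \<Rightarrow> real^'d \<Rightarrow> real" where
  "signed_dist H x = hyp_normal H \<bullet> x - hyp_offset H"

lemma hyp_normal:
  assumes "hyperplane H"
  shows "norm (hyp_normal H) = 1" "H = {x. hyp_normal H \<bullet> x = hyp_offset H}"
proof -
  have "\<exists>n. norm n = 1 \<and> (\<exists>b. H = {x. n \<bullet> x = b})"
    using hyperplane_unit_normal[OF assms, of 0] by blast
  then have *: "norm (hyp_normal H) = 1 \<and> (\<exists>b. H = {x. hyp_normal H \<bullet> x = b})"
    unfolding hyp_normal_def by (rule someI_ex)
  then show "norm (hyp_normal H) = 1" by blast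
  show "H = {x. hyp_normal H \<bullet> x = hyp_offset H}"
    unfolding hyp_offset_def using conjunct2[OF *] by (rule someI_ex)
qed

lemma signed_dist_eq_0_iff: "hyperplane H \<Longrightarrow> signed_dist H x = 0 \<longleftrightarrow> x \<in> H"
  using hyp_normal(2)[of H] by (auto simp: signed_dist_def)

text \<open>Any equation of the plane is a nonzero multiple of the chosen one; this converts signs
  between the two.\<close>

lemma signed_dist_proportional:
  assumes a: "a \<noteq> 0"
  obtains s where "s \<noteq> 0" "\<And>x. a \<bullet> x - b = s * signed_dist {x. a \<bullet> x = b} x"
proof -
  let ?H = "{x. a \<bullet> x = b}"
  have H: "hyperplane ?H" unfolding hyperplane_def using a by blast
  define m where "m = (1 / norm a) *\<^sub>R a"
  have "{x. m \<bullet> x = b / norm a} = ?H" using a by (auto simp: m_def field_simps)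
  then have "{x. m \<bullet> x = b / norm a} = {x. hyp_normal ?H \<bullet> x = hyp_offset ?H}" using hyp_normal(2)[OF H] by simp
  moreover have "norm m = 1" using a by (simp add: m_def)
  ultimately consider "hyp_normal ?H = m" "hyp_offset ?H = b / norm a" | "hyp_normal ?H = - m" "hyp_offset ?H = - (b / norm a)"
    using unit_normal_unique[of m "hyp_normal ?H"] hyp_normal(1)[OF H] by blast
  then show thesis
  proof cases
    case 1 then show ?thesis using a by (intro that[of "norm a"]) (auto simp: signed_dist_def m_def field_simps)
  next
    case 2 then show ?thesis using a by (intro that[of "- norm a"]) (auto simp: signed_dist_def m_def field_simps)
  qed
qed

lemma continuous_signed_dist: "continuous_on S (signed_dist H)"
  unfolding signed_dist_def[abs_def] by (intro continuous_intros)

text \<open>\<open>U\<close> is a union of cells, of all dimensions, of the arrangement: the vector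
  of signs -1, 0, 1 of a point decides its membership.\<close>

definition arranged :: "(real^'d) set set \<Rightarrow> (real^'d) set \<Rightarrow> bool" where
  "arranged \<H> U \<longleftrightarrow> (\<forall>x y. (\<forall>H\<in>\<H>. sgn (signed_dist H x) = sgn (signed_dist H y)) \<longrightarrow> (x \<in> U \<longleftrightarrow> y \<in> U))"

lemma arranged_mono: "arranged \<H> U \<Longrightarrow> \<H> \<subseteq> \<H>' \<Longrightarrow> arranged \<H>' U"
  unfolding arranged_def by blast

lemma arranged_Inter: "(\<And>h. h \<in> A \<Longrightarrow> arranged \<H> h) \<Longrightarrow> arranged \<H> (\<Inter>A)"
  unfolding arranged_def by blast

lemma arranged_Union: "(\<And>h. h \<in> A \<Longrightarrow> arranged \<H> h) \<Longrightarrow> arranged \<H> (\<Union>A)"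
  unfolding arranged_def by blast

lemma arranged_halfspace: "a \<noteq> 0 \<Longrightarrow> arranged {{x. a \<bullet> x = b}} {x. a \<bullet> x \<le> b}"
  unfolding arranged_def
proof (intro allI impI)
  fix x y assume a: "a \<noteq> 0"
    and *: "\<forall>H\<in>{{x. a \<bullet> x = b}}. sgn (signed_dist H x) = sgn (signed_dist H y)"
  obtain s where s: "s \<noteq> 0" "\<And>x. a \<bullet> x - b = s * signed_dist {x. a \<bullet> x = b} x"
    using signed_dist_proportional[OF a] by blast
  have "sgn (a \<bullet> x - b) = sgn (a \<bullet> y - b)" unfolding s(2) sgn_mult using * by simp
  then show "(x \<in> {x. a \<bullet> x \<le> b}) = (y \<in> {x. a \<bullet> x \<le> b})"
    by (auto simp: sgn_if split: if_splits)
qed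

lemma arranged_polyhedron:
  assumes "polyhedron P"
  shows "\<exists>\<H>. finite \<H> \<and> (\<forall>H\<in>\<H>. hyperplane H) \<and> arranged \<H> P"
proof -
  obtain A where A: "finite A" "P = \<Inter>A" "\<forall>h\<in>A. \<exists>a b. a \<noteq> 0 \<and> h = {x. a \<bullet> x \<le> b}"
    using assms unfolding polyhedron_def by blast
  obtain a b where ab: "\<And>h. h \<in> A \<Longrightarrow> a h \<noteq> 0 \<and> h = {x. a h \<bullet> x \<le> b h}" using A(3) by metis
  let ?\<H> = "(\<lambda>h. {x. a h \<bullet> x = b h}) ` A"
  have "arranged ?\<H> P" unfolding A(2)
  proof (rule arranged_Inter)
    fix h assume h: "h \<in> A"
    have "arranged {{x. a h \<bullet> x = b h}} {x. a h \<bullet> x \<le> b h}" using ab[OF h] by (intro arranged_halfspace) auto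
    then have "arranged {{x. a h \<bullet> x = b h}} h" using ab[OF h] by simp
    then show "arranged ?\<H> h" by (rule arranged_mono) (use h in auto)
  qed
  moreover have "\<forall>H\<in>?\<H>. hyperplane H" using ab unfolding hyperplane_def by blast
  ultimately show ?thesis using A(1) by (intro exI[of _ ?\<H>]) auto
qed

text \<open>The union of the separate families serves all sets at once, since refining an
  arrangement preserves \<open>arranged\<close>. \<open>Q\<close> is a parameter because the lemma
  is used for the polytopes of one set and also for the compact sets whose interiors are the domain
  and the cells.\<close>

lemma arranged_common:
  assumes "finite A" "\<And>P. P \<in> A \<Longrightarrow> \<exists>\<H>. finite \<H> \<and> (\<forall>H\<in>\<H>. hyperplane H) \<and> (\<exists>U. Q P U \<and> arranged \<H> U)"
  shows "\<exists>\<H>. finite \<H> \<and> (\<forall>H\<in>\<H>. hyperplane H) \<and> (\<forall>P\<in>A. \<exists>U. Q P U \<and> arranged \<H> U)"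
proof -
  obtain h where h: "\<And>P. P \<in> A \<Longrightarrow> finite (h P) \<and> (\<forall>H\<in>h P. hyperplane H) \<and> (\<exists>U. Q P U \<and> arranged (h P) U)"
    using assms(2) by metis
  show ?thesis
  proof (intro exI[of _ "\<Union>(h ` A)"] conjI ballI)
    fix P assume P: "P \<in> A"
    then obtain U where "Q P U" "arranged (h P) U" using h by blast
    then show "\<exists>U. Q P U \<and> arranged (\<Union> (h ` A)) U" using arranged_mono[of "h P" U "\<Union> (h ` A)"] P by blast
  qed (use h assms(1) in auto)
qed

text \<open>Half-spaces, intersections and unions reach the compact union of the polytopes, not its
  interior; hence \<open>T\<close> and \<open>U\<close> are kept as a pair.\<close>

lemma arranged_open_polyhedral:
  assumes "open_polyhedral T"
  shows "\<exists>\<H>. finite \<H> \<and> (\<forall>H\<in>\<H>. hyperplane H) \<and> (\<exists>U. (compact U \<and> T = interior U) \<and> arranged \<H> U)"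
proof -
  obtain \<P> where P: "finite \<P>" "\<forall>P\<in>\<P>. polytope P" "T = interior (\<Union>\<P>)"
    using assms unfolding open_polyhedral_def by blast
  have "\<exists>\<H>. finite \<H> \<and> (\<forall>H\<in>\<H>. hyperplane H) \<and> (\<forall>P\<in>\<P>. \<exists>U. U = P \<and> arranged \<H> U)"
  proof (rule arranged_common[OF P(1), of "\<lambda>P U. U = P"])
    fix P assume "P \<in> \<P>"
    then have "polyhedron P" using P(2) polytope_imp_polyhedron by blast
    from arranged_polyhedron[OF this]
    show "\<exists>\<H>. finite \<H> \<and> (\<forall>H\<in>\<H>. hyperplane H) \<and> (\<exists>U. U = P \<and> arranged \<H> U)" by simp
  qed
  then obtain \<H> where H: "finite \<H>" "\<forall>H\<in>\<H>. hyperplane H" "\<forall>P\<in>\<P>. arranged \<H> P" by blast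
  have "arranged \<H> (\<Union>\<P>)" using H(3) by (intro arranged_Union) auto
  moreover have "compact (\<Union>\<P>)" using P polytope_imp_compact by (intro compact_Union) auto
  ultimately show ?thesis using H P(3) by blast
qed

text \<open>This is the shape of a polyhedral set near a point of the hyperplane \<open>n \<cdot> x = b\<close> that lies on no other
  hyperplane of the arrangement.\<close>

definition locally_sided :: "(real^'d) set \<Rightarrow> real^'d \<Rightarrow> real^'d \<Rightarrow> real \<Rightarrow> real \<Rightarrow> bool \<Rightarrow> bool \<Rightarrow> bool" where
  "locally_sided T y n b e P Q \<longleftrightarrow>
    (\<forall>z\<in>ball y e. z \<in> T \<longleftrightarrow> (if n \<bullet> z > b then P else if n \<bullet> z < b then Q else P \<and> Q))"

lemma side_points:
  fixes n :: "real^'d"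
  assumes "norm n = 1" "n \<bullet> y = b" "e > 0"
  obtains zp zm where "zp \<in> ball y e" "n \<bullet> zp > b" "zm \<in> ball y e" "n \<bullet> zm < b"
proof (rule that[of "y + (e/2) *\<^sub>R n" "y - (e/2) *\<^sub>R n"])
  have "n \<bullet> n = 1" using assms(1) by (simp add: norm_eq_1)
  then show "n \<bullet> (y + (e/2) *\<^sub>R n) > b" "n \<bullet> (y - (e/2) *\<^sub>R n) < b"
    using assms by (auto simp: inner_add_right inner_diff_right)
qed (use assms in \<open>auto simp: dist_norm\<close>)

lemma locally_sided_shift:
  assumes "locally_sided T y n b e P Q" "z \<in> ball y e"
  obtains e' where "e' > 0" "locally_sided T z n b e' P Q"
proof -
  obtain e' where "e' > 0" "ball z e' \<subseteq> ball y e" using assms(2) open_ball openE by blast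
  then show ?thesis using that assms(1) unfolding locally_sided_def by blast
qed

lemma locally_sided_frontier_iff:
  fixes n :: "real^'d"
  assumes T: "open T" and n: "norm n = 1" and ls: "locally_sided T y n b e P Q"
    and z: "z \<in> ball y e" "n \<bullet> z = b"
  shows "z \<in> frontier T \<longleftrightarrow> P \<noteq> Q"
proof -
  obtain e' where e': "e' > 0" "locally_sided T z n b e' P Q" using locally_sided_shift[OF ls z(1)] .
  have fr: "z \<in> frontier T \<longleftrightarrow> z \<in> closure T \<and> z \<notin> T" using T by (simp add: frontier_def interior_open)
  have zT: "z \<in> T \<longleftrightarrow> P \<and> Q" using e' z(2) by (simp add: locally_sided_def)
  have cl: "z \<in> closure T" if "P \<or> Q"
    unfolding closure_approachable
  proof (intro allI impI)
    fix d :: real assume "d > 0"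
    obtain zp zm where "zp \<in> ball z (min d e')" "n \<bullet> zp > b" "zm \<in> ball z (min d e')" "n \<bullet> zm < b"
      by (rule side_points[OF n z(2), of "min d e'"]) (use \<open>d > 0\<close> e' in auto)
    then have "P \<longleftrightarrow> zp \<in> T" "Q \<longleftrightarrow> zm \<in> T" "dist zp z < d" "dist zm z < d"
      using e'(2) by (auto simp: locally_sided_def dist_commute)
    then show "\<exists>x\<in>T. dist x z < d" using that by blast
  qed
  have "z \<notin> closure T" if "\<not> P" "\<not> Q"
  proof
    assume "z \<in> closure T"
    then obtain x where "x \<in> T" "dist x z < e'" using e'(1) unfolding closure_approachable by blast
    then show False using e'(2) that unfolding locally_sided_def by (auto simp: dist_commute split: if_splits)
  qed
  then show ?thesis using fr zT cl by blast
qed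

lemma locally_sided_outward_normal:
  fixes n :: "real^'d"
  assumes n: "norm n = 1" and ls: "locally_sided T y n b e P Q" and e: "e > 0" "n \<bullet> y = b" and PQ: "P \<noteq> Q"
  shows "outward_normal T y (if Q then n else - n)"
proof -
  have "z \<in> T \<longleftrightarrow> (z - y) \<bullet> (if Q then n else - n) < 0" if "z \<in> ball y e" for z
  proof -
    have "(z - y) \<bullet> n = n \<bullet> z - b" using e(2) by (simp add: inner_commute[of _ n] inner_diff_right)
    then show ?thesis using ls that PQ by (auto simp: locally_sided_def)
  qed
  then show ?thesis unfolding outward_normal_def using e(1) n by auto
qed

section \<open>Mesh cells around a generic point\<close>

text \<open>The domain is arranged together with the cells because boundary faces involve its
  frontier.\<close>

locale polyhedral_mesh =
  fixes \<Omega> :: "(real^'d) set" and \<T> \<H> :: "(real^'d) set set"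
  assumes mesh: "is_mesh \<Omega> \<T>" and finH: "finite \<H>" and hypH: "\<And>H. H \<in> \<H> \<Longrightarrow> hyperplane H"
    and arr: "\<And>S. S \<in> insert \<Omega> \<T> \<Longrightarrow> \<exists>U. (compact U \<and> S = interior U) \<and> arranged \<H> U"
begin

text \<open>\<open>H\<close> may be any plane here: that a face plane belongs to \<open>\<H>\<close>
  is deduced later from such a point.\<close>

definition generic :: "(real^'d) set \<Rightarrow> real^'d \<Rightarrow> bool" where
  "generic H y \<longleftrightarrow> y \<in> H \<and> (\<forall>H'\<in>\<H> - {H}. y \<notin> H')"

lemma finT: "finite \<T>" using mesh by (simp add: is_mesh_def)

lemma open_cell: "S \<in> insert \<Omega> \<T> \<Longrightarrow> open S" using arr[of S] open_interior by blast

lemma bounded_cell: "S \<in> insert \<Omega> \<T> \<Longrightarrow> bounded S"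
proof -
  assume "S \<in> insert \<Omega> \<T>"
  then obtain U where "compact U" "S = interior U" using arr[of S] by blast
  then show ?thesis using bounded_subset[OF compact_imp_bounded interior_subset] by blast
qed

lemma disjoint_cells: "S \<in> \<T> \<Longrightarrow> S' \<in> \<T> \<Longrightarrow> S \<noteq> S' \<Longrightarrow> S \<inter> S' = {}"
  using mesh by (auto simp: is_mesh_def pairwise_def disjnt_def)

lemma closure_cells: "(\<Union>T\<in>\<T>. closure T) = closure \<Omega>"
  using mesh by (simp add: is_mesh_def)

text \<open>\<open>closure \<Omega>\<close> lies in the compact set of which \<open>\<Omega>\<close>
  is the interior, and a cell is an open subset of it.\<close>

lemma cell_subset_domain: "S \<in> \<T> \<Longrightarrow> S \<subseteq> \<Omega>"
proof -
  assume S: "S \<in> \<T>"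
  obtain U where U: "compact U" "\<Omega> = interior U" using arr[of \<Omega>] by blast
  have "S \<subseteq> closure \<Omega>" using S closure_subset unfolding closure_cells[symmetric] by blast
  also have "closure \<Omega> \<subseteq> U" using U by (metis closure_minimal compact_imp_closed interior_subset)
  finally show ?thesis using U(2) open_cell S by (simp add: interior_maximal)
qed

lemma signed_dist_near:
  assumes "\<And>H. H \<in> \<H>' \<Longrightarrow> H \<in> \<H> \<and> y \<notin> H"
  shows "\<exists>e>0. \<forall>H\<in>\<H>'. \<forall>z\<in>ball y e. sgn (signed_dist H z) = sgn (signed_dist H y)"
proof -
  have fin: "finite \<H>'" using assms finH by (meson finite_subset subsetI)
  have "\<forall>\<^sub>F z in nhds y. sgn (signed_dist H z) = sgn (signed_dist H y)" if "H \<in> \<H>'" for H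
  proof -
    have ne: "signed_dist H y \<noteq> 0" using assms[OF that] signed_dist_eq_0_iff hypH by blast
    have lim: "(signed_dist H \<longlongrightarrow> signed_dist H y) (nhds y)"
      using continuous_signed_dist[of UNIV H] by (simp add: continuous_on_def tendsto_at_iff_tendsto_nhds)
    from ne consider "signed_dist H y > 0" | "signed_dist H y < 0" by linarith
    then show ?thesis
    proof cases
      case 1
      from order_tendstoD(1)[OF lim 1] show ?thesis by eventually_elim (use 1 in simp)
    next
      case 2
      from order_tendstoD(2)[OF lim 2] show ?thesis by eventually_elim (use 2 in simp)
    qed
  qed
  then have "\<forall>\<^sub>F z in nhds y. \<forall>H\<in>\<H>'. sgn (signed_dist H z) = sgn (signed_dist H y)"
    using fin by (intro eventually_ball_finite) auto
  then obtain d where "d > 0" "\<And>z H. dist z y < d \<Longrightarrow> H \<in> \<H>' \<Longrightarrow> sgn (signed_dist H z) = sgn (signed_dist H y)"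
    unfolding eventually_nhds_metric by blast
  moreover have "z \<in> ball y d \<Longrightarrow> dist z y < d" for z by (simp add: dist_commute)
  ultimately show ?thesis by blast
qed

text \<open>Off all planes the sign vector is locally constant, so the point is interior to
  \<open>U\<close> or to its complement.\<close>

lemma frontier_subset: "S \<in> insert \<Omega> \<T> \<Longrightarrow> frontier S \<subseteq> \<Union>\<H>"
proof
  fix x assume S: "S \<in> insert \<Omega> \<T>" and x: "x \<in> frontier S"
  obtain U where U: "S = interior U" "arranged \<H> U" using arr[OF S] by blast
  show "x \<in> \<Union>\<H>"
  proof (rule ccontr)
    assume "x \<notin> \<Union>\<H>"
    then obtain e where e: "e > 0" "\<And>H z. H \<in> \<H> \<Longrightarrow> z \<in> ball x e \<Longrightarrow> sgn (signed_dist H z) = sgn (signed_dist H x)"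
      using signed_dist_near[of \<H> x] by blast
    then have c: "z \<in> U \<longleftrightarrow> x \<in> U" if "z \<in> ball x e" for z using U(2) that unfolding arranged_def by blast
    show False
    proof (cases "x \<in> U")
      case True
      then have "ball x e \<subseteq> U" using c by blast
      then have "x \<in> S" using U(1) e(1) by (meson centre_in_ball interior_maximal open_ball subsetD)
      then show False using x open_cell[OF S] by (simp add: frontier_def interior_open)
    next
      case False
      then have "ball x e \<inter> S = {}" using c U(1) interior_subset by blast
      then have "x \<notin> closure S" using e(1) open_Int_closure_eq_empty[OF open_ball, of x e S] centre_in_ball[of x e] by blast
      then show False using x by (simp add: frontier_def)
    qed
  qed
qed

text \<open>The radius is governed by the other planes alone, so one ball works for the domain and
  all cells at the same time.\<close>

lemma locally_sided_exists:
  assumes H: "H \<in> \<H>" and y: "generic H y" and n: "norm n = 1" "H = {x. n \<bullet> x = b}"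
  shows "\<exists>e>0. \<forall>S\<in>insert \<Omega> \<T>. \<exists>P Q. locally_sided S y n b e P Q"
proof -
  obtain e where e: "e > 0" "\<And>H' z. H' \<in> \<H> - {H} \<Longrightarrow> z \<in> ball y e \<Longrightarrow> sgn (signed_dist H' z) = sgn (signed_dist H' y)"
    using signed_dist_near[of "\<H> - {H}" y] y unfolding generic_def by blast
  have "n \<noteq> 0" using n(1) by auto
  obtain s where s: "s \<noteq> 0" "\<And>x. n \<bullet> x - b = s * signed_dist H x"
    using signed_dist_proportional[OF \<open>n \<noteq> 0\<close>, of b] n(2) by blast
  have yb: "n \<bullet> y = b" using y n by (auto simp: generic_def)
  obtain zp zm where zpm: "zp \<in> ball y e" "n \<bullet> zp > b" "zm \<in> ball y e" "n \<bullet> zm < b"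
    by (rule side_points[OF n(1) yb e(1)])
  have "\<exists>P Q. locally_sided S y n b e P Q" if S: "S \<in> insert \<Omega> \<T>" for S
  proof -
    obtain U where U: "compact U" "S = interior U" "arranged \<H> U" using arr[OF S] by blast
    have sideU: "z \<in> U \<longleftrightarrow> z' \<in> U" if "z \<in> ball y e" "z' \<in> ball y e" "sgn (n \<bullet> z - b) = sgn (n \<bullet> z' - b)" for z z'
    proof -
      have "sgn s * sgn (signed_dist H z) = sgn s * sgn (signed_dist H z')"
        using that(3) unfolding s(2) sgn_mult .
      then have "sgn (signed_dist H z) = sgn (signed_dist H z')" using s(1) by (simp add: sgn_eq_0_iff)
      then have "\<forall>H'\<in>\<H>. sgn (signed_dist H' z) = sgn (signed_dist H' z')"
        using e(2) that(1,2) by (metis DiffI singletonD)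
      then show ?thesis using U(3) unfolding arranged_def by blast
    qed
    have pos: "z \<in> S \<longleftrightarrow> zp \<in> U" if "z \<in> ball y e" "n \<bullet> z > b" for z
    proof
      assume "z \<in> S"
      then have "z \<in> U" using U(2) interior_subset by blast
      then show "zp \<in> U" using sideU[of z zp] that zpm by simp
    next
      assume "zp \<in> U"
      then have "ball y e \<inter> {z. n \<bullet> z > b} \<subseteq> U" using sideU[of _ zp] zpm by auto
      moreover have "open (ball y e \<inter> {z. n \<bullet> z > b})" by (intro open_Int open_ball open_halfspace_gt)
      ultimately have "ball y e \<inter> {z. n \<bullet> z > b} \<subseteq> interior U" by (rule interior_maximal)
      then show "z \<in> S" using that unfolding U(2) by blast
    qed
    have neg: "z \<in> S \<longleftrightarrow> zm \<in> U" if "z \<in> ball y e" "n \<bullet> z < b" for z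
    proof
      assume "z \<in> S"
      then have "z \<in> U" using U(2) interior_subset by blast
      then show "zm \<in> U" using sideU[of z zm] that zpm by simp
    next
      assume "zm \<in> U"
      then have "ball y e \<inter> {z. n \<bullet> z < b} \<subseteq> U" using sideU[of _ zm] zpm by auto
      moreover have "open (ball y e \<inter> {z. n \<bullet> z < b})" by (intro open_Int open_ball open_halfspace_lt)
      ultimately have "ball y e \<inter> {z. n \<bullet> z < b} \<subseteq> interior U" by (rule interior_maximal)
      then show "z \<in> S" using that unfolding U(2) by blast
    qed
    \<comment> \<open>Openness of \<open>S\<close> gives one direction. For the other,
      \<open>U\<close> is closed and comes arbitrarily near to \<open>y\<close>, so it contains
      \<open>y\<close> and with it the plane part of the ball: no slit remains.\<close>
    have zero: "z \<in> S \<longleftrightarrow> zp \<in> U \<and> zm \<in> U" if z: "z \<in> ball y e" "n \<bullet> z = b" for z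
    proof
      assume "z \<in> S"
      then obtain d where d: "d > 0" "ball z d \<subseteq> S \<inter> ball y e"
        using open_cell[OF S] z(1) by (metis IntI open_Int open_ball openE)
      obtain wp wm where "wp \<in> ball z d" "n \<bullet> wp > b" "wm \<in> ball z d" "n \<bullet> wm < b"
        by (rule side_points[OF n(1) z(2) d(1)])
      then show "zp \<in> U \<and> zm \<in> U" using pos neg d(2) by blast
    next
      assume zz: "zp \<in> U \<and> zm \<in> U"
      have "y \<in> closure U"
        unfolding closure_approachable
      proof (intro allI impI)
        fix d :: real assume "d > 0"
        obtain wp wm where w: "wp \<in> ball y (min d e)" "n \<bullet> wp > b" "wm \<in> ball y (min d e)" "n \<bullet> wm < b"
          by (rule side_points[OF n(1) yb, of "min d e"]) (use \<open>d > 0\<close> e in auto)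
        then have "wp \<in> U" using sideU[of wp zp] zz zpm by auto
        then show "\<exists>x\<in>U. dist x y < d" using w(1) by (auto simp: dist_commute)
      qed
      then have "y \<in> U" using compact_imp_closed[OF U(1)] by (simp add: closure_closed)
      have "x \<in> U" if "x \<in> ball y e" for x
      proof -
        consider "n \<bullet> x > b" | "n \<bullet> x < b" | "n \<bullet> x = b" by linarith
        then show ?thesis
        proof cases
          case 1 then show ?thesis using sideU[of x zp] zz zpm that by simp
        next
          case 2 then show ?thesis using sideU[of x zm] zz zpm that by simp
        next
          case 3 then show ?thesis using sideU[of x y] \<open>y \<in> U\<close> that e(1) yb by simp
        qed
      qed
      then have "ball y e \<subseteq> U" by blast
      then show "z \<in> S" using U(2) z(1) by (meson interior_maximal open_ball subsetD)
    qed
    have "locally_sided S y n b e (zp \<in> U) (zm \<in> U)"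
      unfolding locally_sided_def using pos neg zero by (smt (verit))
    then show ?thesis by blast
  qed
  then show ?thesis using e(1) by blast
qed

lemma generic_frontier_iff:
  assumes "generic H y" "norm n = 1" "H = {x. n \<bullet> x = b}" "e > 0" "S \<in> insert \<Omega> \<T>" "locally_sided S y n b e P Q"
  shows "y \<in> frontier S \<longleftrightarrow> P \<noteq> Q"
  by (rule locally_sided_frontier_iff[OF open_cell assms(2,6)]) (use assms in \<open>auto simp: generic_def\<close>)

text \<open>Turns incidence at a generic point into propositional logic; \<open>P\<close> and
  \<open>Q\<close> tell which sets occupy the positive and the negative half-ball.\<close>

lemma generic_sides:
  assumes H: "H \<in> \<H>" and y: "generic H y"
  obtains P Q :: "(real^'d) set \<Rightarrow> bool" where
    "\<And>S. S \<in> insert \<Omega> \<T> \<Longrightarrow> y \<in> frontier S \<longleftrightarrow> P S \<noteq> Q S"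
    "\<And>S S'. S \<in> \<T> \<Longrightarrow> S' \<in> \<T> \<Longrightarrow> S \<noteq> S' \<Longrightarrow> \<not> (P S \<and> P S')"
    "\<And>S S'. S \<in> \<T> \<Longrightarrow> S' \<in> \<T> \<Longrightarrow> S \<noteq> S' \<Longrightarrow> \<not> (Q S \<and> Q S')"
    "P \<Omega> \<longleftrightarrow> (\<exists>S\<in>\<T>. P S)" "Q \<Omega> \<longleftrightarrow> (\<exists>S\<in>\<T>. Q S)"
proof -
  obtain n b where n: "norm n = 1" "H = {x. n \<bullet> x = b}" using hyperplane_unit_normal[OF hypH[OF H], of 0] by blast
  obtain e P Q where e: "e > 0" and ls: "\<And>S. S \<in> insert \<Omega> \<T> \<Longrightarrow> locally_sided S y n b e (P S) (Q S)"
    using locally_sided_exists[OF assms n] by metis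
  have yb: "n \<bullet> y = b" using y n by (auto simp: generic_def)
  obtain zp zm where z: "zp \<in> ball y e" "n \<bullet> zp > b" "zm \<in> ball y e" "n \<bullet> zm < b"
    by (rule side_points[OF n(1) yb e])
  have Pz: "z \<in> S \<longleftrightarrow> P S" if "S \<in> insert \<Omega> \<T>" "z \<in> ball y e" "n \<bullet> z > b" for S z
    using ls[OF that(1)] that(2,3) by (auto simp: locally_sided_def)
  have Qz: "z \<in> S \<longleftrightarrow> Q S" if "S \<in> insert \<Omega> \<T>" "z \<in> ball y e" "n \<bullet> z < b" for S z
    using ls[OF that(1)] that(2,3) by (auto simp: locally_sided_def)
  \<comment> \<open>Cells are dense in the domain because their closures cover it; since sides are
    all or nothing, one point of a cell is enough.\<close>
  have cov: "\<exists>S\<in>\<T>. \<exists>w\<in>W. w \<in> S" if "z \<in> \<Omega>" "open W" "z \<in> W" for z W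
  proof -
    have "z \<in> (\<Union>T\<in>\<T>. closure T)" unfolding closure_cells using that(1) closure_subset by blast
    then obtain S where "S \<in> \<T>" "z \<in> closure S" by blast
    then show ?thesis using open_Int_closure_eq_empty[OF that(2), of S] that(3) by blast
  qed
  show thesis
  proof (rule that)
    show "y \<in> frontier S \<longleftrightarrow> P S \<noteq> Q S" if "S \<in> insert \<Omega> \<T>" for S
      by (rule generic_frontier_iff[OF y n e that ls[OF that]])
    show "\<not> (P S \<and> P S')" if "S \<in> \<T>" "S' \<in> \<T>" "S \<noteq> S'" for S S'
      using disjoint_cells[OF that] Pz[of S zp] Pz[of S' zp] that z by blast
    show "\<not> (Q S \<and> Q S')" if "S \<in> \<T>" "S' \<in> \<T>" "S \<noteq> S'" for S S'
      using disjoint_cells[OF that] Qz[of S zm] Qz[of S' zm] that z by blast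
    show "P \<Omega> \<longleftrightarrow> (\<exists>S\<in>\<T>. P S)"
    proof
      assume "P \<Omega>"
      then have "zp \<in> \<Omega>" using Pz z by blast
      from cov[OF this, of "ball y e \<inter> {z. n \<bullet> z > b}"] z obtain S w where "S \<in> \<T>" "w \<in> ball y e" "n \<bullet> w > b" "w \<in> S"
        by (auto simp: open_halfspace_gt open_Int)
      then show "\<exists>S\<in>\<T>. P S" using Pz by blast
    qed (use Pz[of _ zp] cell_subset_domain z in blast)
    show "Q \<Omega> \<longleftrightarrow> (\<exists>S\<in>\<T>. Q S)"
    proof
      assume "Q \<Omega>"
      then have "zm \<in> \<Omega>" using Qz z by blast
      from cov[OF this, of "ball y e \<inter> {z. n \<bullet> z < b}"] z obtain S w where "S \<in> \<T>" "w \<in> ball y e" "n \<bullet> w < b" "w \<in> S"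
        by (auto simp: open_halfspace_lt open_Int)
      then show "\<exists>S\<in>\<T>. Q S" using Qz by blast
    qed (use Qz[of _ zm] cell_subset_domain z in blast)
  qed
qed

text \<open>Measure replaces a construction: the nongeneric points of the plane are null, a ball
  around a point of the plane is not.\<close>

lemma generic_point_exists:
  assumes "hyperplane H" "x \<in> H" "e > 0"
  shows "\<exists>y\<in>ball x e. generic H y"
proof (rule ccontr)
  assume neg: "\<not> ?thesis"
  obtain n b where n: "norm n = 1" "H = {x. n \<bullet> x = b}" using hyperplane_unit_normal[OF assms(1), of 0] by blast
  have "AE y in hyperplane_measure n b. n \<bullet> y = b \<and> (\<forall>H\<in>\<H> - {{x. n \<bullet> x = b}}. y \<notin> H)"
    by (rule AE_hyperplane_measure_generic[OF n(1) finH hypH])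
  then have "AE y in hyperplane_measure n b. y \<notin> ball x e"
    by eventually_elim (use neg n in \<open>auto simp: generic_def\<close>)
  then have "emeasure (hyperplane_measure n b) (ball x e) = 0"
    by (subst (asm) AE_iff_null) (auto simp: sets_hyperplane_measure[OF n(1)] space_hyperplane_measure[OF n(1)] null_sets_def ball_def)
  moreover have "emeasure (hyperplane_measure n b) (ball x e) > 0"
    using hyperplane_measure_ball_pos[OF n(1) _ assms(3)] assms(2) n(2) by auto
  ultimately show False by simp
qed

end

lemma bounded_imp_subset_cball:
  fixes S :: "'a::real_normed_vector set"
  shows "bounded S \<Longrightarrow> \<exists>r. S \<subseteq> cball 0 r"
  unfolding bounded_iff by (auto simp: subset_iff)

context polyhedral_mesh
begin

section \<open>Incidence of faces and cells\<close>

lemma interface_affine_hull: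
  assumes "is_interface \<T> Tm Tp F"
  shows "Tm \<in> \<T>" "Tp \<in> \<T>" "Tm \<noteq> Tp" "F = frontier Tm \<inter> frontier Tp \<inter> affine hull F"
    "hyperplane (affine hull F)" "rel_interior F \<noteq> {}"
  using assms unfolding is_interface_def solid_in_def by auto

lemma boundary_faceE:
  assumes "F \<in> boundary_faces \<Omega> \<T>"
  obtains Tm where "Tm \<in> \<T>" "F = frontier Tm \<inter> frontier \<Omega> \<inter> affine hull F"
    "hyperplane (affine hull F)" "rel_interior F \<noteq> {}"
  using assms unfolding boundary_faces_def solid_in_def by auto

lemma facesE:
  assumes "F \<in> faces \<Omega> \<T>"
  obtains Tm S where "Tm \<in> \<T>" "S \<in> insert \<Omega> \<T>" "F = frontier Tm \<inter> frontier S \<inter> affine hull F"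
    "hyperplane (affine hull F)" "rel_interior F \<noteq> {}"
proof -
  from assms consider Tm Tp where "is_interface \<T> Tm Tp F" | "F \<in> boundary_faces \<Omega> \<T>"
    unfolding faces_def interfaces_def by blast
  then show ?thesis
  proof cases
    case 1 
    note i = interface_affine_hull[OF 1]
    show ?thesis by (rule that[OF i(1) _ i(4,5,6)]) (use i(2) in simp)
  next
    case 2
    from boundary_faceE[OF this] show ?thesis using that by (metis insertI1)
  qed
qed

text \<open>A generic point of the face lies on a frontier, hence on some plane of
  \<open>\<H>\<close>; being generic, it leaves only the plane of the face.\<close>

lemma face_plane:
  assumes "F \<in> faces \<Omega> \<T>"
  shows "affine hull F \<in> \<H>" "\<exists>y\<in>F. generic (affine hull F) y"
proof -
  obtain Tm S where F: "Tm \<in> \<T>" "F = frontier Tm \<inter> frontier S \<inter> affine hull F"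
    "hyperplane (affine hull F)" "rel_interior F \<noteq> {}" using facesE[OF assms] by metis
  obtain x e where x: "x \<in> F" "e > 0" "ball x e \<inter> affine hull F \<subseteq> F"
    using F(4) mem_rel_interior_ball by blast
  obtain y where y: "y \<in> ball x e" "generic (affine hull F) y"
    using generic_point_exists[OF F(3) hull_inc[OF x(1)] x(2)] by blast
  then have "y \<in> F" using x(3) by (auto simp: generic_def)
  then show "\<exists>y\<in>F. generic (affine hull F) y" using y(2) by blast
  have "y \<in> frontier Tm" using \<open>y \<in> F\<close> F(2) by blast
  then have "y \<in> \<Union>\<H>" using frontier_subset[of Tm] F(1) by blast
  then show "affine hull F \<in> \<H>" using y(2) unfolding generic_def by blast
qed

lemma finite_faces: "finite (faces \<Omega> \<T>)"
proof (rule finite_subset)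
  show "faces \<Omega> \<T> \<subseteq> (\<lambda>(S, S', H). frontier S \<inter> frontier S' \<inter> H) ` (\<T> \<times> insert \<Omega> \<T> \<times> \<H>)"
  proof
    fix F assume F: "F \<in> faces \<Omega> \<T>"
    obtain Tm S where "Tm \<in> \<T>" "S \<in> insert \<Omega> \<T>" "F = frontier Tm \<inter> frontier S \<inter> affine hull F" using facesE[OF F] by metis
    then show "F \<in> (\<lambda>(S, S', H). frontier S \<inter> frontier S' \<inter> H) ` (\<T> \<times> insert \<Omega> \<T> \<times> \<H>)"
      using face_plane(1)[OF F] by (intro image_eqI[of _ _ "(Tm, S, affine hull F)"]) auto
  qed
qed (use finT finH in auto)

lemma generic_ball_in_face:
  assumes H: "H \<in> \<H>" "generic H y" and S: "S \<in> insert \<Omega> \<T>" "S' \<in> insert \<Omega> \<T>" and y: "y \<in> frontier S" "y \<in> frontier S'"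
  shows "\<exists>e>0. ball y e \<inter> H \<subseteq> frontier S \<inter> frontier S' \<inter> H"
proof -
  obtain n b where n: "norm n = 1" "H = {x. n \<bullet> x = b}" using hyperplane_unit_normal[OF hypH[OF H(1)], of 0] by blast
  obtain e P Q where e: "e > 0" "\<And>S. S \<in> insert \<Omega> \<T> \<Longrightarrow> locally_sided S y n b e (P S) (Q S)"
    using locally_sided_exists[OF H n] by metis
  have yb: "n \<bullet> y = b" "y \<in> ball y e" using H n e by (auto simp: generic_def)
  have "ball y e \<inter> H \<subseteq> frontier R" if "R \<in> insert \<Omega> \<T>" "y \<in> frontier R" for R
    using locally_sided_frontier_iff[OF open_cell[OF that(1)] n(1) e(2)[OF that(1)]] yb that(2) n(2) by auto
  then show ?thesis using e(1) S y by blast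
qed

lemma generic_rel_interior:
  assumes F: "F \<in> faces \<Omega> \<T>" and y: "y \<in> F" "generic (affine hull F) y"
  shows "y \<in> rel_interior F"
proof -
  obtain Tm S where F': "Tm \<in> \<T>" "S \<in> insert \<Omega> \<T>" "F = frontier Tm \<inter> frontier S \<inter> affine hull F" using facesE[OF F] by metis
  then have "Tm \<in> insert \<Omega> \<T>" "y \<in> frontier Tm" "y \<in> frontier S" using y by auto
  from generic_ball_in_face[OF face_plane(1)[OF F] y(2) this(1) F'(2) this(2,3)]
  show ?thesis unfolding mem_rel_interior_ball using F'(3) y(1) by metis
qed

text \<open>\<open>Tm\<close> and \<open>Tp\<close> occupy one side each, and not the same one. So
  both sides are taken, no third cell fits, and the domain is present on both.\<close>

lemma interface_generic:
  assumes i: "is_interface \<T> Tm Tp F" and y: "y \<in> F" "generic (affine hull F) y"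
  shows "T \<in> \<T> \<Longrightarrow> y \<in> frontier T \<Longrightarrow> T = Tm \<or> T = Tp" "y \<notin> frontier \<Omega>"
proof -
  note I = interface_affine_hull[OF i]
  have F: "F \<in> faces \<Omega> \<T>" using i by (auto simp: faces_def interfaces_def)
  obtain P Q where fr: "\<And>S. S \<in> insert \<Omega> \<T> \<Longrightarrow> y \<in> frontier S \<longleftrightarrow> P S \<noteq> Q S"
    and P: "\<And>S S'. S \<in> \<T> \<Longrightarrow> S' \<in> \<T> \<Longrightarrow> S \<noteq> S' \<Longrightarrow> \<not> (P S \<and> P S')"
    and Q: "\<And>S S'. S \<in> \<T> \<Longrightarrow> S' \<in> \<T> \<Longrightarrow> S \<noteq> S' \<Longrightarrow> \<not> (Q S \<and> Q S')"
    and PO: "P \<Omega> \<longleftrightarrow> (\<exists>S\<in>\<T>. P S)" and QO: "Q \<Omega> \<longleftrightarrow> (\<exists>S\<in>\<T>. Q S)"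
    by (rule generic_sides[OF face_plane(1)[OF F] y(2)], rule that)
  have m: "P Tm \<noteq> Q Tm" "P Tp \<noteq> Q Tp" using fr I(1,2,4) y(1) by blast+
  show "T = Tm \<or> T = Tp" if "T \<in> \<T>" "y \<in> frontier T"
    using fr[of T] that m P[of T Tm] P[of T Tp] P[of Tm Tp] Q[of T Tm] Q[of T Tp] Q[of Tm Tp] I(1-3) by blast
  have "P \<Omega>" "Q \<Omega>" using m P[of Tm Tp] Q[of Tm Tp] I(1-3) PO QO by blast+
  then show "y \<notin> frontier \<Omega>" using fr by blast
qed

text \<open>Only one side belongs to the domain, and it has room for one cell.\<close>

lemma boundary_generic:
  assumes Tm: "Tm \<in> \<T>" and H: "H \<in> \<H>" and y: "y \<in> frontier Tm" "y \<in> frontier \<Omega>" "generic H y"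
  shows "T \<in> \<T> \<Longrightarrow> y \<in> frontier T \<Longrightarrow> T = Tm"
proof -
  obtain P Q where fr: "\<And>S. S \<in> insert \<Omega> \<T> \<Longrightarrow> y \<in> frontier S \<longleftrightarrow> P S \<noteq> Q S"
    and P: "\<And>S S'. S \<in> \<T> \<Longrightarrow> S' \<in> \<T> \<Longrightarrow> S \<noteq> S' \<Longrightarrow> \<not> (P S \<and> P S')"
    and Q: "\<And>S S'. S \<in> \<T> \<Longrightarrow> S' \<in> \<T> \<Longrightarrow> S \<noteq> S' \<Longrightarrow> \<not> (Q S \<and> Q S')"
    and PO: "P \<Omega> \<longleftrightarrow> (\<exists>S\<in>\<T>. P S)" and QO: "Q \<Omega> \<longleftrightarrow> (\<exists>S\<in>\<T>. Q S)"
    by (rule generic_sides[OF H y(3)], rule that)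
  show "T = Tm" if "T \<in> \<T>" "y \<in> frontier T"
    using fr[of T] fr[of Tm] fr[of \<Omega>] that y Tm P[of T Tm] Q[of T Tm] PO QO by blast
qed

text \<open>\<open>cell_faces\<close> asks only for inclusion in the frontier; evaluating that at a
  generic point excludes a third cell.\<close>

lemma interface_cells:
  assumes i: "is_interface \<T> Tm Tp F" and T: "T \<in> \<T>"
  shows "F \<in> cell_faces \<Omega> \<T> T \<longleftrightarrow> T = Tm \<or> T = Tp"
proof
  have F: "F \<in> faces \<Omega> \<T>" using i by (auto simp: faces_def interfaces_def)
  show "F \<in> cell_faces \<Omega> \<T> T" if "T = Tm \<or> T = Tp"
    using that F interface_affine_hull(4)[OF i] by (auto simp: cell_faces_def)
  assume "F \<in> cell_faces \<Omega> \<T> T"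
  moreover obtain y where "y \<in> F" "generic (affine hull F) y" using face_plane(2)[OF F] by blast
  ultimately show "T = Tm \<or> T = Tp" using interface_generic(1)[OF i _ _ T] by (auto simp: cell_faces_def)
qed

lemma interface_not_boundary:
  assumes i: "is_interface \<T> Tm Tp F" shows "F \<notin> boundary_faces \<Omega> \<T>"
proof
  assume b: "F \<in> boundary_faces \<Omega> \<T>"
  have F: "F \<in> faces \<Omega> \<T>" using i by (auto simp: faces_def interfaces_def)
  obtain y where y: "y \<in> F" "generic (affine hull F) y" using face_plane(2)[OF F] by blast
  then have "y \<in> frontier \<Omega>" using boundary_faceE[OF b] by blast
  then show False using interface_generic(2)[OF i y] by blast
qed

text \<open>The point determines the cells of its face, and these together with the plane determine
  the face. So at most one face in a given plane contributes at a generic point.\<close>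

lemma face_unique:
  assumes F: "F \<in> faces \<Omega> \<T>" "F' \<in> faces \<Omega> \<T>" and hull: "affine hull F = affine hull F'"
    and y: "y \<in> F" "y \<in> F'" "generic (affine hull F) y"
  shows "F = F'"
proof -
  have y': "generic (affine hull F') y" using y(3) hull by simp
  have *: "F = F'" if i: "is_interface \<T> Tm Tp F" and F': "F' \<in> faces \<Omega> \<T>" 
     and hull: "affine hull F = affine hull F'"
    and y: "y \<in> F" "y \<in> F'" "generic (affine hull F) y" for F F' Tm Tp
  proof -
    note I = interface_affine_hull[OF i]
    from F' consider Tm' Tp' where "is_interface \<T> Tm' Tp' F'" | "F' \<in> boundary_faces \<Omega> \<T>"
      unfolding faces_def interfaces_def by blast
    then show ?thesis
    proof cases
      case 1
      note I' = interface_affine_hull[OF this]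
      have "y \<in> frontier Tm'" "y \<in> frontier Tp'" using y(2) I'(4) by blast+
      then have "{Tm, Tp} = {Tm', Tp'}" 
        using interface_generic(1)[OF i y(1,3)] I'(1-3) by blast
      then show ?thesis using I(4) I'(4) hull by (metis Int_commute doubleton_eq_iff)
    next
      case 2
      then have "y \<in> frontier \<Omega>" using boundary_faceE[OF 2] y(2) by blast
      then show ?thesis using interface_generic(2)[OF i y(1,3)] by blast
    qed
  qed
  show ?thesis
  proof (cases "(\<exists>Tm Tp. is_interface \<T> Tm Tp F) \<or> (\<exists>Tm Tp. is_interface \<T> Tm Tp F')")
    case True
    then show ?thesis using *[OF _ F(2) hull y] *[OF _ F(1) hull[symmetric] y(2,1) y'] by metis
  next
    case False
    then have b: "F \<in> boundary_faces \<Omega> \<T>" "F' \<in> boundary_faces \<Omega> \<T>" using F by (auto simp: faces_def interfaces_def)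
    obtain Tm where Tm: "Tm \<in> \<T>" "F = frontier Tm \<inter> frontier \<Omega> \<inter> affine hull F" using boundary_faceE[OF b(1)] by metis
    obtain Tm' where Tm': "Tm' \<in> \<T>" "F' = frontier Tm' \<inter> frontier \<Omega> \<inter> affine hull F'" using boundary_faceE[OF b(2)] by metis
    have "y \<in> frontier Tm" "y \<in> frontier \<Omega>" "y \<in> frontier Tm'" using y Tm(2) Tm'(2) by blast+
    then have "Tm' = Tm" using boundary_generic[OF Tm(1) face_plane(1)[OF F(1)] _ _ y(3) Tm'(1)] by blast
    then show ?thesis using Tm Tm' hull by metis
  qed
qed

text \<open>The faces of a cell cover its frontier up to nongeneric points. If the domain lies on
  both sides at \<open>y\<close>, the side not occupied by \<open>T\<close> belongs to another cell
  and yields an interface; otherwise \<open>y\<close> is on a boundary face.\<close>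

lemma generic_face_exists:
  assumes T: "T \<in> \<T>" and H: "H \<in> \<H>" "generic H y" and y: "y \<in> frontier T"
  shows "\<exists>F\<in>cell_faces \<Omega> \<T> T. y \<in> F \<and> affine hull F = H"
proof -
  have solid: "solid_in H (frontier T \<inter> frontier S \<inter> H)" if S: "S \<in> insert \<Omega> \<T>" "y \<in> frontier S" for S
  proof -
    let ?F = "frontier T \<inter> frontier S \<inter> H"
    have yH: "y \<in> H" using H(2) by (simp add: generic_def)
    obtain e where e: "e > 0" "ball y e \<inter> H \<subseteq> ?F"
      using generic_ball_in_face[OF H _ S(1) y S(2)] T by blast
    obtain n b where n: "n \<noteq> 0" "H = {x. n \<bullet> x = b}" using hypH[OF H(1)] unfolding hyperplane_def by blast
    have aff: "affine H" unfolding n(2) by (rule affine_hyperplane)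
    have "affine hull (H \<inter> ball y e) = affine hull H"
      by (rule affine_hull_affine_Int_open[OF aff open_ball]) (use e yH in auto)
    then have "affine hull (H \<inter> ball y e) = H" using aff by (simp add: hull_same)
    moreover have "affine hull (H \<inter> ball y e) \<subseteq> affine hull ?F" by (rule hull_mono) (use e in auto)
    moreover have "affine hull ?F \<subseteq> H" using aff by (intro hull_minimal) auto
    ultimately have hull: "affine hull ?F = H" by blast
    moreover have "y \<in> rel_interior ?F"
      unfolding mem_rel_interior_ball hull using e yH S(2) y by blast
    ultimately show ?thesis unfolding solid_in_def by blast
  qed
  obtain P Q where fr: "\<And>S. S \<in> insert \<Omega> \<T> \<Longrightarrow> y \<in> frontier S \<longleftrightarrow> P S \<noteq> Q S"
    and P: "\<And>S S'. S \<in> \<T> \<Longrightarrow> S' \<in> \<T> \<Longrightarrow> S \<noteq> S' \<Longrightarrow> \<not> (P S \<and> P S')"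
    and Q: "\<And>S S'. S \<in> \<T> \<Longrightarrow> S' \<in> \<T> \<Longrightarrow> S \<noteq> S' \<Longrightarrow> \<not> (Q S \<and> Q S')"
    and PO: "P \<Omega> \<longleftrightarrow> (\<exists>S\<in>\<T>. P S)" and QO: "Q \<Omega> \<longleftrightarrow> (\<exists>S\<in>\<T>. Q S)"
    by (rule generic_sides[OF H], rule that)
  have PQ: "P T \<noteq> Q T" using fr T y by blast
  have yH: "y \<in> H" using H(2) by (simp add: generic_def)
  have "y \<in> frontier \<Omega> \<or> (\<exists>S\<in>\<T>. S \<noteq> T \<and> y \<in> frontier S)"
  proof (cases "P \<Omega> = Q \<Omega>")
    case True
    then have "P \<Omega>" "Q \<Omega>" using PQ PO QO T by blast+
    then obtain S S' where S: "S \<in> \<T>" "P S" "S' \<in> \<T>" "Q S'" using PO QO by blast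
    show ?thesis
    proof (cases "P T")
      case True
      then have "S' \<noteq> T" "\<not> P S'" using PQ S P[of S' T] T by blast+
      then show ?thesis using fr[of S'] S by blast
    next
      case False
      then have "S \<noteq> T" "\<not> Q S" using PQ S Q[of S T] T by blast+
      then show ?thesis using fr[of S] S by blast
    qed
  qed (use fr in blast)
  then show ?thesis
  proof
    assume yO: "y \<in> frontier \<Omega>"
    let ?F = "frontier T \<inter> frontier \<Omega> \<inter> H"
    have s: "solid_in H ?F" by (rule solid) (use yO in auto)
    then have "?F \<in> boundary_faces \<Omega> \<T>" using T hypH[OF H(1)] unfolding boundary_faces_def by blast
    then have "?F \<in> cell_faces \<Omega> \<T> T" by (auto simp: cell_faces_def faces_def)
    moreover have "affine hull ?F = H" using s by (simp add: solid_in_def)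
    ultimately show ?thesis using yO y yH by (intro bexI[of _ ?F]) auto
  next
    assume "\<exists>S\<in>\<T>. S \<noteq> T \<and> y \<in> frontier S"
    then obtain S where S: "S \<in> \<T>" "S \<noteq> T" "y \<in> frontier S" by blast
    let ?F = "frontier T \<inter> frontier S \<inter> H"
    have s: "solid_in H ?F" by (rule solid) (use S in auto)
    then have "is_interface \<T> T S ?F" using T S hypH[OF H(1)] unfolding is_interface_def by blast
    then have "?F \<in> cell_faces \<Omega> \<T> T" by (auto simp: cell_faces_def faces_def interfaces_def)
    moreover have "affine hull ?F = H" using s by (simp add: solid_in_def)
    ultimately show ?thesis using S(3) y yH by (intro bexI[of _ ?F]) auto
  qed
qed

lemma normals_agree:
  "T \<in> \<T> \<Longrightarrow> F \<in> cell_faces \<Omega> \<T> T \<Longrightarrow> x \<in> rel_interior F \<Longrightarrow> y \<in> rel_interior F \<Longrightarrow>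
    outward_normal T x m \<Longrightarrow> outward_normal T y n \<Longrightarrow> m = n"
  using mesh unfolding is_mesh_def by (elim conjE) metis

text \<open>The mesh condition makes the normal constant on the face, so it can be read off at a
  single generic point.\<close>

lemma face_normal_eq:
  assumes T: "T \<in> \<T>" and F: "F \<in> cell_faces \<Omega> \<T> T" and y: "y \<in> F" "generic (affine hull F) y"
    and n: "norm n = 1" "affine hull F = {x. n \<bullet> x = b}" and ls: "e > 0" "locally_sided T y n b e P Q"
  shows "P \<noteq> Q" "face_normal T F = (if Q then n else - n)"
proof -
  have Ff: "F \<in> faces \<Omega> \<T>" and yT: "y \<in> frontier T" using F y by (auto simp: cell_faces_def)
  show PQ: "P \<noteq> Q" using generic_frontier_iff[OF y(2) n ls(1) _ ls(2)] T yT by blast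
  have "n \<bullet> y = b" using y(2) n(2) by (auto simp: generic_def)
  then have on: "outward_normal T y (if Q then n else - n)"
    by (rule locally_sided_outward_normal[OF n(1) ls(2,1) _ PQ])
  have yr: "y \<in> rel_interior F" by (rule generic_rel_interior[OF Ff y])
  show "face_normal T F = (if Q then n else - n)"
    unfolding face_normal_def
  proof (rule the_equality)
    show "\<exists>x\<in>rel_interior F. outward_normal T x (if Q then n else - n)" using on yr by blast
    fix m assume "\<exists>x\<in>rel_interior F. outward_normal T x m"
    then show "m = (if Q then n else - n)" using normals_agree[OF T F _ yr _ on] by blast
  qed
qed

section \<open>The divergence theorem on a cell\<close>

lemma face_measurable: "F \<in> faces \<Omega> \<T> \<Longrightarrow> F \<in> sets borel" "F \<in> faces \<Omega> \<T> \<Longrightarrow> bounded F"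
proof -
  assume F: "F \<in> faces \<Omega> \<T>"
  obtain Tm S where F': "Tm \<in> \<T>" "S \<in> insert \<Omega> \<T>" "F = frontier Tm \<inter> frontier S \<inter> affine hull F" using facesE[OF F] by metis
  have "closed F" by (subst F'(3)) (intro closed_Int frontier_closed closed_affine_hull)
  then show "F \<in> sets borel" by (rule borel_closed)
  have "bounded Tm" by (rule bounded_cell) (use F'(1) in simp)
  then have "bounded (frontier Tm)" unfolding frontier_def by (intro bounded_diff bounded_closure)
  then show "bounded F" by (rule bounded_subset) (use F'(3) in blast)
qed

lemma surface_measure_face:
  assumes F: "F \<in> faces \<Omega> \<T>" and n: "norm n = 1" "affine hull F = {x. n \<bullet> x = b}"
  shows "surface_measure F = restrict_space (hyperplane_measure n b) F"
    "F \<inter> space (hyperplane_measure n b) \<in> sets (hyperplane_measure n b)"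
  using surface_measure_eq[OF n] face_measurable(1)[OF F]
  by (simp_all add: space_hyperplane_measure[OF n(1)] sets_hyperplane_measure[OF n(1)])

lemma surface_integral:
  fixes g :: "real^'d \<Rightarrow> real"
  assumes "F \<in> faces \<Omega> \<T>" "norm n = 1" "affine hull F = {x. n \<bullet> x = b}"
  shows "(\<integral>x. g x \<partial>surface_measure F) = (\<integral>x. indicator F x * g x \<partial>hyperplane_measure n b)"
  using surface_measure_face[OF assms] by (simp only: integral_restrict_space real_scaleR_def)

lemma hyperplane_integrable:
  fixes g :: "real^'d \<Rightarrow> real"
  assumes F: "F \<in> faces \<Omega> \<T>" and n: "norm n = 1" and g: "continuous_on UNIV g"
  shows "integrable (hyperplane_measure n b) (\<lambda>x. indicator F x * g x)"
proof -
  let ?\<sigma> = "hyperplane_measure n b"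
  obtain r where r: "F \<subseteq> cball 0 r" using bounded_imp_subset_cball[OF face_measurable(2)[OF F]] by blast
  have "bounded (g ` cball 0 r)"
    using continuous_on_subset[OF g] by (intro compact_imp_bounded compact_continuous_image) auto
  then obtain K where K: "\<And>x. x \<in> cball 0 r \<Longrightarrow> \<bar>g x\<bar> \<le> K" 
    unfolding bounded_iff real_norm_def by blast
  have Fm: "F \<in> sets borel" by (rule face_measurable(1)[OF F])
  have gm: "g \<in> borel_measurable borel" using g by (rule borel_measurable_continuous_onI)
  show ?thesis
  proof (rule Bochner_Integration.integrable_bound)
    show "integrable ?\<sigma> (\<lambda>x. K * indicator (cball 0 r) x :: real)"
      using emeasure_hyperplane_measure_cball[OF n, of b r]
      by (intro integrable_mult_right integrable_real_indicator) (auto simp: sets_hyperplane_measure[OF n])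
    show "AE x in ?\<sigma>. norm (indicator F x * g x) \<le> norm (K * indicator (cball 0 r) x :: real)"
    proof (rule AE_I2)
      fix x
      show "norm (indicator F x * g x) \<le> norm (K * indicator (cball 0 r) x :: real)"
      proof (cases "x \<in> F")
        case True
        then have x: "x \<in> cball 0 r" using r by blast
        then have "\<bar>g x\<bar> \<le> K" "indicator (cball 0 r) x = (1 :: real)" using K by auto
        then show ?thesis using True by simp
      qed simp
    qed
    show "(\<lambda>x. indicator F x * g x) \<in> borel_measurable ?\<sigma>"
      unfolding measurable_cong_sets[OF sets_hyperplane_measure[OF n] refl] using gm Fm by measurable
  qed
qed

theorem gauss_cell:
  assumes T: "T \<in> \<T>" and p: "p \<in> cell_polys k"
  shows "(\<integral>x. indicator T x * (grad p x \<bullet> v) \<partial>lborel) =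
    (\<Sum>F\<in>cell_faces \<Omega> \<T> T. \<integral>x. p x * (face_normal T F \<bullet> v) \<partial>surface_measure F)"
proof -
  have "\<exists>n b. norm n = 1 \<and> H = {x. n \<bullet> x = b} \<and> n \<bullet> v \<ge> 0" if "H \<in> \<H>" for H
    using hyperplane_unit_normal[OF hypH[OF that], of v] by blast
  then obtain N off where N: "\<And>H. H \<in> \<H> \<Longrightarrow> norm (N H) = 1" "\<And>H. H \<in> \<H> \<Longrightarrow> H = {x. N H \<bullet> x = off H}"
      "\<And>H. H \<in> \<H> \<Longrightarrow> N H \<bullet> v \<ge> 0" by metis
  define B where "B = cell_faces \<Omega> \<T> T"
  have B: "F \<in> faces \<Omega> \<T>" "F \<subseteq> frontier T" if "F \<in> B" for F using that by (auto simp: B_def cell_faces_def)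
  have finB: "finite B" using finite_faces by (rule finite_subset[rotated]) (use B in auto)
  \<comment> \<open>The normal component of \<open>v\<close> on the part of the plane covered by
    faces of \<open>T\<close>; at a generic point at most one face contributes.\<close>
  define \<nu> where "\<nu> H y = (\<Sum>F\<in>{F \<in> B. affine hull F = H}. indicator F y * (face_normal T F \<bullet> v))" for H y
  obtain U where U: "compact U" "T = interior U" "arranged \<H> U" using arr T by blast
  obtain R where R: "T \<subseteq> cball 0 R" using bounded_cell[of T] T bounded_imp_subset_cball by blast
  have \<nu>m: "\<nu> H \<in> borel_measurable borel" for H
    unfolding \<nu>_def using B face_measurable(1) by (intro borel_measurable_sum borel_measurable_times borel_measurable_indicator) auto
  have "(\<integral>x. indicator T x * (grad p x \<bullet> v) \<partial>lborel) =
    (\<Sum>H\<in>\<H>. \<integral>y. p y * \<nu> H y \<partial>hyperplane_measure (N H) (off H))"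
  proof (rule gauss_arrangement[OF _ R finH N _ \<nu>m _ p])
    show "open T" using open_cell T by blast
  next
    \<comment> \<open>Equal strict signs give equal membership in \<open>U\<close>, and off the
      planes \<open>U\<close> agrees with its interior \<open>T\<close>.\<close>
    fix x y assume xy: "\<And>H. H \<in> \<H> \<Longrightarrow> (N H \<bullet> x - off H) * (N H \<bullet> y - off H) > 0"
    have sg: "sgn (signed_dist H x) = sgn (signed_dist H y) \<and> signed_dist H x \<noteq> 0 \<and> signed_dist H y \<noteq> 0" if H: "H \<in> \<H>" for H
    proof -
      have "N H \<noteq> 0" using N(1)[OF H] by auto
      obtain s where s: "s \<noteq> 0" "\<And>x. N H \<bullet> x - off H = s * signed_dist H x"
        using signed_dist_proportional[OF \<open>N H \<noteq> 0\<close>, of "off H"] N(2)[OF H] by metis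
      have "(s * s) * (signed_dist H x * signed_dist H y) > 0" using xy[OF H] unfolding s(2) by (simp add: mult_ac)
      then have "signed_dist H x * signed_dist H y > 0" using s(1) by (simp add: zero_less_mult_iff)
      then show ?thesis by (auto simp: zero_less_mult_iff)
    qed
    have nbd: "\<exists>e>0. ball z e \<subseteq> U" if zU: "z \<in> U" and nz: "\<And>H. H \<in> \<H> \<Longrightarrow> signed_dist H z \<noteq> 0" for z
    proof -
      have "H \<in> \<H> \<and> z \<notin> H" if "H \<in> \<H>" for H using nz[OF that] signed_dist_eq_0_iff[OF hypH[OF that]] that by blast
      note near = signed_dist_near[of \<H> z, OF this]
      obtain e where "e > 0" "\<forall>H\<in>\<H>. \<forall>w\<in>ball z e. sgn (signed_dist H w) = sgn (signed_dist H z)"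
        using near by blast
      then show ?thesis using U(3) zU unfolding arranged_def by blast
    qed
    have T_iff: "z \<in> T \<longleftrightarrow> z \<in> U" if "\<And>H. H \<in> \<H> \<Longrightarrow> signed_dist H z \<noteq> 0" for z
    proof
      show "z \<in> T \<Longrightarrow> z \<in> U" using U(2) interior_subset by blast
      assume "z \<in> U"
      from nbd[OF this that] show "z \<in> T" unfolding U(2) mem_interior by blast
    qed
    have "x \<in> U \<longleftrightarrow> y \<in> U" using U(3) sg unfolding arranged_def by blast
    then show "x \<in> T \<longleftrightarrow> y \<in> T" using T_iff sg by blast
  next
    fix H y e P Q
    assume H: "H \<in> \<H>" and y: "y \<in> H" "\<And>H'. H' \<in> \<H> \<Longrightarrow> H' \<noteq> H \<Longrightarrow> y \<notin> H'" and e: "e > 0"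
      and P: "\<And>z. z \<in> ball y e \<Longrightarrow> N H \<bullet> z > off H \<Longrightarrow> z \<in> T \<longleftrightarrow> P"
      and Q: "\<And>z. z \<in> ball y e \<Longrightarrow> N H \<bullet> z < off H \<Longrightarrow> z \<in> T \<longleftrightarrow> Q"
    have gen: "generic H y" using y by (auto simp: generic_def)
    obtain e' P' Q' where e': "e' > 0" and ls': "locally_sided T y (N H) (off H) e' P' Q'"
      using locally_sided_exists[OF H gen N(1,2)[OF H]] T by blast
    have yb: "N H \<bullet> y = off H" using y(1) N(2)[OF H] by blast
    \<comment> \<open>The given sides and those of \<open>locally_sided\<close> come from different
      balls; they are compared at points of the smaller one.\<close>
    obtain zp zm where z: "zp \<in> ball y (min e e')" "N H \<bullet> zp > off H" "zm \<in> ball y (min e e')" "N H \<bullet> zm < off H"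
      by (rule side_points[OF N(1)[OF H] yb, of "min e e'"]) (use e e' in auto)
    have "P' = P" using z(1,2) P[of zp] ls' by (auto simp: locally_sided_def)
    moreover have "Q' = Q" using z(3,4) Q[of zm] ls' by (auto simp: locally_sided_def)
    ultimately have ls: "locally_sided T y (N H) (off H) e' P Q" using ls' by simp
    have fr: "y \<in> frontier T \<longleftrightarrow> P \<noteq> Q"
      by (rule generic_frontier_iff[OF gen N(1,2)[OF H] e' _ ls]) (use T in auto)
    show "\<nu> H y = (N H \<bullet> v) * (of_bool Q - of_bool P)"
    proof (cases "P = Q")
      case True
      then have "y \<notin> F" if "F \<in> B" for F using fr B(2)[OF that] by blast
      then have "\<nu> H y = 0" unfolding \<nu>_def by (intro sum.neutral) auto
      then show ?thesis using True by simp
    next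
      case False
      then obtain F where F: "F \<in> B" "y \<in> F" "affine hull F = H"
        using generic_face_exists[OF T H gen] fr unfolding B_def by blast
      have uniq: "F' = F" if "F' \<in> B" "affine hull F' = H" "y \<in> F'" for F'
        by (rule face_unique[OF B(1)[OF that(1)] B(1)[OF F(1)]]) (use that F gen in auto)
      have "\<nu> H y = (\<Sum>F'\<in>{F \<in> B. affine hull F = H}. if F' = F then face_normal T F \<bullet> v else 0)"
        unfolding \<nu>_def
      proof (rule sum.cong[OF refl])
        fix F' assume F': "F' \<in> {F \<in> B. affine hull F = H}"
        show "indicator F' y * (face_normal T F' \<bullet> v) = (if F' = F then face_normal T F \<bullet> v else 0)"
        proof (cases "F' = F")
          case False
          then have "y \<notin> F'" using uniq[of F'] F' by blast
          then show ?thesis using False by simp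
        qed (use F(2) in simp)
      qed
      also have "\<dots> = face_normal T F \<bullet> v" using finB F(1,3) by (subst sum.delta) auto
      also have "face_normal T F = (if Q then N H else - N H)"
        by (rule face_normal_eq(2)[OF T _ F(2) _ N(1)[OF H] _ e' ls]) (use F gen N(2)[OF H] in \<open>auto simp: B_def\<close>)
      finally show ?thesis using False by auto
    qed
  qed
  also have "\<dots> = (\<Sum>H\<in>\<H>. \<Sum>F\<in>{F \<in> B. affine hull F = H}. \<integral>x. p x * (face_normal T F \<bullet> v) \<partial>surface_measure F)"
  proof (rule sum.cong[OF refl])
    fix H assume H: "H \<in> \<H>"
    let ?\<sigma> = "hyperplane_measure (N H) (off H)"
    have hull: "affine hull F = {x. N H \<bullet> x = off H}" if "affine hull F = H" for F using that N(2)[OF H] by simp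
    have surf: "(\<integral>x. p x * (face_normal T F \<bullet> v) \<partial>surface_measure F) = (\<integral>x. indicator F x * (p x * (face_normal T F \<bullet> v)) \<partial>?\<sigma>)"
      if "F \<in> B" "affine hull F = H" for F
      by (rule surface_integral[OF B(1)[OF that(1)] N(1)[OF H] hull[OF that(2)]])
    have int: "integrable ?\<sigma> (\<lambda>x. indicator F x * (p x * (face_normal T F \<bullet> v)))" if F: "F \<in> B" "affine hull F = H" for F
      by (rule hyperplane_integrable[OF B(1)[OF F(1)] N(1)[OF H]]) (intro continuous_intros cell_polys_continuous[OF p])
    have "(\<integral>y. p y * \<nu> H y \<partial>?\<sigma>) = (\<integral>y. (\<Sum>F\<in>{F \<in> B. affine hull F = H}. indicator F y * (p y * (face_normal T F \<bullet> v))) \<partial>?\<sigma>)"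
      unfolding \<nu>_def by (simp add: sum_distrib_left mult_ac)
    also have "\<dots> = (\<Sum>F\<in>{F \<in> B. affine hull F = H}. \<integral>y. indicator F y * (p y * (face_normal T F \<bullet> v)) \<partial>?\<sigma>)"
      using int by (intro Bochner_Integration.integral_sum) auto
    also have "\<dots> = (\<Sum>F\<in>{F \<in> B. affine hull F = H}. \<integral>x. p x * (face_normal T F \<bullet> v) \<partial>surface_measure F)"
      using surf by (intro sum.cong) auto
    finally show "(\<integral>y. p y * \<nu> H y \<partial>?\<sigma>) = \<dots>" .
  qed
  \<comment> \<open>Every face spans exactly one plane of the arrangement.\<close>
  also have "\<dots> = (\<Sum>F\<in>B. \<integral>x. p x * (face_normal T F \<bullet> v) \<partial>surface_measure F)"
    by (rule sum.group[OF finB finH]) (use B face_plane in auto)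
  finally show ?thesis unfolding B_def .
qed

end

section \<open>The local operators\<close>

text \<open>By \<open>dep\<close>, every element has coefficients vanishing outside
  \<open>I\<close>, although \<open>\<phi>\<close> need not be injective.\<close>

lemma riesz_param:
  fixes \<phi> :: "('i \<Rightarrow> real) \<Rightarrow> 'v" and ip :: "'v \<Rightarrow> 'v \<Rightarrow> real" and L :: "'v \<Rightarrow> real"
  assumes fin: "finite I" and dep: "\<And>c c'. (\<And>i. i \<in> I \<Longrightarrow> c i = c' i) \<Longrightarrow> \<phi> c = \<phi> c'"
    and lin: "\<And>a c c' e. ip (\<phi> (\<lambda>i. a * c i + c' i)) (\<phi> e) = a * ip (\<phi> c) (\<phi> e) + ip (\<phi> c') (\<phi> e)"
    and sym: "\<And>c e. ip (\<phi> c) (\<phi> e) = ip (\<phi> e) (\<phi> c)" and pos: "\<And>c. ip (\<phi> c) (\<phi> c) \<ge> 0"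
    and llin: "\<And>a c c'. L (\<phi> (\<lambda>i. a * c i + c' i)) = a * L (\<phi> c) + L (\<phi> c')"
    and null: "\<And>c. ip (\<phi> c) (\<phi> c) = 0 \<Longrightarrow> L (\<phi> c) = 0"
  shows "\<exists>r\<in>range \<phi>. \<forall>q\<in>range \<phi>. ip r q = L q"
proof -
  obtain r where r: "\<And>c. (\<forall>i. i \<notin> I \<longrightarrow> c i = 0) \<Longrightarrow> ip (\<phi> r) (\<phi> c) = L (\<phi> c)"
    using riesz_coeff[of I "\<lambda>c e. ip (\<phi> c) (\<phi> e)" "\<lambda>c. L (\<phi> c)", OF fin lin sym pos llin null] by blast
  have "ip (\<phi> r) (\<phi> c) = L (\<phi> c)" for c
  proof -
    have "\<phi> c = \<phi> (\<lambda>i. if i \<in> I then c i else 0)" by (rule dep) simp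
    then show ?thesis using r[of "\<lambda>i. if i \<in> I then c i else 0"] by simp
  qed
  then show ?thesis by blast
qed

lemma riesz_cell_polys:
  fixes ip :: "(real^'d \<Rightarrow> real) \<Rightarrow> (real^'d \<Rightarrow> real) \<Rightarrow> real"
  assumes lin: "\<And>a u v w. u \<in> cell_polys m \<Longrightarrow> v \<in> cell_polys m \<Longrightarrow> w \<in> cell_polys m \<Longrightarrow>
      ip (\<lambda>x. a * u x + v x) w = a * ip u w + ip v w"
    and sym: "\<And>u v. ip u v = ip v u" and pos: "\<And>u. u \<in> cell_polys m \<Longrightarrow> ip u u \<ge> 0"
    and llin: "\<And>a u v. u \<in> cell_polys m \<Longrightarrow> v \<in> cell_polys m \<Longrightarrow> L (\<lambda>x. a * u x + v x) = a * L u + L v"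
    and null: "\<And>u. u \<in> cell_polys m \<Longrightarrow> ip u u = 0 \<Longrightarrow> L u = 0"
  shows "\<exists>r\<in>cell_polys m. \<forall>q\<in>cell_polys m. ip r q = L q"
proof -
  obtain I where I: "finite I" "cell_polys m = range (\<lambda>c (x::real^'d). \<Sum>\<alpha>\<in>I. c \<alpha> * (\<Prod>i\<in>UNIV. x $ i ^ \<alpha> i))"
    using cell_polys_parametrization[where 'd = 'd] by blast
  define \<phi> where "\<phi> = (\<lambda>c (x::real^'d). \<Sum>\<alpha>\<in>I. c \<alpha> * (\<Prod>i\<in>UNIV. x $ i ^ \<alpha> i) :: real)"
  have \<phi>: "\<phi> (\<lambda>\<alpha>. a * c \<alpha> + c' \<alpha>) = (\<lambda>x. a * \<phi> c x + \<phi> c' x)" for a c c'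
    by (simp add: \<phi>_def fun_eq_iff sum.distrib sum_distrib_left distrib_right mult.assoc)
  have mem: "\<phi> c \<in> cell_polys m" for c using I(2) by (auto simp: \<phi>_def)
  have "\<exists>r\<in>range \<phi>. \<forall>q\<in>range \<phi>. ip r q = L q"
  proof (rule riesz_param[OF I(1)])
    show "\<phi> c = \<phi> c'" if "\<And>\<alpha>. \<alpha> \<in> I \<Longrightarrow> c \<alpha> = c' \<alpha>" for c c'
      unfolding \<phi>_def using that by (auto intro!: sum.cong)
  qed (use lin sym pos llin null mem in \<open>simp_all add: \<phi>\<close>)
  then show ?thesis using I(2) by (simp add: \<phi>_def)
qed

lemma ip_cell_commute: "ip_cell T u v = ip_cell T v u"
  by (simp add: ip_cell_def mult.commute)

lemma ip_bd_commute: "ip_bd B \<eta> \<mu> = ip_bd B \<mu> \<eta>"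
  by (simp add: ip_bd_def mult.commute)

lemma cell_polys_integrable_on:
  assumes openT: "open T" and boundedT: "bounded T" and u: "u \<in> cell_polys m"
  shows "integrable (lebesgue_on T) u"
proof -
  have T: "T \<in> lmeasurable" using openT boundedT by (simp add: lmeasurable_open)
  interpret finite_measure "lebesgue_on T" using T by (rule finite_measure_lebesgue_on)
  have "compact (closure T)" using boundedT by simp
  then have "bounded (u ` closure T)"
    by (intro compact_imp_bounded compact_continuous_image cell_polys_continuous[OF u])
  then obtain K where K: "\<And>x. x \<in> closure T \<Longrightarrow> norm (u x) \<le> K" unfolding bounded_iff by blast
  show ?thesis
  proof (rule integrable_const_bound)
    show "AE x in lebesgue_on T. norm (u x) \<le> K" using K closure_subset by (intro AE_I2) (auto simp: subset_iff)
    show "u \<in> borel_measurable (lebesgue_on T)"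
      using cell_polys_continuous[OF u] T by (intro continuous_imp_measurable_on_sets_lebesgue) (auto simp: fmeasurableD)
  qed
qed

text \<open>All that the local theory takes from geometry; no arrangement occurs inside this locale.
  \<open>parts\<close> is the divergence theorem, and \<open>zero_face\<close> makes the face inner
  products definite.\<close>

locale hho_cell =
  fixes T :: "(real^'d) set" and B :: "(real^'d) set set" and k :: nat
  assumes openT: "open T" and boundedT: "bounded T" and nonemptyT: "T \<noteq> {}" and finB: "finite B"
    and space_face: "\<And>F. F \<in> B \<Longrightarrow> space (surface_measure F) = F"
    and int_face: "\<And>F m v. F \<in> B \<Longrightarrow> v \<in> cell_polys m \<Longrightarrow> integrable (surface_measure F) v"
    and zero_face: "\<And>F m v x. F \<in> B \<Longrightarrow> v \<in> cell_polys m \<Longrightarrow> (\<integral>x. v x * v x \<partial>surface_measure F) = 0 \<Longrightarrow> x \<in> F \<Longrightarrow> v x = 0"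
    and face_restr: "\<And>F m. F \<in> B \<Longrightarrow> face_polys m F = (\<lambda>v. restrict v F) ` cell_polys m"
    and parts: "\<And>w q m l. w \<in> cell_polys m \<Longrightarrow> q \<in> cell_polys l \<Longrightarrow>
      ip_cell_vec T (grad w) (grad q) = - ip_cell T w (laplacian q) +
        (\<Sum>F\<in>B. \<integral>x. w x * (face_normal T F \<bullet> grad q x) \<partial>surface_measure F)"
begin

section \<open>Piecewise polynomials on the cell boundary\<close>

text \<open>The degree may vary with the face and values off the faces are free, so traces, normal
  derivatives and their combinations qualify before being projected to degree
  \<open>k\<close>.\<close>

definition bd_poly :: "'d face_family \<Rightarrow> bool" where
  "bd_poly \<eta> \<longleftrightarrow> (\<forall>F\<in>B. \<exists>m. \<exists>v\<in>cell_polys m. \<forall>x\<in>F. \<eta> F x = v x)"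

abbreviation bd_restrict :: "'d face_family \<Rightarrow> 'd face_family" where
  "bd_restrict g \<equiv> (\<lambda>F\<in>B. \<lambda>x\<in>F. g F x)"

lemma bd_space_iff:
  "\<mu> \<in> bd_space m B \<longleftrightarrow> bd_restrict \<mu> = \<mu> \<and> (\<forall>F\<in>B. \<exists>v\<in>cell_polys m. \<forall>x\<in>F. \<mu> F x = v x)"
proof
  assume "\<mu> \<in> bd_space m B"
  then have ext: "\<mu> \<in> extensional B" and "\<And>F. F \<in> B \<Longrightarrow> \<mu> F \<in> face_polys m F"
    by (auto simp: bd_space_def PiE_def)
  then have *: "\<And>F. F \<in> B \<Longrightarrow> \<exists>v\<in>cell_polys m. \<mu> F = restrict v F" using face_restr by blast
  have "bd_restrict \<mu> F = \<mu> F" for F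
    using *[of F] ext by (cases "F \<in> B") (auto simp: extensional_def fun_eq_iff)
  then have "bd_restrict \<mu> = \<mu>" by (rule HOL.ext)
  moreover have "\<exists>v\<in>cell_polys m. \<forall>x\<in>F. \<mu> F x = v x" if F: "F \<in> B" for F
  proof -
    obtain v where "v \<in> cell_polys m" "\<mu> F = restrict v F" using *[OF F] by blast
    then show ?thesis by (intro bexI[of _ v]) auto
  qed
  ultimately show "bd_restrict \<mu> = \<mu> \<and> (\<forall>F\<in>B. \<exists>v\<in>cell_polys m. \<forall>x\<in>F. \<mu> F x = v x)" by blast
next
  assume a: "bd_restrict \<mu> = \<mu> \<and> (\<forall>F\<in>B. \<exists>v\<in>cell_polys m. \<forall>x\<in>F. \<mu> F x = v x)"
  have "\<mu> F \<in> (\<lambda>v. restrict v F) ` cell_polys m" if F: "F \<in> B" for F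
  proof -
    obtain v where v: "v \<in> cell_polys m" "\<And>x. x \<in> F \<Longrightarrow> \<mu> F x = v x" using a F by blast
    have "\<mu> F = restrict (\<mu> F) F" using fun_cong[OF conjunct1[OF a], of F] F by simp
    also have "\<dots> = restrict v F" using v by (auto simp: fun_eq_iff)
    finally show ?thesis using v(1) by blast
  qed
  moreover have "\<mu> \<in> extensional B" by (subst conjunct1[OF a, symmetric]) (rule restrict_extensional)
  ultimately show "\<mu> \<in> bd_space m B" unfolding bd_space_def PiE_def using face_restr by blast
qed

lemma bd_restrict_in_bd_space:
  "(\<And>F. F \<in> B \<Longrightarrow> \<exists>v\<in>cell_polys m. \<forall>x\<in>F. g F x = v x) \<Longrightarrow> bd_restrict g \<in> bd_space m B"
  unfolding bd_space_iff by (auto simp: fun_eq_iff)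

lemma bd_space_polyE:
  assumes "\<mu> \<in> bd_space m B" "F \<in> B"
  obtains v where "v \<in> cell_polys m" "\<And>x. x \<in> F \<Longrightarrow> \<mu> F x = v x"
  using assms bd_space_iff by blast

lemma bd_space_eqI:
  assumes "\<mu> \<in> bd_space m B" "\<nu> \<in> bd_space m B" "\<And>F x. F \<in> B \<Longrightarrow> x \<in> F \<Longrightarrow> \<mu> F x = \<nu> F x"
  shows "\<mu> = \<nu>"
proof -
  have "bd_restrict \<mu> = bd_restrict \<nu>" using assms(3) by (auto simp: fun_eq_iff)
  then show ?thesis using assms(1,2) by (simp add: bd_space_iff)
qed

lemma bd_space_poly: "\<mu> \<in> bd_space m B \<Longrightarrow> bd_poly \<mu>"
  unfolding bd_space_iff bd_poly_def by blast

lemma bd_poly_lin: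
  assumes "bd_poly \<eta>" "bd_poly \<mu>" "\<And>F x. F \<in> B \<Longrightarrow> x \<in> F \<Longrightarrow> \<xi> F x = a * \<eta> F x + \<mu> F x"
  shows "bd_poly \<xi>"
  unfolding bd_poly_def
proof
  fix F assume F: "F \<in> B"
  obtain m v l w where "v \<in> cell_polys m" "\<forall>x\<in>F. \<eta> F x = v x" "w \<in> cell_polys l" "\<forall>x\<in>F. \<mu> F x = w x"
    using assms(1,2) F unfolding bd_poly_def by meson
  then show "\<exists>m. \<exists>v\<in>cell_polys m. \<forall>x\<in>F. \<xi> F x = v x"
    using cell_polys_lin[OF cell_polys_mono[of m "max m l" v] cell_polys_mono[of l "max m l" w], of a] assms(3)[OF F]
    by (intro exI[of _ "max m l"] bexI[of _ "\<lambda>x. a * v x + w x"]) auto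
qed

lemma bd_space_lin:
  assumes "\<eta> \<in> bd_space m B" "\<mu> \<in> bd_space m B"
  shows "bd_restrict (\<lambda>F x. a * \<eta> F x + \<mu> F x) \<in> bd_space m B"
proof (rule bd_restrict_in_bd_space)
  fix F assume F: "F \<in> B"
  obtain v w where "v \<in> cell_polys m" "\<And>x. x \<in> F \<Longrightarrow> \<eta> F x = v x" "w \<in> cell_polys m" "\<And>x. x \<in> F \<Longrightarrow> \<mu> F x = w x"
    using bd_space_polyE[OF assms(1) F] bd_space_polyE[OF assms(2) F] by metis
  then show "\<exists>v\<in>cell_polys m. \<forall>x\<in>F. a * \<eta> F x + \<mu> F x = v x"
    by (intro bexI[of _ "\<lambda>x. a * v x + w x"]) (auto intro: cell_polys_lin)
qed

lemma ip_bd_cong: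
  assumes "\<And>F x. F \<in> B \<Longrightarrow> x \<in> F \<Longrightarrow> \<eta> F x = \<eta>' F x" "\<And>F x. F \<in> B \<Longrightarrow> x \<in> F \<Longrightarrow> \<mu> F x = \<mu>' F x"
  shows "ip_bd B \<eta> \<mu> = ip_bd B \<eta>' \<mu>'"
  unfolding ip_bd_def using assms space_face by (intro sum.cong Bochner_Integration.integral_cong) auto

lemma bd_poly_integrable:
  assumes "bd_poly \<eta>" "bd_poly \<mu>" "F \<in> B"
  shows "integrable (surface_measure F) (\<lambda>x. \<eta> F x * \<mu> F x)"
proof -
  obtain m v l w where vw: "v \<in> cell_polys m" "\<forall>x\<in>F. \<eta> F x = v x" "w \<in> cell_polys l" "\<forall>x\<in>F. \<mu> F x = w x"
    using assms unfolding bd_poly_def by meson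
  have "integrable (surface_measure F) (\<lambda>x. v x * w x)"
    by (rule int_face[OF assms(3) cell_polys_mult[OF vw(1,3)]])
  then show ?thesis
    by (rule Bochner_Integration.integrable_cong[THEN iffD1, rotated 2]) (use vw space_face assms(3) in auto)
qed

lemma ip_bd_lin:
  assumes "bd_poly \<eta>" "bd_poly \<eta>'" "bd_poly \<mu>" "\<And>F x. F \<in> B \<Longrightarrow> x \<in> F \<Longrightarrow> \<xi> F x = a * \<eta> F x + \<eta>' F x"
  shows "ip_bd B \<xi> \<mu> = a * ip_bd B \<eta> \<mu> + ip_bd B \<eta>' \<mu>"
proof -
  have "ip_bd B \<xi> \<mu> = ip_bd B (\<lambda>F x. a * \<eta> F x + \<eta>' F x) \<mu>" using assms(4) by (rule ip_bd_cong) auto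
  also have "\<dots> = (\<Sum>F\<in>B. a * (\<integral>x. \<eta> F x * \<mu> F x \<partial>surface_measure F) + (\<integral>x. \<eta>' F x * \<mu> F x \<partial>surface_measure F))"
    unfolding ip_bd_def
  proof (rule sum.cong[OF refl])
    fix F assume F: "F \<in> B"
    show "(\<integral>x. (a * \<eta> F x + \<eta>' F x) * \<mu> F x \<partial>surface_measure F) = 
       a * (\<integral>x. \<eta> F x * \<mu> F x \<partial>surface_measure F) + (\<integral>x. \<eta>' F x * \<mu> F x \<partial>surface_measure F)"
      using bd_poly_integrable[OF assms(1,3) F] bd_poly_integrable[OF assms(2,3) F] by (simp add: distrib_right mult.assoc)
  qed
  finally show ?thesis by (simp add: ip_bd_def sum.distrib sum_distrib_left)
qed

lemma ip_bd_lin_right: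
  assumes "bd_poly \<eta>" "bd_poly \<eta>'" "bd_poly \<mu>" "\<And>F x. F \<in> B \<Longrightarrow> x \<in> F \<Longrightarrow> \<xi> F x = a * \<eta> F x + \<eta>' F x"
  shows "ip_bd B \<mu> \<xi> = a * ip_bd B \<mu> \<eta> + ip_bd B \<mu> \<eta>'"
  using ip_bd_lin[OF assms] by (simp add: ip_bd_commute)

lemma ip_bd_pos: "ip_bd B \<eta> \<eta> \<ge> 0"
  unfolding ip_bd_def by (intro sum_nonneg Bochner_Integration.integral_nonneg) auto

lemma ip_bd_definite:
  assumes "bd_poly \<eta>" "ip_bd B \<eta> \<eta> = 0" "F \<in> B" "x \<in> F"
  shows "\<eta> F x = 0"
proof -
  have "(\<integral>x. \<eta> F x * \<eta> F x \<partial>surface_measure F) = 0"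
    using assms(2,3) finB unfolding ip_bd_def by (subst (asm) sum_nonneg_eq_0_iff) auto
  moreover obtain m v where v: "v \<in> cell_polys m" "\<forall>x\<in>F. \<eta> F x = v x" using assms(1,3) unfolding bd_poly_def by meson
  moreover have "(\<integral>x. \<eta> F x * \<eta> F x \<partial>surface_measure F) = (\<integral>x. v x * v x \<partial>surface_measure F)"
    using v(2) space_face[OF assms(3)] by (intro Bochner_Integration.integral_cong) auto
  ultimately show ?thesis using zero_face[OF assms(3) v(1) _ assms(4)] assms(4) by simp
qed

text \<open>Coefficients are indexed by a face and a multi-index in all d variables. They are
  redundant on a face, so the form can be degenerate on coefficients while it is definite on
  functions, which gives uniqueness.\<close>

lemma riesz_bd_space:
  assumes llin: "\<And>a \<eta> \<mu>. \<eta> \<in> bd_space m B \<Longrightarrow> \<mu> \<in> bd_space m B \<Longrightarrow>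
      L (bd_restrict (\<lambda>F x. a * \<eta> F x + \<mu> F x)) = a * L \<eta> + L \<mu>"
  shows "\<exists>!\<nu>. \<nu> \<in> bd_space m B \<and> (\<forall>\<mu>\<in>bd_space m B. ip_bd B \<nu> \<mu> = L \<mu>)"
proof -
  obtain I where I: "finite I" "cell_polys m = range (\<lambda>c (x::real^'d). \<Sum>\<alpha>\<in>I. c \<alpha> * (\<Prod>i\<in>UNIV. x $ i ^ \<alpha> i))"
    using cell_polys_parametrization[where 'd = 'd] by blast
  define \<psi> where "\<psi> = (\<lambda>c (x::real^'d). \<Sum>\<alpha>\<in>I. c \<alpha> * (\<Prod>i\<in>UNIV. x $ i ^ \<alpha> i) :: real)"
  define \<phi> where "\<phi> c = bd_restrict (\<lambda>F. \<psi> (\<lambda>\<alpha>. c (F, \<alpha>)))" for c :: "(real^'d) set \<times> ('d \<Rightarrow> nat) \<Rightarrow> real"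
  have \<psi>: "\<psi> (\<lambda>\<alpha>. a * c \<alpha> + c' \<alpha>) = (\<lambda>x. a * \<psi> c x + \<psi> c' x)" for a c c'
    by (simp add: \<psi>_def fun_eq_iff sum.distrib sum_distrib_left distrib_right mult.assoc)
  have \<psi>_range: "cell_polys m = range \<psi>" unfolding I(2) \<psi>_def ..
  have \<phi>_mem: "\<phi> c \<in> bd_space m B" for c
    unfolding \<phi>_def
  proof (rule bd_restrict_in_bd_space)
    show "\<exists>v\<in>cell_polys m. \<forall>x\<in>F. \<psi> (\<lambda>\<alpha>. c (F, \<alpha>)) x = v x" for F
      by (rule bexI[of _ "\<psi> (\<lambda>\<alpha>. c (F, \<alpha>))"]) (simp_all add: \<psi>_range)
  qed
  have \<phi>_range: "bd_space m B = range \<phi>"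
  proof
    show "range \<phi> \<subseteq> bd_space m B" using \<phi>_mem by blast
    show "bd_space m B \<subseteq> range \<phi>"
    proof
      fix \<mu> assume \<mu>: "\<mu> \<in> bd_space m B"
      have "\<exists>c. \<forall>x\<in>F. \<mu> F x = \<psi> c x" if "F \<in> B" for F
        using bd_space_polyE[OF \<mu> that] \<psi>_range by (metis rangeE)
      then obtain c where "\<And>F x. F \<in> B \<Longrightarrow> x \<in> F \<Longrightarrow> \<mu> F x = \<psi> (c F) x" by metis
      then have "\<mu> = \<phi> (\<lambda>(F, \<alpha>). c F \<alpha>)"
        by (intro bd_space_eqI[OF \<mu> \<phi>_mem]) (simp add: \<phi>_def)
      then show "\<mu> \<in> range \<phi>" by blast
    qed
  qed
  have \<phi>_lin: "\<phi> (\<lambda>i. a * c i + c' i) = bd_restrict (\<lambda>F x. a * \<phi> c F x + \<phi> c' F x)" for a c c'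
    by (auto simp: \<phi>_def \<psi> fun_eq_iff)
  have l0: "L (\<phi> c) = 0" if "ip_bd B (\<phi> c) (\<phi> c) = 0" for c
  proof -
    have z: "\<phi> c F x = 0" if "F \<in> B" "x \<in> F" for F x
      by (rule ip_bd_definite[OF bd_space_poly[OF \<phi>_mem] _ that]) fact
    \<comment> \<open>The family represented by a null coefficient vector is zero, hence equal to
      twice itself; linearity then forces \<open>L\<close> to vanish on it.\<close>
    have "\<phi> c = bd_restrict (\<lambda>F x. 1 * \<phi> c F x + \<phi> c F x)"
      by (rule bd_space_eqI[OF \<phi>_mem bd_space_lin[OF \<phi>_mem \<phi>_mem]]) (simp add: z)
    then have "L (\<phi> c) = 1 * L (\<phi> c) + L (\<phi> c)" using llin[OF \<phi>_mem \<phi>_mem, of 1 c c] by simp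
    then show ?thesis by simp
  qed
  have "\<exists>r\<in>range \<phi>. \<forall>q\<in>range \<phi>. ip_bd B r q = L q"
  proof (rule riesz_param[where I = "B \<times> I"])
    show "finite (B \<times> I)" using finB I(1) by simp
    show "\<phi> c = \<phi> c'" if "\<And>i. i \<in> B \<times> I \<Longrightarrow> c i = c' i" for c c'
    proof -
      have "\<psi> (\<lambda>\<alpha>. c (F, \<alpha>)) = \<psi> (\<lambda>\<alpha>. c' (F, \<alpha>))" if "F \<in> B" for F
        unfolding \<psi>_def using that \<open>\<And>i. i \<in> B \<times> I \<Longrightarrow> c i = c' i\<close> by (auto intro!: sum.cong)
      then show ?thesis unfolding \<phi>_def by (auto simp: fun_eq_iff)
    qed
    show "ip_bd B (\<phi> (\<lambda>i. a * c i + c' i)) (\<phi> e) = a * ip_bd B (\<phi> c) (\<phi> e) + ip_bd B (\<phi> c') (\<phi> e)" for a c c' e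
      by (rule ip_bd_lin[OF bd_space_poly[OF \<phi>_mem] bd_space_poly[OF \<phi>_mem] bd_space_poly[OF \<phi>_mem]])
        (simp add: \<phi>_lin)
    show "L (\<phi> (\<lambda>i. a * c i + c' i)) = a * L (\<phi> c) + L (\<phi> c')" for a c c'
      unfolding \<phi>_lin by (rule llin[OF \<phi>_mem \<phi>_mem])
  qed (auto intro: ip_bd_commute ip_bd_pos l0)
  then obtain r where r: "r \<in> bd_space m B" "\<And>q. q \<in> bd_space m B \<Longrightarrow> ip_bd B r q = L q"
    unfolding \<phi>_range by blast
  have "\<nu> = r" if \<nu>: "\<nu> \<in> bd_space m B" "\<forall>\<mu>\<in>bd_space m B. ip_bd B \<nu> \<mu> = L \<mu>" for \<nu>
  proof (rule bd_space_eqI[OF \<nu>(1) r(1)])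
    define d where "d = bd_restrict (\<lambda>F x. (-1) * r F x + \<nu> F x)"
    have d: "d \<in> bd_space m B" unfolding d_def by (rule bd_space_lin[OF r(1) \<nu>(1)])
    have "ip_bd B d d = (-1) * ip_bd B r d + ip_bd B \<nu> d"
      by (rule ip_bd_lin) (use r(1) \<nu>(1) d bd_space_poly in \<open>auto simp: d_def\<close>)
    then have "ip_bd B d d = 0" using r(2)[OF d] \<nu>(2) d by simp
    then show "\<nu> F x = r F x" if "F \<in> B" "x \<in> F" for F x
      using ip_bd_definite[OF bd_space_poly[OF d] _ that] that by (simp add: d_def)
  qed
  then show ?thesis using r by blast
qed

text \<open>Orthogonality of the error is rewritten as equality of inner products, the form in which
  \<open>riesz_bd_space\<close> gives existence and uniqueness.\<close>

lemma proj_bd: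
  assumes \<eta>: "bd_poly \<eta>"
  shows "proj_bd m B \<eta> \<in> bd_space m B"
    and "\<nu> \<in> bd_space m B \<Longrightarrow> ip_bd B (proj_bd m B \<eta>) \<nu> = ip_bd B \<eta> \<nu>"
    and "\<mu> \<in> bd_space m B \<Longrightarrow> (\<And>\<nu>. \<nu> \<in> bd_space m B \<Longrightarrow> ip_bd B \<mu> \<nu> = ip_bd B \<eta> \<nu>) \<Longrightarrow> proj_bd m B \<eta> = \<mu>"
proof -
  have eq: "ip_bd B (bd_diff B \<eta> \<mu>) \<nu> = 0 \<longleftrightarrow> ip_bd B \<mu> \<nu> = ip_bd B \<eta> \<nu>" if "\<mu> \<in> bd_space m B" "\<nu> \<in> bd_space m B" for \<mu> \<nu>
  proof -
    have "ip_bd B (bd_diff B \<eta> \<mu>) \<nu> = (-1) * ip_bd B \<mu> \<nu> + ip_bd B \<eta> \<nu>"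
      by (rule ip_bd_lin) (use that \<eta> bd_space_poly in \<open>auto simp: bd_diff_def\<close>)
    then show ?thesis by auto
  qed
  have ex1: "\<exists>!\<mu>. \<mu> \<in> bd_space m B \<and> (\<forall>\<nu>\<in>bd_space m B. ip_bd B \<mu> \<nu> = ip_bd B \<eta> \<nu>)"
    by (rule riesz_bd_space) (auto intro!: ip_bd_lin_right bd_space_poly \<eta>)
  have "proj_bd m B \<eta> = (THE \<mu>. \<mu> \<in> bd_space m B \<and> (\<forall>\<nu>\<in>bd_space m B. ip_bd B \<mu> \<nu> = ip_bd B \<eta> \<nu>))"
    unfolding proj_bd_def by (rule arg_cong[where f = The]) (use eq in \<open>auto simp: fun_eq_iff\<close>)
  then have "proj_bd m B \<eta> \<in> bd_space m B \<and> (\<forall>\<nu>\<in>bd_space m B. ip_bd B (proj_bd m B \<eta>) \<nu> = ip_bd B \<eta> \<nu>)"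
    using theI'[OF ex1] by simp
  then show *: "proj_bd m B \<eta> \<in> bd_space m B" and **: "\<nu> \<in> bd_space m B \<Longrightarrow> ip_bd B (proj_bd m B \<eta>) \<nu> = ip_bd B \<eta> \<nu>" for \<nu>
    by blast+
  show "proj_bd m B \<eta> = \<mu>" if "\<mu> \<in> bd_space m B" "\<And>\<nu>. \<nu> \<in> bd_space m B \<Longrightarrow> ip_bd B \<mu> \<nu> = ip_bd B \<eta> \<nu>"
    using ex1 * ** that by blast
qed

lemma proj_bd_lin:
  assumes "bd_poly \<eta>" "bd_poly \<mu>" "\<And>F x. F \<in> B \<Longrightarrow> x \<in> F \<Longrightarrow> \<xi> F x = a * \<eta> F x + \<mu> F x"
  shows "proj_bd m B \<xi> = bd_restrict (\<lambda>F x. a * proj_bd m B \<eta> F x + proj_bd m B \<mu> F x)"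
proof (rule proj_bd(3)[OF bd_poly_lin[OF assms]])
  show "bd_restrict (\<lambda>F x. a * proj_bd m B \<eta> F x + proj_bd m B \<mu> F x) \<in> bd_space m B"
    by (rule bd_space_lin) (rule proj_bd(1), fact)+
  fix \<nu> assume \<nu>: "\<nu> \<in> bd_space m B"
  have "ip_bd B (bd_restrict (\<lambda>F x. a * proj_bd m B \<eta> F x + proj_bd m B \<mu> F x)) \<nu> =
     a * ip_bd B (proj_bd m B \<eta>) \<nu> + ip_bd B (proj_bd m B \<mu>) \<nu>"
    by (rule ip_bd_lin[OF bd_space_poly[OF proj_bd(1)[OF assms(1)]] bd_space_poly[OF proj_bd(1)[OF assms(2)]] bd_space_poly[OF \<nu>]])
      simp
  also have "\<dots> = a * ip_bd B \<eta> \<nu> + ip_bd B \<mu> \<nu>" using assms \<nu> proj_bd(2) by simp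
  also have "\<dots> = ip_bd B \<xi> \<nu>"
    by (rule ip_bd_lin[symmetric]) (use assms \<nu> bd_space_poly in auto)
  finally show "ip_bd B (bd_restrict (\<lambda>F x. a * proj_bd m B \<eta> F x + proj_bd m B \<mu> F x)) \<nu> = ip_bd B \<xi> \<nu>" .
qed

section \<open>Inner products and projection on the cell\<close>

lemmas cell_polys_integrable = cell_polys_integrable_on[OF openT boundedT]

lemma ip_cell_lin:
  assumes "u \<in> cell_polys m" "v \<in> cell_polys l" "w \<in> cell_polys n"
  shows "ip_cell T (\<lambda>x. a * u x + v x) w = a * ip_cell T u w + ip_cell T v w"
  unfolding ip_cell_def using cell_polys_integrable[OF cell_polys_mult[OF assms(1,3)]]
    cell_polys_integrable[OF cell_polys_mult[OF assms(2,3)]] by (simp add: distrib_right mult.assoc)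

lemma ip_cell_lin_right:
  assumes "u \<in> cell_polys m" "v \<in> cell_polys l" "w \<in> cell_polys n"
  shows "ip_cell T w (\<lambda>x. a * u x + v x) = a * ip_cell T w u + ip_cell T w v"
  using ip_cell_lin[OF assms] by (simp add: ip_cell_commute)

lemma ip_cell_pos: "ip_cell T u u \<ge> 0"
  unfolding ip_cell_def by (intro Bochner_Integration.integral_nonneg) auto

text \<open>Continuity upgrades almost everywhere on the open set to everywhere, and the identity
  theorem extends the conclusion to all \<open>x\<close>, also outside \<open>T\<close>.\<close>

lemma ip_cell_definite:
  assumes u: "u \<in> cell_polys m" and 0: "ip_cell T u u = 0"
  shows "u x = 0"
proof -
  have "AE x in lebesgue_on T. u x * u x = 0"
    using 0 unfolding ip_cell_def
    by (subst (asm) integral_nonneg_eq_0_iff_AE) (auto intro: cell_polys_integrable[OF cell_polys_mult[OF u u]])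
  then have "AE x in lebesgue. x \<in> T \<longrightarrow> u x = 0"
    using openT by (subst (asm) AE_restrict_space_iff) auto
  then have AE: "AE x in lebesgue. x \<notin> {x \<in> T. u x \<noteq> 0}" by eventually_elim simp
  have "open (T \<inter> u -` (- {0}))"
    using openT cell_polys_continuous[OF u, of T] by (intro continuous_open_preimage) auto
  moreover have "T \<inter> u -` (- {0}) = {x \<in> T. u x \<noteq> 0}" by auto
  ultimately have op: "open {x \<in> T. u x \<noteq> 0}" by simp
  then have "{x \<in> T. u x \<noteq> 0} \<in> null_sets lebesgue"
    using AE by (subst AE_iff_null_sets) auto
  then have "{x \<in> T. u x \<noteq> 0} = {}" using op open_not_negligible negligible_iff_null_sets by metis
  then have z: "u x = 0" if "x \<in> T" for x using that by blast
  obtain x0 e where e: "e > 0" "ball x0 e \<subseteq> T" using openT nonemptyT open_contains_ball by blast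
  show ?thesis
    by (rule cell_polys_zero_on_relopen[where x = x0 and e = e, OF u affine_UNIV UNIV_I UNIV_I]) (use z e in auto)
qed

lemma ip_cell_vec_eq:
  assumes "u \<in> cell_polys m" "v \<in> cell_polys l"
  shows "ip_cell_vec T (grad u) (grad v) = (\<Sum>i\<in>UNIV. ip_cell T (\<lambda>x. grad u x $ i) (\<lambda>x. grad v x $ i))"
  unfolding ip_cell_vec_def ip_cell_def inner_vec_def inner_real_def
  using cell_polys_integrable[OF cell_polys_mult[OF grad_cell_polys[OF assms(1)] grad_cell_polys[OF assms(2)]]]
  by (intro Bochner_Integration.integral_sum) auto

lemma ip_cell_vec_commute: "ip_cell_vec T U V = ip_cell_vec T V U"
  by (simp add: ip_cell_vec_def inner_commute)

lemma ip_cell_vec_lin: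
  assumes "u \<in> cell_polys m" "v \<in> cell_polys l" "w \<in> cell_polys n"
  shows "ip_cell_vec T (grad (\<lambda>x. a * u x + v x)) (grad w) =
    a * ip_cell_vec T (grad u) (grad w) + ip_cell_vec T (grad v) (grad w)"
proof -
  have "(\<lambda>x. a * u x + v x) \<in> cell_polys (max m l)"
    by (intro cell_polys_lin cell_polys_mono[OF max.cobounded1 assms(1)] cell_polys_mono[OF max.cobounded2 assms(2)])
  from ip_cell_vec_eq[OF this assms(3)] show ?thesis
    unfolding ip_cell_vec_eq[OF assms(1,3)] ip_cell_vec_eq[OF assms(2,3)] grad_lin[OF assms(1,2)]
    using ip_cell_lin[OF grad_cell_polys[OF assms(1)] grad_cell_polys[OF assms(2)] grad_cell_polys[OF assms(3)]]
    by (simp add: sum.distrib sum_distrib_left)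
qed

text \<open>The gradient vanishes on the whole space and not only on \<open>T\<close>, so one
  constant serves even if \<open>T\<close> has several components.\<close>

lemma ip_cell_vec_definite:
  assumes u: "u \<in> cell_polys m" and 0: "ip_cell_vec T (grad u) (grad u) = 0"
  shows "\<exists>c. \<forall>x. u x = c"
proof -
  have "(\<Sum>i\<in>UNIV. ip_cell T (\<lambda>x. grad u x $ i) (\<lambda>x. grad u x $ i)) = 0"
    using 0 ip_cell_vec_eq[OF u u] by simp
  then have "ip_cell T (\<lambda>x. grad u x $ i) (\<lambda>x. grad u x $ i) = 0" for i
    by (subst (asm) sum_nonneg_eq_0_iff) (auto intro: ip_cell_pos)
  then have "grad u x $ i = 0" for x i
    by (rule ip_cell_definite[OF grad_cell_polys[OF u]])
  then have "grad u x = 0" for x by (simp add: vec_eq_iff)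
  then have "(u has_derivative (\<lambda>h. 0)) (at x)" for x
    using GDERIV_grad[OF u, of x] by (simp add: gderiv_def)
  then show ?thesis using has_derivative_zero_constant[of UNIV u] by auto
qed

lemma proj_cell:
  assumes u: "u \<in> cell_polys n"
  shows "proj_cell m T u \<in> cell_polys m"
    and "q \<in> cell_polys m \<Longrightarrow> ip_cell T (proj_cell m T u) q = ip_cell T u q"
    and "p \<in> cell_polys m \<Longrightarrow> (\<And>q. q \<in> cell_polys m \<Longrightarrow> ip_cell T p q = ip_cell T u q) \<Longrightarrow> proj_cell m T u = p"
proof -
  have eq: "ip_cell T (\<lambda>x. u x - p x) q = 0 \<longleftrightarrow> ip_cell T p q = ip_cell T u q" if "p \<in> cell_polys m" "q \<in> cell_polys m" for p q
    using ip_cell_lin[OF that(1) u that(2), of "-1"] by auto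
  have "\<exists>p\<in>cell_polys m. \<forall>q\<in>cell_polys m. ip_cell T p q = ip_cell T u q"
  proof (rule riesz_cell_polys)
    show "ip_cell T u w = 0" if "w \<in> cell_polys m" "ip_cell T w w = 0" for w
      using ip_cell_definite[OF that] by (simp add: ip_cell_def)
  qed (use ip_cell_lin ip_cell_lin_right u in \<open>auto intro: ip_cell_commute ip_cell_pos\<close>)
  then obtain p where p: "p \<in> cell_polys m" "\<And>q. q \<in> cell_polys m \<Longrightarrow> ip_cell T p q = ip_cell T u q" by blast
  have uniq: "p' = p" if p': "p' \<in> cell_polys m" "\<And>q. q \<in> cell_polys m \<Longrightarrow> ip_cell T p' q = ip_cell T u q" for p'
  proof -
    have d: "(\<lambda>x. (-1) * p x + p' x) \<in> cell_polys m" by (rule cell_polys_lin[OF p(1) p'(1)])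
    have "ip_cell T (\<lambda>x. (-1) * p x + p' x) (\<lambda>x. (-1) * p x + p' x) = 0"
      using ip_cell_lin[OF p(1) p'(1) d, of "-1"] p(2)[OF d] p'(2)[OF d] by simp
    from ip_cell_definite[OF d this] show ?thesis by (simp add: fun_eq_iff)
  qed
  have "proj_cell m T u = (THE p. p \<in> cell_polys m \<and> (\<forall>q\<in>cell_polys m. ip_cell T p q = ip_cell T u q))"
    unfolding proj_cell_def by (rule arg_cong[where f = The]) (use eq in \<open>auto simp: fun_eq_iff\<close>)
  also have "\<dots> = p" by (rule the_equality) (use p uniq in blast)+
  finally have "proj_cell m T u = p" .
  note eq = this
  show "proj_cell m T u \<in> cell_polys m" unfolding eq by (rule p(1))
  show "ip_cell T (proj_cell m T u) q = ip_cell T u q" if "q \<in> cell_polys m" for q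
    unfolding eq using that by (rule p(2))
  show "proj_cell m T u = p'" if "p' \<in> cell_polys m" "\<And>q. q \<in> cell_polys m \<Longrightarrow> ip_cell T p' q = ip_cell T u q" for p'
    unfolding eq using uniq[OF that] by simp
qed

lemma proj_cell_lin:
  assumes "u \<in> cell_polys n" "v \<in> cell_polys n"
  shows "proj_cell m T (\<lambda>x. a * u x + v x) = (\<lambda>x. a * proj_cell m T u x + proj_cell m T v x)"
proof (rule proj_cell(3)[OF cell_polys_lin[OF assms]])
  show "(\<lambda>x. a * proj_cell m T u x + proj_cell m T v x) \<in> cell_polys m"
    by (intro cell_polys_lin proj_cell(1)[OF assms(1)] proj_cell(1)[OF assms(2)])
  fix q :: "real^'d \<Rightarrow> real" assume q: "q \<in> cell_polys m"
  show "ip_cell T (\<lambda>x. a * proj_cell m T u x + proj_cell m T v x) q = ip_cell T (\<lambda>x. a * u x + v x) q"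
    using ip_cell_lin[OF proj_cell(1)[OF assms(1)] proj_cell(1)[OF assms(2)] q] ip_cell_lin[OF assms q]
      proj_cell(2)[OF assms(1) q] proj_cell(2)[OF assms(2) q] by simp
qed

lemma proj_cell_id: "u \<in> cell_polys m \<Longrightarrow> proj_cell m T u = u"
  by (rule proj_cell(3)) auto

lemma normal_deriv_in_bd_space: "q \<in> cell_polys (Suc m) \<Longrightarrow> normal_deriv T B q \<in> bd_space m B"
proof -
  assume q: "q \<in> cell_polys (Suc m)"
  have "(\<lambda>x. n \<bullet> grad q x) \<in> cell_polys m" for n
    unfolding inner_vec_def using grad_cell_polys[OF q] by (intro cell_polys_sum) (simp add: cell_polys_cmult)
  note n = this
  show ?thesis unfolding normal_deriv_def
  proof (rule bd_restrict_in_bd_space)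
    show "\<exists>v\<in>cell_polys m. \<forall>x\<in>F. face_normal T F \<bullet> grad q x = v x" for F
      by (rule bexI[OF _ n[of "face_normal T F"]]) simp
  qed
qed

lemma normal_deriv_poly: "q \<in> cell_polys m \<Longrightarrow> bd_poly (normal_deriv T B q)"
  using normal_deriv_in_bd_space[of q m] bd_space_poly cell_polys_mono[of m "Suc m" q] by simp

lemma bd_trace_in_bd_space: "v \<in> cell_polys m \<Longrightarrow> bd_trace B v \<in> bd_space m B"
  unfolding bd_trace_def by (intro bd_restrict_in_bd_space bexI[of _ v]) auto

lemma bd_diff_in_bd_space: "\<eta> \<in> bd_space m B \<Longrightarrow> \<mu> \<in> bd_space m B \<Longrightarrow> bd_diff B \<eta> \<mu> \<in> bd_space m B"
  using bd_space_lin[of \<mu> m \<eta> "-1"] by (simp add: bd_diff_def)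

section \<open>Reconstruction\<close>

text \<open>Tests against all polynomials instead of those with zero mean. Both sides vanish on
  constants, so nothing is lost, and a reconstruction can itself serve as a test function.\<close>

definition is_recon :: "(real^'d \<Rightarrow> real) \<Rightarrow> 'd face_family \<Rightarrow> (real^'d \<Rightarrow> real) \<Rightarrow> bool" where
  "is_recon v \<mu> r \<longleftrightarrow> r \<in> cell_polys (k + 1) \<and>
     (\<forall>q\<in>cell_polys (k + 1). ip_cell_vec T (grad r) (grad q) =
          - ip_cell T v (laplacian q) + ip_bd B \<mu> (normal_deriv T B q)) \<and>
     ip_cell T r (\<lambda>x. 1) = ip_cell T v (\<lambda>x. 1)"

lemma volume_nonzero: "ip_cell T (\<lambda>x. 1) (\<lambda>x. 1) \<noteq> 0"
  using ip_cell_definite[OF cell_polys_const[of 1 0]] by auto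

lemma recon_rhs_lin:
  assumes "v \<in> cell_polys m" "bd_poly \<mu>" "p \<in> cell_polys l" "q \<in> cell_polys l"
  shows "- ip_cell T v (laplacian (\<lambda>x. a * p x + q x)) + ip_bd B \<mu> (normal_deriv T B (\<lambda>x. a * p x + q x)) =
    a * (- ip_cell T v (laplacian p) + ip_bd B \<mu> (normal_deriv T B p)) +
      (- ip_cell T v (laplacian q) + ip_bd B \<mu> (normal_deriv T B q))"
proof -
  have "ip_cell T v (laplacian (\<lambda>x. a * p x + q x)) = a * ip_cell T v (laplacian p) + ip_cell T v (laplacian q)"
    unfolding laplacian_lin[OF assms(3,4)]
    by (rule ip_cell_lin_right[OF laplacian_cell_polys[OF assms(3)] laplacian_cell_polys[OF assms(4)] assms(1)])
  moreover have "ip_bd B \<mu> (normal_deriv T B (\<lambda>x. a * p x + q x)) =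
      a * ip_bd B \<mu> (normal_deriv T B p) + ip_bd B \<mu> (normal_deriv T B q)"
    by (rule ip_bd_lin_right[OF normal_deriv_poly[OF assms(3)] normal_deriv_poly[OF assms(4)] assms(2)])
      (simp add: normal_deriv_def grad_lin[OF assms(3,4)] inner_add_right)
  ultimately show ?thesis by (simp add: algebra_simps)
qed

lemma recon_rhs_const:
  "ip_cell T v (laplacian (\<lambda>x. c)) = 0" "ip_bd B \<mu> (normal_deriv T B (\<lambda>x. c)) = 0"
  "ip_cell_vec T U (grad (\<lambda>x. c)) = 0"
proof -
  show "ip_cell T v (laplacian (\<lambda>x. c)) = 0" by (simp add: laplacian_def[abs_def] grad_const ip_cell_def)
  show "ip_cell_vec T U (grad (\<lambda>x. c)) = 0" by (simp add: ip_cell_vec_def grad_const)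
  have "ip_bd B \<mu> (normal_deriv T B (\<lambda>x. c)) = ip_bd B \<mu> (\<lambda>F x. 0)"
    by (rule ip_bd_cong) (auto simp: normal_deriv_def grad_const)
  then show "ip_bd B \<mu> (normal_deriv T B (\<lambda>x. c)) = 0" by (simp add: ip_bd_def)
qed

text \<open>The difference of two candidates has zero mean, so it may be tested against itself; it
  is then constant, and the constant is zero.\<close>

lemma recon_eqI:
  assumes v: "v \<in> cell_polys m" and \<mu>: "bd_poly \<mu>" and r: "is_recon v \<mu> r"
  shows "recon k T B (v, \<mu>) = r"
  unfolding recon_def fst_conv snd_conv
proof (rule the_equality)
  show "r \<in> cell_polys (k + 1) \<and> (\<forall>q\<in>cell_polys (k + 1). ip_cell T q (\<lambda>x. 1) = 0 \<longrightarrow>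
      ip_cell_vec T (grad r) (grad q) = - ip_cell T v (laplacian q) + ip_bd B \<mu> (normal_deriv T B q)) \<and>
      ip_cell T r (\<lambda>x. 1) = ip_cell T v (\<lambda>x. 1)" using r unfolding is_recon_def by blast
  fix s assume s: "s \<in> cell_polys (k + 1) \<and> (\<forall>q\<in>cell_polys (k + 1). ip_cell T q (\<lambda>x. 1) = 0 \<longrightarrow>
      ip_cell_vec T (grad s) (grad q) = - ip_cell T v (laplacian q) + ip_bd B \<mu> (normal_deriv T B q)) \<and>
      ip_cell T s (\<lambda>x. 1) = ip_cell T v (\<lambda>x. 1)"
  have rk: "r \<in> cell_polys (k + 1)" and sk: "s \<in> cell_polys (k + 1)" using r s by (auto simp: is_recon_def)
  define d where "d = (\<lambda>x. (-1) * r x + s x)"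
  have d: "d \<in> cell_polys (k + 1)" unfolding d_def by (rule cell_polys_lin[OF rk sk])
  have d1: "ip_cell T d (\<lambda>x. 1) = 0"
    unfolding d_def ip_cell_lin[OF rk sk cell_polys_const[of 1 0]] using r s by (simp add: is_recon_def)
  have "ip_cell_vec T (grad d) (grad d) = (-1) * ip_cell_vec T (grad r) (grad d) + ip_cell_vec T (grad s) (grad d)"
    using ip_cell_vec_lin[OF rk sk d, of "-1"] by (simp add: d_def)
  then have "ip_cell_vec T (grad d) (grad d) = 0" using r s d d1 by (simp add: is_recon_def)
  then obtain c where c: "\<And>x. d x = c" using ip_cell_vec_definite[OF d] by blast
  then have "d = (\<lambda>x. c * 1 + 0)" by auto
  then have "c * ip_cell T (\<lambda>x. 1) (\<lambda>x. 1) = 0"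
    using d1 ip_cell_lin[OF cell_polys_const[of 1 0] cell_polys_const[of 0 0] cell_polys_const[of 1 0], of c] 
    by (auto simp: ip_cell_def)
  then have "c = 0" using volume_nonzero by simp
  then show "s = r" using c by (auto simp: d_def fun_eq_iff)
qed

lemma is_recon_recon:
  assumes v: "v \<in> cell_polys m" and \<mu>: "bd_poly \<mu>"
  shows "is_recon v \<mu> (recon k T B (v, \<mu>))"
proof -
  \<comment> \<open>The product of the means makes the gradient form definite; testing with 1
    afterwards separates the mean condition from the gradient identity.\<close>
  define bil where "bil p q = ip_cell_vec T (grad p) (grad q) + ip_cell T p (\<lambda>x. 1) * ip_cell T q (\<lambda>x. 1)" for p q
  define L where "L q = - ip_cell T v (laplacian q) + ip_bd B \<mu> (normal_deriv T B q) +
     ip_cell T v (\<lambda>x. 1) * ip_cell T q (\<lambda>x. 1)" for q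
  have one: "(\<lambda>x. 1) \<in> cell_polys 0" by (rule cell_polys_const)
  have "\<exists>r\<in>cell_polys (k + 1). \<forall>q\<in>cell_polys (k + 1). bil r q = L q"
  proof (rule riesz_cell_polys)
    show "bil (\<lambda>x. a * p x + q x) w = a * bil p w + bil q w"
      if "p \<in> cell_polys (k + 1)" "q \<in> cell_polys (k + 1)" "w \<in> cell_polys (k + 1)" for a p q w
      unfolding bil_def ip_cell_vec_lin[OF that] ip_cell_lin[OF that(1,2) one] by (simp add: algebra_simps)
    show "bil p q = bil q p" for p q by (simp add: bil_def ip_cell_vec_commute mult.commute)
    have nn: "ip_cell_vec T (grad p) (grad p) \<ge> 0" for p
      unfolding ip_cell_vec_def by (intro Bochner_Integration.integral_nonneg) auto
    show "bil p p \<ge> 0" for p using nn by (simp add: bil_def)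
    show "L (\<lambda>x. a * p x + q x) = a * L p + L q" if "p \<in> cell_polys (k + 1)" "q \<in> cell_polys (k + 1)" for a p q
      unfolding L_def recon_rhs_lin[OF v \<mu> that] ip_cell_lin[OF that one] by (simp add: algebra_simps)
    show "L q = 0" if q: "q \<in> cell_polys (k + 1)" and 0: "bil q q = 0" for q
    proof -
      have "ip_cell_vec T (grad q) (grad q) = 0 \<and> ip_cell T q (\<lambda>x. 1) * ip_cell T q (\<lambda>x. 1) = 0"
        using 0 nn[of q] zero_le_square[of "ip_cell T q (\<lambda>x. 1)"] unfolding bil_def by linarith
      moreover from this obtain c where "\<And>x. q x = c" using ip_cell_vec_definite[OF q] by blast
      then have "q = (\<lambda>x. c)" by auto
      ultimately show ?thesis by (simp add: L_def recon_rhs_const)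
    qed
  qed
  then obtain r where r: "r \<in> cell_polys (k + 1)" "\<And>q. q \<in> cell_polys (k + 1) \<Longrightarrow> bil r q = L q" by blast
  have mean: "ip_cell T r (\<lambda>x. 1) = ip_cell T v (\<lambda>x. 1)"
    using r(2)[OF cell_polys_const[of 1]] volume_nonzero by (simp add: bil_def L_def recon_rhs_const)
  then have "is_recon v \<mu> r" using r unfolding is_recon_def bil_def L_def by simp
  then show ?thesis using recon_eqI[OF v \<mu>] by simp
qed

lemma recon_in_cell_polys: "v \<in> cell_polys m \<Longrightarrow> bd_poly \<mu> \<Longrightarrow> recon k T B (v, \<mu>) \<in> cell_polys (k + 1)"
  using is_recon_recon unfolding is_recon_def by blast

lemma recon_lin:
  assumes "v \<in> cell_polys m" "w \<in> cell_polys m" "bd_poly \<eta>" "bd_poly \<mu>"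
    and "\<And>F x. F \<in> B \<Longrightarrow> x \<in> F \<Longrightarrow> \<xi> F x = a * \<eta> F x + \<mu> F x"
  shows "recon k T B (\<lambda>x. a * v x + w x, \<xi>) = (\<lambda>x. a * recon k T B (v, \<eta>) x + recon k T B (w, \<mu>) x)"
proof (rule recon_eqI[OF cell_polys_lin[OF assms(1,2)] bd_poly_lin[OF assms(3-5)]])
  let ?r = "recon k T B (v, \<eta>)" and ?s = "recon k T B (w, \<mu>)"
  have r: "is_recon v \<eta> ?r" and s: "is_recon w \<mu> ?s" using is_recon_recon assms by blast+
  then have rk: "?r \<in> cell_polys (k + 1)" and sk: "?s \<in> cell_polys (k + 1)" by (auto simp: is_recon_def)
  show "is_recon (\<lambda>x. a * v x + w x) \<xi> (\<lambda>x. a * ?r x + ?s x)"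
    unfolding is_recon_def
  proof (intro conjI ballI)
    show "(\<lambda>x. a * ?r x + ?s x) \<in> cell_polys (k + 1)" by (rule cell_polys_lin[OF rk sk])
    show "ip_cell T (\<lambda>x. a * ?r x + ?s x) (\<lambda>x. 1) = ip_cell T (\<lambda>x. a * v x + w x) (\<lambda>x. 1)"
      unfolding ip_cell_lin[OF rk sk cell_polys_const[of 1 0]] ip_cell_lin[OF assms(1,2) cell_polys_const[of 1 0]]
      using r s by (simp add: is_recon_def)
    fix q :: "real^'d \<Rightarrow> real" assume q: "q \<in> cell_polys (k + 1)"
    have "ip_bd B \<xi> (normal_deriv T B q) = a * ip_bd B \<eta> (normal_deriv T B q) + ip_bd B \<mu> (normal_deriv T B q)"
      by (rule ip_bd_lin[OF assms(3,4) normal_deriv_poly[OF q] assms(5)])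
    then show "ip_cell_vec T (grad (\<lambda>x. a * ?r x + ?s x)) (grad q) =
        - ip_cell T (\<lambda>x. a * v x + w x) (laplacian q) + ip_bd B \<xi> (normal_deriv T B q)"
      unfolding ip_cell_vec_lin[OF rk sk q] ip_cell_lin[OF assms(1,2) laplacian_cell_polys[OF q]]
    proof -
      assume b: "ip_bd B \<xi> (normal_deriv T B q) = a * ip_bd B \<eta> (normal_deriv T B q) + ip_bd B \<mu> (normal_deriv T B q)"
      have e: "ip_cell_vec T (grad ?r) (grad q) = - ip_cell T v (laplacian q) + ip_bd B \<eta> (normal_deriv T B q)"
        "ip_cell_vec T (grad ?s) (grad q) = - ip_cell T w (laplacian q) + ip_bd B \<mu> (normal_deriv T B q)"
        using r s q unfolding is_recon_def by blast+
      then show "a * ip_cell_vec T (grad ?r) (grad q) + ip_cell_vec T (grad ?s) (grad q) =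
          - (a * ip_cell T v (laplacian q) + ip_cell T w (laplacian q)) + ip_bd B \<xi> (normal_deriv T B q)"
        unfolding b e by (simp add: algebra_simps)
    qed
  qed
qed

lemma parts_trace:
  assumes "v \<in> cell_polys m" "q \<in> cell_polys l"
  shows "ip_cell_vec T (grad v) (grad q) = - ip_cell T v (laplacian q) + ip_bd B (bd_trace B v) (normal_deriv T B q)"
proof -
  have "ip_bd B (bd_trace B v) (normal_deriv T B q) = ip_bd B (\<lambda>F. v) (\<lambda>F x. face_normal T F \<bullet> grad q x)"
    by (rule ip_bd_cong) (auto simp: bd_trace_def normal_deriv_def)
  then show ?thesis using parts[OF assms] by (simp add: ip_bd_def)
qed

lemma recon_trace:
  assumes v: "v \<in> cell_polys k" shows "recon k T B (v, bd_trace B v) = v"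
  by (rule recon_eqI[OF v bd_space_poly[OF bd_trace_in_bd_space[OF v]]])
    (use v in \<open>auto simp: is_recon_def parts_trace[OF v] intro: cell_polys_mono[of k "Suc k"]\<close>)

lemma zero_poly: "(\<lambda>x. 0) \<in> cell_polys m" by (rule cell_polys_const)

section \<open>Stabilization and numerical flux\<close>

lemma recon_fluct_poly:
  assumes "v \<in> cell_polys m" "bd_poly \<mu>"
  shows "recon_fluct k T B (v, \<mu>) \<in> cell_polys (k + 1)"
proof -
  have r: "recon k T B (v, \<mu>) \<in> cell_polys (k + 1)" by (rule recon_in_cell_polys[OF assms])
  have "proj_cell k T (recon k T B (v, \<mu>)) \<in> cell_polys (k + 1)"
    by (rule cell_polys_mono[OF _ proj_cell(1)[OF r]]) simp
  from cell_polys_diff[OF r this] show ?thesis by (simp add: recon_fluct_def)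
qed

text \<open>\<open>(v, \<mu>)\<close> is \<open>(v, bd_trace B v)\<close> minus the pair with zero
  cell part and the trace difference on the boundary. The former is reconstructed as
  \<open>v\<close>, whose fluctuation is zero since its degree is at most \<open>k\<close>.\<close>

lemma recon_fluct_split:
  assumes v: "v \<in> cell_polys k" and \<mu>: "\<mu> \<in> bd_space k B"
  shows "recon_fluct k T B (v, \<mu>) x = - recon_fluct k T B (\<lambda>x. 0, bd_diff B (bd_trace B v) \<mu>) x"
proof -
  define \<delta> where "\<delta> = bd_diff B (bd_trace B v) \<mu>"
  have \<delta>: "\<delta> \<in> bd_space k B" unfolding \<delta>_def by (intro bd_diff_in_bd_space bd_trace_in_bd_space v \<mu>)
  define R0 where "R0 = recon k T B (\<lambda>x. 0, \<delta>)"
  have R0: "R0 \<in> cell_polys (k + 1)" unfolding R0_def by (rule recon_in_cell_polys[OF zero_poly bd_space_poly[OF \<delta>]])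
  have vk: "v \<in> cell_polys (k + 1)" by (rule cell_polys_mono[OF _ v]) simp
  have "recon k T B (\<lambda>x. (-1) * 0 + v x, \<mu>) = (\<lambda>x. (-1) * R0 x + recon k T B (v, bd_trace B v) x)"
    unfolding R0_def
    by (rule recon_lin[OF zero_poly v]) (use \<delta> bd_trace_in_bd_space[OF v] bd_space_poly in \<open>auto simp: \<delta>_def bd_diff_def bd_trace_def\<close>)
  then have R: "recon k T B (v, \<mu>) = (\<lambda>x. (-1) * R0 x + v x)" using recon_trace[OF v] by simp
  show ?thesis
    unfolding recon_fluct_def R proj_cell_lin[OF R0 vk] proj_cell_id[OF v] 
    by (simp add: R0_def \<delta>_def)
qed

lemma stab_eq_stab_tilde:
  assumes v: "v \<in> cell_polys k" and \<mu>: "\<mu> \<in> bd_space k B"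
  shows "stab k T B (v, \<mu>) = stab_tilde k T B (bd_diff B (bd_trace B v) \<mu>)"
  unfolding stab_def stab_tilde_def
  by (rule arg_cong[where f = "proj_bd k B"])
    (auto simp: fun_eq_iff bd_diff_def bd_trace_def recon_fluct_split[OF v \<mu>])

lemma stab_tilde_arg_poly:
  "\<mu> \<in> bd_space k B \<Longrightarrow> bd_poly (bd_diff B \<mu> (bd_trace B (recon_fluct k T B (\<lambda>x. 0, \<mu>))))"
  by (rule bd_poly_lin[where a = "-1", OF bd_space_poly[OF bd_trace_in_bd_space[OF recon_fluct_poly[OF zero_poly bd_space_poly]]] bd_space_poly])
    (auto simp: bd_diff_def)

lemma stab_tilde_in_bd_space: "\<mu> \<in> bd_space k B \<Longrightarrow> stab_tilde k T B \<mu> \<in> bd_space k B"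
  unfolding stab_tilde_def by (intro proj_bd(1) stab_tilde_arg_poly)

lemma stab_tilde_lin:
  assumes \<eta>: "\<eta> \<in> bd_space k B" and \<mu>: "\<mu> \<in> bd_space k B"
  shows "stab_tilde k T B (bd_restrict (\<lambda>F x. a * \<eta> F x + \<mu> F x)) =
    bd_restrict (\<lambda>F x. a * stab_tilde k T B \<eta> F x + stab_tilde k T B \<mu> F x)"
  unfolding stab_tilde_def
proof (rule proj_bd_lin[OF stab_tilde_arg_poly[OF \<eta>] stab_tilde_arg_poly[OF \<mu>]])
  define \<xi> where "\<xi> = bd_restrict (\<lambda>F x. a * \<eta> F x + \<mu> F x)"
  have p: "bd_poly \<eta>" "bd_poly \<mu>" using \<eta> \<mu> bd_space_poly by auto
  have "recon k T B (\<lambda>x. a * 0 + 0, \<xi>) = (\<lambda>x. a * recon k T B (\<lambda>x. 0, \<eta>) x + recon k T B (\<lambda>x. 0, \<mu>) x)"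
    by (rule recon_lin[OF zero_poly zero_poly p]) (simp add: \<xi>_def)
  then have R: "recon k T B (\<lambda>x. 0, \<xi>) = (\<lambda>x. a * recon k T B (\<lambda>x. 0, \<eta>) x + recon k T B (\<lambda>x. 0, \<mu>) x)" by simp
  have "recon_fluct k T B (\<lambda>x. 0, \<xi>) x = a * recon_fluct k T B (\<lambda>x. 0, \<eta>) x + recon_fluct k T B (\<lambda>x. 0, \<mu>) x" for x
    unfolding recon_fluct_def R
      proj_cell_lin[OF recon_in_cell_polys[OF zero_poly p(1)] recon_in_cell_polys[OF zero_poly p(2)]]
    by (simp add: algebra_simps)
  then show "bd_diff B \<xi> (bd_trace B (recon_fluct k T B (\<lambda>x. 0, \<xi>))) F x =
      a * bd_diff B \<eta> (bd_trace B (recon_fluct k T B (\<lambda>x. 0, \<eta>))) F x +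
      bd_diff B \<mu> (bd_trace B (recon_fluct k T B (\<lambda>x. 0, \<mu>))) F x" if "F \<in> B" "x \<in> F" for F x
    using that by (simp add: bd_diff_def bd_trace_def \<xi>_def algebra_simps)
qed

lemma stab_tilde_adj:
  assumes \<eta>: "\<eta> \<in> bd_space k B"
  shows "stab_tilde_adj k T B \<eta> \<in> bd_space k B"
    and "\<mu> \<in> bd_space k B \<Longrightarrow> ip_bd B (stab_tilde_adj k T B \<eta>) \<mu> = ip_bd B \<eta> (stab_tilde k T B \<mu>)"
proof -
  have "\<exists>!\<nu>. \<nu> \<in> bd_space k B \<and> (\<forall>\<mu>\<in>bd_space k B. ip_bd B \<nu> \<mu> = ip_bd B \<eta> (stab_tilde k T B \<mu>))"
    by (rule riesz_bd_space, rule ip_bd_lin_right) 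
      (auto intro!: bd_space_poly[OF stab_tilde_in_bd_space] bd_space_poly[OF \<eta>] simp: stab_tilde_lin)
  from theI'[OF this] show "stab_tilde_adj k T B \<eta> \<in> bd_space k B"
    "\<mu> \<in> bd_space k B \<Longrightarrow> ip_bd B (stab_tilde_adj k T B \<eta>) \<mu> = ip_bd B \<eta> (stab_tilde k T B \<mu>)"
    unfolding stab_tilde_adj_def by blast+
qed

lemma num_flux_in_bd_space:
  assumes v: "v \<in> cell_polys k" and \<mu>: "\<mu> \<in> bd_space k B"
  shows "num_flux k T B (v, \<mu>) \<in> bd_space k B"
proof -
  define A where "A = stab_tilde_adj k T B (stab_tilde k T B (bd_diff B (bd_trace B v) \<mu>))"
  have A: "A \<in> bd_space k B" unfolding A_def
    by (intro stab_tilde_adj(1) stab_tilde_in_bd_space bd_diff_in_bd_space bd_trace_in_bd_space v \<mu>)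
  have N: "normal_deriv T B (recon k T B (v, \<mu>)) \<in> bd_space k B"
    using normal_deriv_in_bd_space recon_in_cell_polys[OF v bd_space_poly[OF \<mu>]] by simp
  show ?thesis unfolding num_flux_def
  proof (rule bd_restrict_in_bd_space)
    fix F assume F: "F \<in> B"
    obtain p q where "p \<in> cell_polys k" "\<And>x. x \<in> F \<Longrightarrow> normal_deriv T B (recon k T B (v, \<mu>)) F x = p x"
      "q \<in> cell_polys k" "\<And>x. x \<in> F \<Longrightarrow> A F x = q x"
      using bd_space_polyE[OF N F] bd_space_polyE[OF A F] by metis
    then show "\<exists>p\<in>cell_polys k. \<forall>x\<in>F. - normal_deriv T B (recon k T B (v, \<mu>)) F x + inverse (diameter T) *
       (stab_tilde_adj k T B \<circ> stab_tilde k T B) (bd_diff B (bd_trace B (fst (v, \<mu>))) (snd (v, \<mu>))) F x = p x"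
      by (intro bexI[of _ "\<lambda>x. inverse (diameter T) * q x + - p x"] cell_polys_lin cell_polys_uminus)
        (auto simp: A_def)
  qed
qed

text \<open>The normal derivative terms come from integrating the definition of the reconstruction of \<open>(w, \<nu>)\<close>
  by parts back onto \<open>w\<close>; the stabilization is moved onto the trace difference by the adjoint.\<close>

lemma local_identity:
  assumes u: "u \<in> cell_polys k" "\<mu> \<in> bd_space k B" and w: "w \<in> cell_polys k" "\<nu> \<in> bd_space k B"
  shows "ip_cell_vec T (grad (recon k T B (u, \<mu>))) (grad (recon k T B (w, \<nu>))) +
      inverse (diameter T) * ip_bd B (stab k T B (u, \<mu>)) (stab k T B (w, \<nu>)) =
    ip_cell_vec T (grad (recon k T B (u, \<mu>))) (grad w) +
      ip_bd B (num_flux k T B (u, \<mu>)) (bd_trace B w) - ip_bd B (num_flux k T B (u, \<mu>)) \<nu>"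
proof -
  define r where "r = recon k T B (u, \<mu>)"
  define \<delta>u where "\<delta>u = bd_diff B (bd_trace B u) \<mu>"
  define \<delta>w where "\<delta>w = bd_diff B (bd_trace B w) \<nu>"
  define A where "A = stab_tilde_adj k T B (stab_tilde k T B \<delta>u)"
  define N where "N = normal_deriv T B r"
  have \<delta>: "\<delta>u \<in> bd_space k B" "\<delta>w \<in> bd_space k B"
    unfolding \<delta>u_def \<delta>w_def by (intro bd_diff_in_bd_space bd_trace_in_bd_space u w)+
  have r: "r \<in> cell_polys (k + 1)" unfolding r_def by (rule recon_in_cell_polys[OF u(1) bd_space_poly[OF u(2)]])
  have A: "A \<in> bd_space k B" unfolding A_def by (intro stab_tilde_adj(1) stab_tilde_in_bd_space \<delta>)
  have N: "bd_poly N" unfolding N_def by (rule normal_deriv_poly[OF r])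
  have tr: "bd_trace B w \<in> bd_space k B" by (rule bd_trace_in_bd_space[OF w(1)])
  have flux: "num_flux k T B (u, \<mu>) \<in> bd_space k B" by (rule num_flux_in_bd_space[OF u])
  \<comment> \<open>The zero family fills the second summand in \<open>ip_bd_lin\<close>, which is
    stated for \<open>a * \<eta> + \<eta>'\<close>.\<close>
  have z: "bd_poly (\<lambda>F x. 0)" unfolding bd_poly_def using zero_poly by (intro ballI exI bexI[of _ "\<lambda>x. 0"]) auto
  note poly = bd_space_poly[OF A] bd_space_poly[OF tr] bd_space_poly[OF w(2)] bd_space_poly[OF \<delta>(2)] bd_space_poly[OF flux]
  have "ip_cell_vec T (grad r) (grad (recon k T B (w, \<nu>))) = ip_cell_vec T (grad (recon k T B (w, \<nu>))) (grad r)"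
    by (rule ip_cell_vec_commute)
  \<comment> \<open>Here \<open>r\<close> is the test function for the other reconstruction; its
    mean is arbitrary, which is why \<open>is_recon\<close> admits all test functions.\<close>
  also have "\<dots> = - ip_cell T w (laplacian r) + ip_bd B \<nu> N"
    using is_recon_recon[OF w(1) bd_space_poly[OF w(2)]] r unfolding is_recon_def N_def by blast
  also have "- ip_cell T w (laplacian r) = ip_cell_vec T (grad w) (grad r) - ip_bd B (bd_trace B w) N"
    using parts_trace[OF w(1) r] by (simp add: N_def)
  finally have 1: "ip_cell_vec T (grad r) (grad (recon k T B (w, \<nu>))) =
      ip_cell_vec T (grad r) (grad w) - ip_bd B (bd_trace B w) N + ip_bd B \<nu> N"
    by (simp add: ip_cell_vec_commute)
  have "ip_bd B \<delta>w N = (-1) * ip_bd B \<nu> N + ip_bd B (bd_trace B w) N"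
    by (rule ip_bd_lin[OF poly(3,2) N]) (simp add: \<delta>w_def bd_diff_def)
  then have 2: "ip_cell_vec T (grad r) (grad (recon k T B (w, \<nu>))) = ip_cell_vec T (grad r) (grad w) - ip_bd B \<delta>w N"
    using 1 by simp
  have 3: "ip_bd B (stab k T B (u, \<mu>)) (stab k T B (w, \<nu>)) = ip_bd B A \<delta>w"
    unfolding stab_eq_stab_tilde[OF u] stab_eq_stab_tilde[OF w] \<delta>u_def[symmetric] \<delta>w_def[symmetric] A_def
    by (rule stab_tilde_adj(2)[OF stab_tilde_in_bd_space[OF \<delta>(1)] \<delta>(2), symmetric])
  have "ip_bd B (num_flux k T B (u, \<mu>)) \<delta>w = (-1) * ip_bd B N \<delta>w + ip_bd B (\<lambda>F x. inverse (diameter T) * A F x + 0) \<delta>w"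
    by (rule ip_bd_lin[OF N bd_poly_lin[OF poly(1) z refl] poly(4)])
      (simp add: num_flux_def N_def A_def \<delta>u_def r_def)
  also have "ip_bd B (\<lambda>F x. inverse (diameter T) * A F x + 0) \<delta>w = inverse (diameter T) * ip_bd B A \<delta>w + ip_bd B (\<lambda>F x. 0) \<delta>w"
    by (rule ip_bd_lin[OF poly(1) z poly(4) refl])
  finally have 4: "ip_bd B (num_flux k T B (u, \<mu>)) \<delta>w = - ip_bd B \<delta>w N + inverse (diameter T) * ip_bd B A \<delta>w"
    by (simp add: ip_bd_commute[of B N] ip_bd_def[of B "\<lambda>F x. 0"])
  have "ip_bd B (num_flux k T B (u, \<mu>)) \<delta>w = (-1) * ip_bd B (num_flux k T B (u, \<mu>)) \<nu> + ip_bd B (num_flux k T B (u, \<mu>)) (bd_trace B w)"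
    by (rule ip_bd_lin_right[OF poly(3,2,5)]) (simp add: \<delta>w_def bd_diff_def)
  then show ?thesis using 2 3 4 by (simp add: r_def)
qed

end

section \<open>The global problem\<close>

context polyhedral_mesh
begin

section \<open>From the mesh to the local theory\<close>

abbreviation cfaces :: "(real^'d) set \<Rightarrow> (real^'d) set set" where "cfaces T \<equiv> cell_faces \<Omega> \<T> T"

lemma cfaces_faces: "F \<in> cfaces T \<Longrightarrow> F \<in> faces \<Omega> \<T>" by (simp add: cell_faces_def)

lemma finite_cfaces: "finite (cfaces T)"
  using finite_faces by (rule finite_subset[rotated]) (auto simp: cell_faces_def)

lemma face_unit_normal:
  assumes "F \<in> faces \<Omega> \<T>" obtains n b where "norm n = 1" "affine hull F = {x. n \<bullet> x = b}"
  using hyperplane_unit_normal[OF hypH[OF face_plane(1)[OF assms]], of 0] by blast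

lemma space_surface_measure:
  assumes F: "F \<in> faces \<Omega> \<T>" shows "space (surface_measure F) = F"
proof -
  obtain n b where n: "norm n = 1" "affine hull F = {x. n \<bullet> x = b}" using face_unit_normal[OF F] by blast
  show ?thesis unfolding surface_measure_face(1)[OF F n] by (simp add: space_restrict_space space_hyperplane_measure[OF n(1)])
qed

lemma surface_integrable:
  fixes g :: "real^'d \<Rightarrow> real"
  assumes F: "F \<in> faces \<Omega> \<T>" and g: "continuous_on UNIV g" shows "integrable (surface_measure F) g"
proof -
  obtain n b where n: "norm n = 1" "affine hull F = {x. n \<bullet> x = b}" using face_unit_normal[OF F] by blast
  show ?thesis
    unfolding surface_measure_face(1)[OF F n] integrable_restrict_space[OF surface_measure_face(2)[OF F n]]
    using hyperplane_integrable[OF F n(1) g] by simp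
qed

text \<open>Near a generic point of the face, a nonzero value would persist on a small ball of the
  plane, which has positive measure. The identity theorem then spreads the zero to the whole
  face.\<close>

lemma surface_definite:
  assumes F: "F \<in> faces \<Omega> \<T>" and v: "v \<in> cell_polys m" and 0: "(\<integral>x. v x * v x \<partial>surface_measure F) = 0" and x: "x \<in> F"
  shows "v x = 0"
proof -
  obtain n b where n: "norm n = 1" "affine hull F = {x. n \<bullet> x = b}" using face_unit_normal[OF F] by blast
  let ?\<sigma> = "hyperplane_measure n b"
  have vc: "continuous_on UNIV v" by (rule cell_polys_continuous[OF v])
  have "(\<integral>x. indicator F x * (v x * v x) \<partial>?\<sigma>) = 0" using 0 surface_integral[OF F n] by simp
  moreover have "integrable ?\<sigma> (\<lambda>x. indicator F x * (v x * v x))"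
    by (rule hyperplane_integrable[OF F n(1)]) (intro continuous_intros vc)
  ultimately have AE0: "AE x in ?\<sigma>. indicator F x * (v x * v x) = 0"
    by (subst (asm) integral_nonneg_eq_0_iff_AE) auto
  obtain y where y: "y \<in> F" "generic (affine hull F) y" using face_plane(2)[OF F] by blast
  obtain e where e: "e > 0" "ball y e \<inter> affine hull F \<subseteq> F"
    using generic_rel_interior[OF F y] unfolding mem_rel_interior_ball by blast
  have z0: "v z = 0" if z: "z \<in> ball y e \<inter> affine hull F" for z
  proof (rule ccontr)
    assume nz: "v z \<noteq> 0"
    have "open (ball y e \<inter> {x. v x \<noteq> 0})"
      using vc by (intro open_Int open_ball open_Collect_neq continuous_on_const)
    then obtain d where d: "d > 0" "ball z d \<subseteq> ball y e \<inter> {x. v x \<noteq> 0}"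
      using z nz by (metis (mono_tags, lifting) IntD1 IntI mem_Collect_eq openE)
    have gen: "AE x in ?\<sigma>. n \<bullet> x = b \<and> (\<forall>H\<in>\<H> - {{x. n \<bullet> x = b}}. x \<notin> H)"
      by (rule AE_hyperplane_measure_generic[OF n(1) finH hypH])
    have "AE x in ?\<sigma>. x \<notin> ball z d"
      using AE0 gen
    proof eventually_elim
      fix x assume x: "indicator F x * (v x * v x) = 0" "n \<bullet> x = b \<and> (\<forall>H\<in>\<H> - {{x. n \<bullet> x = b}}. x \<notin> H)"
      show "x \<notin> ball z d"
      proof
        assume "x \<in> ball z d"
        then have "x \<in> F" "v x \<noteq> 0" using d e(2) x(2) n(2) by blast+
        then show False using x(1) by simp
      qed
    qed
    then have "emeasure ?\<sigma> (ball z d) = 0"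
      by (subst (asm) AE_iff_null) (auto simp: sets_hyperplane_measure[OF n(1)] space_hyperplane_measure[OF n(1)] null_sets_def ball_def)
    moreover have "n \<bullet> z = b" using z n(2) by blast
    then have "emeasure ?\<sigma> (ball z d) > 0" by (rule hyperplane_measure_ball_pos[OF n(1) _ d(1)])
    ultimately show False by simp
  qed
  show ?thesis
    by (rule cell_polys_zero_on_relopen[OF v affine_affine_hull hull_inc[OF y(1)] hull_inc[OF x] e(1) z0])
qed

lemma gauss_cell_lebesgue:
  assumes T: "T \<in> \<T>" and p: "p \<in> cell_polys k"
  shows "(\<integral>x. grad p x $ i \<partial>lebesgue_on T) =
    (\<Sum>F\<in>cfaces T. \<integral>x. p x * face_normal T F $ i \<partial>surface_measure F)"
proof -
  have oT: "open T" using open_cell T by blast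
  have m: "(\<lambda>x. grad p x $ i) \<in> borel_measurable borel"
    using cell_polys_continuous[OF grad_cell_polys[OF p]] by (rule borel_measurable_continuous_onI)
  have "(\<integral>x. grad p x $ i \<partial>lebesgue_on T) = (\<integral>x. indicator T x * grad p x $ i \<partial>lebesgue)"
    using oT by (subst integral_restrict_space) auto
  also have "\<dots> = (\<integral>x. indicator T x * grad p x $ i \<partial>lborel)"
    using oT m by (intro integral_completion) measurable
  finally show ?thesis using gauss_cell[OF T p, of "axis i 1"] by (simp add: inner_axis)
qed

text \<open>The divergence theorem is applied to \<open>w\<close> times each partial derivative
  \<open>qi i\<close> of \<open>q\<close> and summed over \<open>i\<close>; the product rule yields
  the two cell terms.\<close>

lemma parts_cell:
  assumes T: "T \<in> \<T>" and w: "w \<in> cell_polys m" and q: "q \<in> cell_polys l"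
  shows "ip_cell_vec T (grad w) (grad q) = - ip_cell T w (laplacian q) +
    (\<Sum>F\<in>cfaces T. \<integral>x. w x * (face_normal T F \<bullet> grad q x) \<partial>surface_measure F)"
proof -
  have oT: "open T" and bT: "bounded T" using open_cell bounded_cell T by auto
  note int = cell_polys_integrable_on[OF oT bT]
  define qi where "qi i x = grad q x $ i" for i x
  have qi: "qi i \<in> cell_polys l" for i
    unfolding qi_def by (rule cell_polys_mono[OF _ grad_cell_polys[OF q]]) simp
  have wq: "(\<lambda>x. w x * qi i x) \<in> cell_polys (m + l)" for i by (rule cell_polys_mult[OF w qi])
  have gr: "grad (\<lambda>x. w x * qi i x) x = w x *\<^sub>R grad (qi i) x + qi i x *\<^sub>R grad w x" for i x
    using GDERIV_mult[OF GDERIV_grad[OF w, of x] GDERIV_grad[OF qi[of i], of x]]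
    by (intro grad_eqI) (simp add: algebra_simps)
  have i1: "integrable (lebesgue_on T) (\<lambda>x. grad (\<lambda>x. w x * qi i x) x $ i)" for i
    by (rule int[OF grad_cell_polys[OF wq]])
  have sum: "(\<Sum>i\<in>UNIV. grad (\<lambda>x. w x * qi i x) x $ i) = w x * laplacian q x + grad w x \<bullet> grad q x" for x
    unfolding gr by (simp add: sum.distrib laplacian_def qi_def[abs_def] inner_vec_def sum_distrib_left mult.commute)
  have i2: "integrable (lebesgue_on T) (\<lambda>x. w x * laplacian q x)"
    by (rule int[OF cell_polys_mult[OF w laplacian_cell_polys[OF q]]])
  have i3: "integrable (lebesgue_on T) (\<lambda>x. grad w x \<bullet> grad q x)"
    unfolding inner_vec_def inner_real_def
    by (intro Bochner_Integration.integrable_sum int[OF cell_polys_mult[OF grad_cell_polys[OF w] grad_cell_polys[OF q]]])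
  have "ip_cell T w (laplacian q) + ip_cell_vec T (grad w) (grad q) =
      (\<integral>x. w x * laplacian q x + grad w x \<bullet> grad q x \<partial>lebesgue_on T)"
    unfolding ip_cell_def ip_cell_vec_def using i2 i3 by simp
  also have "\<dots> = (\<Sum>i\<in>UNIV. \<integral>x. grad (\<lambda>x. w x * qi i x) x $ i \<partial>lebesgue_on T)"
    unfolding sum[symmetric] using i1 by (intro Bochner_Integration.integral_sum) auto
  also have "\<dots> = (\<Sum>i\<in>UNIV. \<Sum>F\<in>cfaces T. \<integral>x. (w x * qi i x) * face_normal T F $ i \<partial>surface_measure F)"
    by (intro sum.cong refl gauss_cell_lebesgue[OF T wq])
  also have "\<dots> = (\<Sum>F\<in>cfaces T. \<Sum>i\<in>UNIV. \<integral>x. (w x * qi i x) * face_normal T F $ i \<partial>surface_measure F)"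
    by (rule sum.swap)
  also have "\<dots> = (\<Sum>F\<in>cfaces T. \<integral>x. w x * (face_normal T F \<bullet> grad q x) \<partial>surface_measure F)"
  proof (rule sum.cong[OF refl])
    fix F assume F: "F \<in> cfaces T"
    have "(\<Sum>i\<in>UNIV. \<integral>x. (w x * qi i x) * face_normal T F $ i \<partial>surface_measure F) =
       (\<integral>x. (\<Sum>i\<in>UNIV. (w x * qi i x) * face_normal T F $ i) \<partial>surface_measure F)"
      by (intro Bochner_Integration.integral_sum[symmetric] surface_integrable[OF cfaces_faces[OF F]] continuous_intros
          cell_polys_continuous[OF w] cell_polys_continuous[OF qi])
    also have "\<dots> = (\<integral>x. w x * (face_normal T F \<bullet> grad q x) \<partial>surface_measure F)"
      by (simp add: inner_vec_def sum_distrib_left qi_def mult_ac)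
    finally show "(\<Sum>i\<in>UNIV. \<integral>x. (w x * qi i x) * face_normal T F $ i \<partial>surface_measure F) = \<dots>" .
  qed
  finally show ?thesis by simp
qed

lemma hho_cell: "T \<in> \<T> \<Longrightarrow> hho_cell T (cfaces T)"
proof
  assume T: "T \<in> \<T>"
  show "open T" "bounded T" using open_cell bounded_cell T by auto
  show "T \<noteq> {}" using mesh T by (simp add: is_mesh_def)
  show "finite (cfaces T)" by (rule finite_cfaces)
  show "space (surface_measure F) = F" if "F \<in> cfaces T" for F
    by (rule space_surface_measure[OF cfaces_faces[OF that]])
  show "integrable (surface_measure F) v" if "F \<in> cfaces T" "v \<in> cell_polys m" for F m v
    by (rule surface_integrable[OF cfaces_faces[OF that(1)] cell_polys_continuous[OF that(2)]])
  show "v x = 0" if "F \<in> cfaces T" "v \<in> cell_polys m" "(\<integral>x. v x * v x \<partial>surface_measure F) = 0" "x \<in> F" for F m v x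
    by (rule surface_definite[OF cfaces_faces[OF that(1)] that(2-4)])
  show "face_polys m F = (\<lambda>v. restrict v F) ` cell_polys m" if "F \<in> cfaces T" for F m
    by (rule face_polys_eq_restrictions[OF hypH[OF face_plane(1)[OF cfaces_faces[OF that]]]])
  show "ip_cell_vec T (grad w) (grad q) = - ip_cell T w (laplacian q) +
      (\<Sum>F\<in>cfaces T. \<integral>x. w x * (face_normal T F \<bullet> grad q x) \<partial>surface_measure F)"
    if "w \<in> cell_polys m" "q \<in> cell_polys l" for w q m l
    by (rule parts_cell[OF T that])
qed

lemma hho_space_local:
  assumes w: "w \<in> hho_space k \<Omega> \<T>" and T: "T \<in> \<T>"
  shows "fst w T \<in> cell_polys k" "restrict (snd w) (cfaces T) \<in> bd_space k (cfaces T)"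
  using w T cfaces_faces by (auto simp: hho_space_def bd_space_def PiE_iff)

lemma flux_in_bd_space:
  assumes u: "u \<in> hho_space k \<Omega> \<T>" and T: "T \<in> \<T>"
  shows "flux_at k \<Omega> \<T> u T \<in> bd_space k (cfaces T)"
  unfolding flux_at_def local_comp_def
  by (rule hho_cell.num_flux_in_bd_space[OF hho_cell[OF T] hho_space_local[OF u T]])

section \<open>From cell identities to the global problem\<close>

definition cell_balance :: "nat \<Rightarrow> 'd hho \<Rightarrow> (real^'d) set \<Rightarrow> (real^'d \<Rightarrow> real) \<Rightarrow> real" where
  "cell_balance k u T q = ip_cell_vec T (grad (recon_at k \<Omega> \<T> u T)) (grad q) +
     ip_bd (cfaces T) (flux_at k \<Omega> \<T> u T) (bd_trace (cfaces T) q)"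

lemma flux_balance_iff:
  "flux_balance k \<Omega> \<T> f u \<longleftrightarrow> (\<forall>T\<in>\<T>. \<forall>q\<in>cell_polys k. cell_balance k u T q = ip_cell T f q)"
  by (simp add: flux_balance_def cell_balance_def)

lemma cell_balance_0: "T \<in> \<T> \<Longrightarrow> cell_balance k u T (\<lambda>x. 0) = 0"
proof -
  assume T: "T \<in> \<T>"
  have "ip_bd (cfaces T) (flux_at k \<Omega> \<T> u T) (bd_trace (cfaces T) (\<lambda>x. 0)) = ip_bd (cfaces T) (flux_at k \<Omega> \<T> u T) (\<lambda>F x. 0)"
    by (rule hho_cell.ip_bd_cong[OF hho_cell[OF T]]) (auto simp: bd_trace_def)
  then show ?thesis by (simp add: cell_balance_def ip_cell_vec_def grad_const ip_bd_def)
qed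

abbreviation face_term :: "nat \<Rightarrow> 'd hho \<Rightarrow> 'd hho \<Rightarrow> (real^'d) set \<Rightarrow> (real^'d) set \<Rightarrow> real" where
  "face_term k u w T F \<equiv> \<integral>x. flux_at k \<Omega> \<T> u T F x * snd w F x \<partial>surface_measure F"

text \<open>Sums \<open>local_identity\<close> over the cells and exchanges cells with faces, so
  that each face collects the fluxes of its cells against the same unknown. Testing then amounts to
  choosing \<open>w\<close>.\<close>

lemma a_h_eq:
  assumes u: "u \<in> hho_space k \<Omega> \<T>" and w: "w \<in> hho_space k \<Omega> \<T>"
  shows "a_h k \<Omega> \<T> u w = (\<Sum>T\<in>\<T>. cell_balance k u T (fst w T)) -
    (\<Sum>F\<in>faces \<Omega> \<T>. \<Sum>T\<in>{T \<in> \<T>. F \<in> cfaces T}. face_term k u w T F)"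
proof -
  have "a_h k \<Omega> \<T> u w = (\<Sum>T\<in>\<T>. cell_balance k u T (fst w T) - ip_bd (cfaces T) (flux_at k \<Omega> \<T> u T) (snd w))"
    unfolding a_h_def
  proof (rule sum.cong[OF refl])
    fix T assume T: "T \<in> \<T>"
    interpret hho_cell T "cfaces T" k by (rule hho_cell[OF T])
    have "ip_bd (cfaces T) (flux_at k \<Omega> \<T> u T) (snd w) = ip_bd (cfaces T) (flux_at k \<Omega> \<T> u T) (restrict (snd w) (cfaces T))"
      by (rule ip_bd_cong) auto
    then show "ip_cell_vec T (grad (recon_at k \<Omega> \<T> u T)) (grad (recon_at k \<Omega> \<T> w T)) +
        inverse (diameter T) * ip_bd (cfaces T) (stab_at k \<Omega> \<T> u T) (stab_at k \<Omega> \<T> w T) =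
        cell_balance k u T (fst w T) - ip_bd (cfaces T) (flux_at k \<Omega> \<T> u T) (snd w)"
      using local_identity[OF hho_space_local[OF u T] hho_space_local[OF w T]]
      by (simp add: cell_balance_def recon_at_def stab_at_def flux_at_def local_comp_def)
  qed
  also have "\<dots> = (\<Sum>T\<in>\<T>. cell_balance k u T (fst w T)) -
      (\<Sum>T\<in>\<T>. \<Sum>F\<in>cfaces T. face_term k u w T F)"
    by (simp add: sum_subtractf ip_bd_def)
  also have "(\<Sum>T\<in>\<T>. \<Sum>F\<in>cfaces T. face_term k u w T F) =
      (\<Sum>T\<in>\<T>. \<Sum>F\<in>{F \<in> faces \<Omega> \<T>. F \<in> cfaces T}. face_term k u w T F)"
    by (intro sum.cong refl) (auto simp: cell_faces_def)
  also have "\<dots> = (\<Sum>F\<in>faces \<Omega> \<T>. \<Sum>T\<in>{T \<in> \<T>. F \<in> cfaces T}. face_term k u w T F)"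
    by (rule sum.swap_restrict[OF finT finite_faces])
  finally show ?thesis .
qed

lemma interface_cell_set:
  assumes i: "is_interface \<T> Tm Tp F"
  shows "{T \<in> \<T>. F \<in> cfaces T} = {Tm, Tp}"
  using interface_cells[OF i] interface_affine_hull(1,2)[OF i] by auto

lemma load_eq:
  assumes f: "L2_fun \<Omega> f" and w: "w \<in> hho_space k \<Omega> \<T>"
  shows "ip_cell \<Omega> f (broken \<T> (fst w)) = (\<Sum>T\<in>\<T>. ip_cell T f (fst w T))"
proof -
  have oO: "open \<Omega>" and bO: "bounded \<Omega>" using open_cell bounded_cell by auto
  have fm: "f \<in> borel_measurable (lebesgue_on \<Omega>)" and f2: "integrable (lebesgue_on \<Omega>) (\<lambda>x. (f x)\<^sup>2)"
    using f by (auto simp: L2_fun_def)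
  have int: "integrable (lebesgue_on \<Omega>) (\<lambda>x. f x * (indicator T x * fst w T x))" if T: "T \<in> \<T>" for T
  proof -
    have wT: "fst w T \<in> cell_polys k" by (rule hho_space_local(1)[OF w T])
    have Tm: "T \<in> sets lebesgue" using open_cell[of T] T by (auto intro: borel_open)
    have "indicator T \<in> borel_measurable (lebesgue_on \<Omega>)"
      using borel_measurable_indicator[OF Tm] by (rule measurable_restrict_space1)
    moreover have "fst w T \<in> borel_measurable (lebesgue_on \<Omega>)"
      using borel_measurable_integrable[OF cell_polys_integrable_on[OF oO bO wT]] .
    ultimately have m: "(\<lambda>x. f x * (indicator T x * fst w T x)) \<in> borel_measurable (lebesgue_on \<Omega>)"
      using fm by measurable
    show ?thesis
    proof (rule Bochner_Integration.integrable_bound[OF _ m])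
      show "integrable (lebesgue_on \<Omega>) (\<lambda>x. (f x)\<^sup>2 + fst w T x * fst w T x)"
        using f2 cell_polys_integrable_on[OF oO bO cell_polys_mult[OF wT wT]] by simp
      \<comment> \<open>The product with \<open>f\<close> is dominated by the sum of the squares,
        both integrable: \<open>f\<close> is square integrable and the polynomial is bounded on
        \<open>\<Omega>\<close>.\<close>
      have "\<bar>a * b\<bar> \<le> a\<^sup>2 + b * b" for a b :: real
      proof -
        have "2 * (\<bar>a\<bar> * \<bar>b\<bar>) \<le> a\<^sup>2 + b\<^sup>2" using sum_squares_bound[of "\<bar>a\<bar>" "\<bar>b\<bar>"] by simp
        moreover have "0 \<le> \<bar>a\<bar> * \<bar>b\<bar>" by simp
        ultimately show ?thesis unfolding abs_mult power2_eq_square by linarith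
      qed
      then show "AE x in lebesgue_on \<Omega>. norm (f x * (indicator T x * fst w T x)) \<le> norm ((f x)\<^sup>2 + fst w T x * fst w T x)"
        by (intro AE_I2) (auto simp: indicator_def)
    qed
  qed
  have part: "(\<integral>x. f x * (indicator T x * fst w T x) \<partial>lebesgue_on \<Omega>) = ip_cell T f (fst w T)" if T: "T \<in> \<T>" for T
  proof -
    have ms: "\<Omega> \<inter> space lebesgue \<in> sets lebesgue" "T \<inter> space lebesgue \<in> sets lebesgue"
      using open_cell[of T] T oO by (auto intro: borel_open)
    have "(\<integral>x. f x * (indicator T x * fst w T x) \<partial>lebesgue_on \<Omega>) = (\<integral>x. indicator \<Omega> x * (f x * (indicator T x * fst w T x)) \<partial>lebesgue)"
      using integral_restrict_space[OF ms(1), of "\<lambda>x. f x * (indicator T x * fst w T x)"] by simp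
    also have "\<dots> = (\<integral>x. indicator T x * (f x * fst w T x) \<partial>lebesgue)"
      using cell_subset_domain[OF T] by (intro Bochner_Integration.integral_cong) (auto simp: indicator_def)
    also have "\<dots> = ip_cell T f (fst w T)"
      unfolding ip_cell_def using integral_restrict_space[OF ms(2), of "\<lambda>x. f x * fst w T x"] by simp
    finally show ?thesis .
  qed
  have "ip_cell \<Omega> f (broken \<T> (fst w)) = (\<integral>x. (\<Sum>T\<in>\<T>. f x * (indicator T x * fst w T x)) \<partial>lebesgue_on \<Omega>)"
    by (simp add: ip_cell_def broken_def sum_distrib_left)
  also have "\<dots> = (\<Sum>T\<in>\<T>. \<integral>x. f x * (indicator T x * fst w T x) \<partial>lebesgue_on \<Omega>)"
    using int by (intro Bochner_Integration.integral_sum) auto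
  finally show ?thesis using part by simp
qed

lemma face_polys_face:
  "F \<in> faces \<Omega> \<T> \<Longrightarrow> v \<in> cell_polys k \<Longrightarrow> restrict v F \<in> face_polys k F"
  using face_polys_eq_restrictions[OF hypH[OF face_plane(1)]] by blast

lemma balance_of_solution:
  assumes f: "L2_fun \<Omega> f" and u: "solves_hho k \<Omega> \<T> f u"
  shows "flux_balance k \<Omega> \<T> f u"
  unfolding flux_balance_iff
proof (intro ballI)
  fix T and q :: "real^'d \<Rightarrow> real" assume T: "T \<in> \<T>" and q: "q \<in> cell_polys k"
  \<comment> \<open>All face unknowns are zero, so \<open>w\<close> respects the boundary condition
    and the face sum of \<open>a_h_eq\<close> drops out.\<close>
  define w :: "'d hho" where "w = (\<lambda>S\<in>\<T>. if S = T then q else (\<lambda>x. 0), \<lambda>F\<in>faces \<Omega> \<T>. \<lambda>x\<in>F. 0)"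
  have w: "w \<in> hho_space k \<Omega> \<T>"
    using q face_polys_face[OF _ cell_polys_const] by (auto simp: w_def hho_space_def cell_polys_const)
  have u': "u \<in> hho_space k \<Omega> \<T>" using u by (auto simp: solves_hho_def hho_space0_def)
  have "w \<in> hho_space0 k \<Omega> \<T>"
    unfolding hho_space0_def using w by (auto simp: w_def faces_def)
  then have "a_h k \<Omega> \<T> u w = (\<Sum>S\<in>\<T>. ip_cell S f (fst w S))"
    using u unfolding solves_hho_def load_eq[OF f w, symmetric] by blast
  moreover have "(\<Sum>F\<in>faces \<Omega> \<T>. \<Sum>S\<in>{S \<in> \<T>. F \<in> cfaces S}. face_term k u w S F) = 0"
  proof (intro sum.neutral ballI)
    fix F S assume F: "F \<in> faces \<Omega> \<T>"
    have "face_term k u w S F = (\<integral>x. 0 \<partial>surface_measure F)"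
      using F space_surface_measure[OF F] by (intro Bochner_Integration.integral_cong) (auto simp: w_def)
    then show "face_term k u w S F = 0" by simp
  qed
  ultimately have "(\<Sum>S\<in>\<T>. cell_balance k u S (fst w S)) = (\<Sum>S\<in>\<T>. ip_cell S f (fst w S))"
    using a_h_eq[OF u' w] by simp
  moreover have "(\<Sum>S\<in>\<T>. cell_balance k u S (fst w S)) = (\<Sum>S\<in>\<T>. if S = T then cell_balance k u T q else 0)"
    by (intro sum.cong) (auto simp: w_def cell_balance_0)
  moreover have "(\<Sum>S\<in>\<T>. ip_cell S f (fst w S)) = (\<Sum>S\<in>\<T>. if S = T then ip_cell T f q else 0)"
    by (intro sum.cong) (auto simp: w_def ip_cell_def)
  ultimately show "cell_balance k u T q = ip_cell T f q" using T finT by simp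
qed

lemma equilibrium_of_solution:
  assumes f: "L2_fun \<Omega> f" and u: "solves_hho k \<Omega> \<T> f u"
  shows "flux_equilibrium k \<Omega> \<T> u"
  unfolding flux_equilibrium_def
proof (intro allI impI ballI)
  fix Tm Tp F x assume i: "is_interface \<T> Tm Tp F" and x: "x \<in> F"
  note I = interface_affine_hull[OF i]
  have F: "F \<in> faces \<Omega> \<T>" using i by (auto simp: faces_def interfaces_def)
  have u': "u \<in> hho_space k \<Omega> \<T>" using u by (auto simp: solves_hho_def hho_space0_def)
  have Fc: "F \<in> cfaces Tm" "F \<in> cfaces Tp" using interface_cells[OF i] I(1,2) by auto
  obtain p where p: "p \<in> cell_polys k" "\<And>x. x \<in> F \<Longrightarrow> flux_at k \<Omega> \<T> u Tm F x = p x"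
    using hho_cell.bd_space_polyE[OF hho_cell[OF I(1)] flux_in_bd_space[OF u' I(1)] Fc(1)] by blast
  obtain q where q: "q \<in> cell_polys k" "\<And>x. x \<in> F \<Longrightarrow> flux_at k \<Omega> \<T> u Tp F x = q x"
    using hho_cell.bd_space_polyE[OF hho_cell[OF I(2)] flux_in_bd_space[OF u' I(2)] Fc(2)] by blast
  define g where "g x = p x + q x" for x
  have g: "g \<in> cell_polys k" unfolding g_def by (rule cell_polys_add[OF p(1) q(1)])
  \<comment> \<open>The sum of the two fluxes, extended by zero to the other faces; the boundary
    condition holds because an interface is never a boundary face.\<close>
  define w :: "'d hho" where "w = (\<lambda>S\<in>\<T>. \<lambda>x. 0, \<lambda>F'\<in>faces \<Omega> \<T>. \<lambda>x\<in>F'. if F' = F then g x else 0)"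
  have "(\<lambda>x\<in>F'. if F' = F then g x else 0) \<in> face_polys k F'" if "F' \<in> faces \<Omega> \<T>" for F'
    using face_polys_face[OF that g] face_polys_face[OF that cell_polys_const[of 0]] by (cases "F' = F") auto
  then have w: "w \<in> hho_space k \<Omega> \<T>"
    by (auto simp: w_def hho_space_def cell_polys_const)
  have "w \<in> hho_space0 k \<Omega> \<T>"
    unfolding hho_space0_def using w interface_not_boundary[OF i] by (auto simp: w_def faces_def)
  then have "a_h k \<Omega> \<T> u w = (\<Sum>S\<in>\<T>. ip_cell S f (fst w S))"
    using u unfolding solves_hho_def load_eq[OF f w, symmetric] by blast
  also have "\<dots> = 0" by (intro sum.neutral) (auto simp: w_def ip_cell_def)
  finally have "a_h k \<Omega> \<T> u w = 0" .
  moreover have "(\<Sum>T\<in>\<T>. cell_balance k u T (fst w T)) = 0"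
    by (intro sum.neutral) (auto simp: w_def cell_balance_0)
  ultimately have "(\<Sum>F'\<in>faces \<Omega> \<T>. \<Sum>T\<in>{T \<in> \<T>. F' \<in> cfaces T}. face_term k u w T F') = 0"
    using a_h_eq[OF u' w] by simp
  also have "(\<Sum>F'\<in>faces \<Omega> \<T>. \<Sum>T\<in>{T \<in> \<T>. F' \<in> cfaces T}. face_term k u w T F') =
     (\<Sum>F'\<in>faces \<Omega> \<T>. if F' = F then \<integral>x. g x * g x \<partial>surface_measure F else 0)"
  proof (rule sum.cong[OF refl])
    fix F' assume F': "F' \<in> faces \<Omega> \<T>"
    show "(\<Sum>T\<in>{T \<in> \<T>. F' \<in> cfaces T}. face_term k u w T F') =
      (if F' = F then \<integral>x. g x * g x \<partial>surface_measure F else 0)"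
    proof (cases "F' = F")
      case True
      have "(\<Sum>T\<in>{T \<in> \<T>. F \<in> cfaces T}. face_term k u w T F) =
         face_term k u w Tm F +
         face_term k u w Tp F"
        unfolding interface_cell_set[OF i] using I(3) by simp
      also have "face_term k u w Tm F = (\<integral>x. p x * g x \<partial>surface_measure F)"
        using F p(2) space_surface_measure[OF F] by (intro Bochner_Integration.integral_cong) (auto simp: w_def)
      also have "face_term k u w Tp F = (\<integral>x. q x * g x \<partial>surface_measure F)"
        using F q(2) space_surface_measure[OF F] by (intro Bochner_Integration.integral_cong) (auto simp: w_def)
      also have "(\<integral>x. p x * g x \<partial>surface_measure F) + (\<integral>x. q x * g x \<partial>surface_measure F) = (\<integral>x. g x * g x \<partial>surface_measure F)"
        using surface_integrable[OF F cell_polys_continuous[OF cell_polys_mult[OF p(1) g]]]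
          surface_integrable[OF F cell_polys_continuous[OF cell_polys_mult[OF q(1) g]]]
        by (simp add: g_def distrib_right)
      finally show ?thesis using True by simp
    next
      case False
      have "face_term k u w T F' = (\<integral>x. 0 \<partial>surface_measure F')" for T
        using F' False space_surface_measure[OF F'] by (intro Bochner_Integration.integral_cong) (auto simp: w_def)
      then show ?thesis using False by simp
    qed
  qed
  also have "\<dots> = (\<integral>x. g x * g x \<partial>surface_measure F)" using F finite_faces by simp
  finally have "g x = 0" by (intro surface_definite[OF F g _ x])
  then show "flux_at k \<Omega> \<T> u Tm F x + flux_at k \<Omega> \<T> u Tp F x = 0" using p(2) q(2) x by (simp add: g_def)
qed

lemma solution_of_equilibrium_balance:
  assumes f: "L2_fun \<Omega> f" and u: "u \<in> hho_space0 k \<Omega> \<T>"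
    and eq: "flux_equilibrium k \<Omega> \<T> u" and bal: "flux_balance k \<Omega> \<T> f u"
  shows "solves_hho k \<Omega> \<T> f u"
  unfolding solves_hho_def
proof (intro conjI ballI u)
  fix w :: "'d hho" assume w0: "w \<in> hho_space0 k \<Omega> \<T>"
  then have w: "w \<in> hho_space k \<Omega> \<T>" and u': "u \<in> hho_space k \<Omega> \<T>" using u by (auto simp: hho_space0_def)
  have "(\<Sum>F\<in>faces \<Omega> \<T>. \<Sum>T\<in>{T \<in> \<T>. F \<in> cfaces T}. face_term k u w T F) = 0"
  proof (rule sum.neutral, rule ballI)
    fix F assume F: "F \<in> faces \<Omega> \<T>"
    have cong: "(\<integral>x. g x \<partial>surface_measure F) = (\<integral>x. h x \<partial>surface_measure F)" if "\<And>x. x \<in> F \<Longrightarrow> g x = h x"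
      for g h :: "real^'d \<Rightarrow> real"
      using that space_surface_measure[OF F] by (intro Bochner_Integration.integral_cong) auto
    from F consider Tm Tp where "is_interface \<T> Tm Tp F" | "F \<in> boundary_faces \<Omega> \<T>"
      unfolding faces_def interfaces_def by blast
    then show "(\<Sum>T\<in>{T \<in> \<T>. F \<in> cfaces T}. face_term k u w T F) = 0"
    proof cases
      case 1
      have "face_term k u w Tp F =
          (\<integral>x. - (flux_at k \<Omega> \<T> u Tm F x * snd w F x) \<partial>surface_measure F)"
      proof (rule cong)
        fix x assume "x \<in> F"
        then have "flux_at k \<Omega> \<T> u Tp F x = - flux_at k \<Omega> \<T> u Tm F x"
          using eq 1 unfolding flux_equilibrium_def by (simp add: eq_neg_iff_add_eq_0 add.commute)
        then show "flux_at k \<Omega> \<T> u Tp F x * snd w F x = - (flux_at k \<Omega> \<T> u Tm F x * snd w F x)" by simp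
      qed
      then show ?thesis unfolding interface_cell_set[OF 1] using interface_affine_hull(3)[OF 1] by simp
    next
      \<comment> \<open>Here the test function itself vanishes on the face.\<close>
      case 2
      have "face_term k u w T F = (\<integral>x. 0 \<partial>surface_measure F)" for T
        by (rule cong) (use w0 2 in \<open>auto simp: hho_space0_def\<close>)
      then show ?thesis by simp
    qed
  qed
  moreover have "(\<Sum>T\<in>\<T>. cell_balance k u T (fst w T)) = (\<Sum>T\<in>\<T>. ip_cell T f (fst w T))"
    using bal hho_space_local(1)[OF w] by (intro sum.cong) (auto simp: flux_balance_iff)
  ultimately show "a_h k \<Omega> \<T> u w = ip_cell \<Omega> f (broken \<T> (fst w))"
    using a_h_eq[OF u' w] load_eq[OF f w] by simp
qed

end

text \<open>The arrangement is collected from the polytopes that describe the domain and the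
  cells.\<close>

lemma polyhedral_mesh_exists:
  assumes "open_polyhedral \<Omega>" "is_mesh \<Omega> \<T>"
  shows "\<exists>\<H>. polyhedral_mesh \<Omega> \<T> \<H>"
proof -
  have fin: "finite (insert \<Omega> \<T>)" using assms(2) by (simp add: is_mesh_def)
  have poly: "open_polyhedral S" if "S \<in> insert \<Omega> \<T>" for S
    using assms that by (auto simp: is_mesh_def)
  obtain \<H> where "finite \<H>" "\<forall>H\<in>\<H>. hyperplane H"
    "\<forall>S\<in>insert \<Omega> \<T>. \<exists>U. (compact U \<and> S = interior U) \<and> arranged \<H> U"
    using arranged_common[OF fin, of "\<lambda>S U. compact U \<and> S = interior U", OF arranged_open_polyhedral[OF poly]] by blast
  then have "polyhedral_mesh \<Omega> \<T> \<H>" using assms(2) by unfold_locales auto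
  then show ?thesis by blast
qed

theorem proposition1p11:
  fixes \<Omega> :: "(real^'d) set" and \<T> :: "(real^'d) set set"
    and k :: nat and f :: "real^'d \<Rightarrow> real"
  assumes "CARD('d) \<ge> 2"
    and "lipschitz_polyhedron \<Omega>"
    and "is_mesh \<Omega> \<T>"
    and "L2_fun \<Omega> f"
  shows "(\<forall>u. solves_hho k \<Omega> \<T> f u \<longrightarrow>
           (\<forall>T\<in>\<T>. flux_at k \<Omega> \<T> u T \<in> bd_space k (cell_faces \<Omega> \<T> T)) \<and>
           flux_equilibrium k \<Omega> \<T> u \<and>
           flux_balance k \<Omega> \<T> f u) \<and>
         (\<forall>u \<in> hho_space0 k \<Omega> \<T>.
           solves_hho k \<Omega> \<T> f u \<longleftrightarrow> flux_equilibrium k \<Omega> \<T> u \<and> flux_balance k \<Omega> \<T> f u)"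
proof -
  obtain \<H> where "polyhedral_mesh \<Omega> \<T> \<H>"
    using polyhedral_mesh_exists assms(2,3) by (auto simp: lipschitz_polyhedron_def)
  then interpret polyhedral_mesh \<Omega> \<T> \<H> .
  have "flux_at k \<Omega> \<T> u T \<in> bd_space k (cell_faces \<Omega> \<T> T)" if "solves_hho k \<Omega> \<T> f u" "T \<in> \<T>" for u T
    using flux_in_bd_space that by (auto simp: solves_hho_def hho_space0_def)
  then show ?thesis
    using equilibrium_of_solution[OF assms(4)] balance_of_solution[OF assms(4)]
      solution_of_equilibrium_balance[OF assms(4)] by blast
qed

end
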